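(* A topological space $X$ is (homeomorphic to) the spectrum of an abelian $\ell$-group $G$ if and only if there is a closed subset $Y$ of a cylinder fan based space $T$ such that $X=Y\setminus\{M\}$ (up to homeomorphism), where $M$ is the only closed point in $Y$.
   Context: An (abelian) $\ell$-group is an abelian group $(G,+,0,-)$ with a lattice order $\leq$ such that $x\leq y$ implies $x+z\leq y+z$; no strong unit is assumed. Its spectrum is the set of prime $\ell$-ideals of $G$ (proper $\ell$-ideals $P$, i.e. proper convex $\ell$-subgroups, such that $x\wedge y\in P$ implies $x\in P$ or $y\in P$), with the Zariski topology generated by the open sets $\{P : a\notin P\}$, $a\in G$. A topological space is spectral if it is sober (every irreducible closed set is the closure of a unique singleton), compact, and its compact open subsets form a basis of the topology closed under intersections of any two members. $\Delta(\mathbb R)=\Gamma(\mathbb Z\ \mathrm{lex}\ \mathbb R,(1,0))$ is the MV-algebra on the interval $[(0,0),(1,0)]$ of the lexicographic product $\mathbb Z\ \mathrm{lex}\ \mathbb R$, with $a\oplus b=(a+b)\wedge(1,0)$ and $\neg a=(1,0)-a$. Its elements are $(0,x)$ with $x\ge 0$ and $(1,x)$ with $x\le 0$. Fans. A subset $\sigma$ of a finite dimensional real vector space is a cone if $\alpha x\in\sigma$ for all $x\in\sigma$, $\alpha>0$; it is simplicial if it is generated by a finite set $S$ of linearly independent vectors, and its faces are the cones generated by subsets of $S$. A fan is a finite set $\phi$ of simplicial closed cones such that every face of a member of $\phi$ is in $\phi$ and the intersection of any two members of $\phi$ is in $\phi$; it is rational if every cone in it is defined by linear inequalities with rational coefficients.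 A fan is identified with the union of its cones when regarded as a subset of the vector space (the empty fan gives the empty set). For a finite set $F$, the radical classes of $\Delta(\mathbb R)^F$ (equivalence classes modulo the radical) are indexed by $v\in\{0,1\}^F$: the class $r_v$ consists of all $((v_i,x_i))_{i\in F}\in\Delta(\mathbb R)^F$, and $\beta_{r_v}$ is the natural bijection, $((v_i,x_i))_i\leftrightarrow (x_i)_i$, between $r_v$ and the quadrant $\{x\in\mathbb R^F : x_i\ge 0 \text{ if } v_i=0,\ x_i\le 0\text{ if } v_i=1\}$. A (rational) fan of $\Delta(\mathbb R)^F$ is a subset of $\Delta(\mathbb R)^F$ whose intersection with every radical class $r$ is the image via $\beta_r$ of a (rational) fan in the corresponding quadrant. For an arbitrary set $I$, a cylinder (rational) fan of $\Delta(\mathbb R)^I$ is a set of the form $\{f\in\Delta(\mathbb R)^I : f|_Y\in P_0\}$ where $Y\subseteq I$ is finite and $P_0\subseteq\Delta(\mathbb R)^Y$ is a rational fan. A topological space $T$ is cylinder fan based if it is spectral and, for some cardinal $k$, possibly infinite, its lattice of compact open sets (ordered by inclusion) is anti-isomorphic to the lattice of cylinder fans of $\Delta(\mathbb R)^k$ (ordered by inclusion). *)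

theory Defs
  imports "HOL-Analysis.Analysis" "HOL-Analysis.Finite_Function_Topology"
    "HOL-Algebra.Group" "HOL-Algebra.Lattice"
begin

section \<open>Abelian \<open>\<ell>\<close>-groups and their spectra\<close>

text \<open>The group is written multiplicatively, following HOL-Algebra.\<close>

record 'a lgroup = "'a monoid" +
  lgroup_le :: "['a, 'a] \<Rightarrow> bool"

definition lgroup_order :: "'a lgroup \<Rightarrow> 'a gorder" where
  "lgroup_order G = \<lparr>carrier = carrier G, eq = (=), le = lgroup_le G\<rparr>"

definition abelian_lgroup :: "'a lgroup \<Rightarrow> bool" where
  "abelian_lgroup G \<longleftrightarrow>
     comm_group G \<and> Lattice.lattice (lgroup_order G) \<and>
     (\<forall>x\<in>carrier G. \<forall>y\<in>carrier G. \<forall>z\<in>carrier G.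
        lgroup_le G x y \<longrightarrow> lgroup_le G (x \<otimes>\<^bsub>G\<^esub> z) (y \<otimes>\<^bsub>G\<^esub> z))"

abbreviation lgroup_meet :: "'a lgroup \<Rightarrow> 'a \<Rightarrow> 'a \<Rightarrow> 'a" where
  "lgroup_meet G x y \<equiv> Lattice.meet (lgroup_order G) x y"

abbreviation lgroup_join :: "'a lgroup \<Rightarrow> 'a \<Rightarrow> 'a \<Rightarrow> 'a" where
  "lgroup_join G x y \<equiv> Lattice.join (lgroup_order G) x y"

definition lideal :: "'a lgroup \<Rightarrow> 'a set \<Rightarrow> bool" where
  "lideal G P \<longleftrightarrow>
     subgroup P G \<and>
     (\<forall>x\<in>P. \<forall>y\<in>P. lgroup_meet G x y \<in> P \<and> lgroup_join G x y \<in> P) \<and>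
     (\<forall>x\<in>P. \<forall>y\<in>P. \<forall>z\<in>carrier G. lgroup_le G x z \<and> lgroup_le G z y \<longrightarrow> z \<in> P)"

definition prime_lideal :: "'a lgroup \<Rightarrow> 'a set \<Rightarrow> bool" where
  "prime_lideal G P \<longleftrightarrow>
     lideal G P \<and> P \<noteq> carrier G \<and>
     (\<forall>x\<in>carrier G. \<forall>y\<in>carrier G. lgroup_meet G x y \<in> P \<longrightarrow> x \<in> P \<or> y \<in> P)"

text \<open>Every prime \<open>\<ell>\<close>-ideal is proper, so the generating sets cover the set of all of them, which is
  therefore the \<^const>\<open>topspace\<close>.\<close>

definition lgroup_spectrum :: "'a lgroup \<Rightarrow> 'a set topology" where
  "lgroup_spectrum G =
     topology_generated_by {{P. prime_lideal G P \<and> a \<notin> P} | a. a \<in> carrier G}"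


section \<open>Spectral spaces\<close>

definition irreducible_closedin :: "'a topology \<Rightarrow> 'a set \<Rightarrow> bool" where
  "irreducible_closedin T C \<longleftrightarrow>
     closedin T C \<and> C \<noteq> {} \<and>
     (\<forall>A B. closedin T A \<and> closedin T B \<and> C = A \<union> B \<longrightarrow> C = A \<or> C = B)"

definition sober_space :: "'a topology \<Rightarrow> bool" where
  "sober_space T \<longleftrightarrow>
     (\<forall>C. irreducible_closedin T C \<longrightarrow> (\<exists>!x. x \<in> topspace T \<and> C = T closure_of {x}))"

definition compact_opens :: "'a topology \<Rightarrow> 'a set set" where
  "compact_opens T = {U. compactin T U \<and> openin T U}"

definition spectral_space :: "'a topology \<Rightarrow> bool" where
  "spectral_space T \<longleftrightarrow>
     sober_space T \<and> compact_space T \<and>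
     openin T = arbitrary union_of (\<lambda>U. U \<in> compact_opens T) \<and>
     (\<forall>U\<in>compact_opens T. \<forall>V\<in>compact_opens T. U \<inter> V \<in> compact_opens T)"


section \<open>Powers of \<open>\<Delta>(\<real>)\<close>\<close>

definition lex_le :: "int \<times> real \<Rightarrow> int \<times> real \<Rightarrow> bool" where
  "lex_le p q \<longleftrightarrow> fst p < fst q \<or> fst p = fst q \<and> snd p \<le> snd q"

text \<open>The universe of the MV-algebra \<open>\<Gamma>(\<int> lex \<real>, (1,0))\<close>.\<close>

definition Delta :: "(int \<times> real) set" where
  "Delta = {p. lex_le (0, 0) p \<and> lex_le p (1, 0)}"

abbreviation Delta_power :: "'i set \<Rightarrow> ('i \<Rightarrow> int \<times> real) set" where
  "Delta_power I \<equiv> I \<rightarrow>\<^sub>E Delta"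


section \<open>Fans\<close>

text \<open>For a finite set \<open>F\<close> of indices, \<open>\<real>\<^sup>F\<close> is the finite dimensional subspace of
  all \<open>x\<close> with \<open>keys x \<subseteq> F\<close> in the real normed space of finitely supported functions.\<close>

definition coordinate_space :: "'i set \<Rightarrow> ('i \<Rightarrow>\<^sub>0 real) set" where
  "coordinate_space F = {x. Poly_Mapping.keys x \<subseteq> F}"

text \<open>\<^term>\<open>convex_cone hull {}\<close> is \<^term>\<open>{0}\<close>, so \<^term>\<open>{0}\<close> is a face of
  every simplicial cone and belongs to every nonempty fan.\<close>

definition simplicial_cone :: "'v::real_vector set \<Rightarrow> bool" where
  "simplicial_cone \<sigma> \<longleftrightarrow> (\<exists>S. finite S \<and> independent S \<and> \<sigma> = convex_cone hull S)"

definition cone_face_of :: "'v::real_vector set \<Rightarrow> 'v set \<Rightarrow> bool" where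
  "cone_face_of \<tau> \<sigma> \<longleftrightarrow>
     (\<exists>S. finite S \<and> independent S \<and> \<sigma> = convex_cone hull S \<and>
          (\<exists>S'\<subseteq>S. \<tau> = convex_cone hull S'))"

definition fan :: "'v::real_normed_vector set set \<Rightarrow> bool" where
  "fan \<phi> \<longleftrightarrow>
     finite \<phi> \<and>
     (\<forall>\<sigma>\<in>\<phi>. simplicial_cone \<sigma> \<and> closed \<sigma>) \<and>
     (\<forall>\<sigma>\<in>\<phi>. \<forall>\<tau>. cone_face_of \<tau> \<sigma> \<longrightarrow> \<tau> \<in> \<phi>) \<and>
     (\<forall>\<sigma>\<in>\<phi>. \<forall>\<tau>\<in>\<phi>. \<sigma> \<inter> \<tau> \<in> \<phi>)"

text \<open>The system of inequalities must be finite: an infinite system of rational ones also cuts out,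
  for instance, the ray through \<open>(1, sqrt 2)\<close>.\<close>

definition rational_cone :: "'i set \<Rightarrow> ('i \<Rightarrow>\<^sub>0 real) set \<Rightarrow> bool" where
  "rational_cone F \<sigma> \<longleftrightarrow>
     (\<exists>A :: ('i \<Rightarrow> rat) set. finite A \<and>
        \<sigma> = {x \<in> coordinate_space F.
               \<forall>a\<in>A. 0 \<le> (\<Sum>i\<in>F. of_rat (a i) * Poly_Mapping.lookup x i)})"

definition rational_fan :: "'i set \<Rightarrow> ('i \<Rightarrow>\<^sub>0 real) set set \<Rightarrow> bool" where
  "rational_fan F \<phi> \<longleftrightarrow> fan \<phi> \<and> (\<forall>\<sigma>\<in>\<phi>. rational_cone F \<sigma>)"

definition radical_class :: "'i set \<Rightarrow> ('i \<Rightarrow> int) \<Rightarrow> ('i \<Rightarrow> int \<times> real) set" where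
  "radical_class F v = {f \<in> Delta_power F. \<forall>i\<in>F. fst (f i) = v i}"

definition quadrant :: "'i set \<Rightarrow> ('i \<Rightarrow> int) \<Rightarrow> ('i \<Rightarrow>\<^sub>0 real) set" where
  "quadrant F v =
     {x \<in> coordinate_space F.
        \<forall>i\<in>F. (v i = 0 \<longrightarrow> 0 \<le> Poly_Mapping.lookup x i) \<and>
               (v i = 1 \<longrightarrow> Poly_Mapping.lookup x i \<le> 0)}"

text \<open>The bijection \<open>\<beta>\<close>, from the quadrant to the radical class.\<close>

definition of_quadrant :: "'i set \<Rightarrow> ('i \<Rightarrow> int) \<Rightarrow> ('i \<Rightarrow>\<^sub>0 real) \<Rightarrow> ('i \<Rightarrow> int \<times> real)" where
  "of_quadrant F v x = (\<lambda>i\<in>F. (v i, Poly_Mapping.lookup x i))"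

definition rational_Delta_fan :: "'i set \<Rightarrow> ('i \<Rightarrow> int \<times> real) set \<Rightarrow> bool" where
  "rational_Delta_fan F P \<longleftrightarrow>
     P \<subseteq> Delta_power F \<and>
     (\<forall>v \<in> F \<rightarrow>\<^sub>E {0, 1}.
        \<exists>\<phi>. rational_fan F \<phi> \<and> \<Union>\<phi> \<subseteq> quadrant F v \<and>
            P \<inter> radical_class F v = of_quadrant F v ` \<Union>\<phi>)"

definition cylinder_fans :: "'i set \<Rightarrow> ('i \<Rightarrow> int \<times> real) set set" where
  "cylinder_fans I =
     {{f \<in> Delta_power I. restrict f F \<in> P} | F P. finite F \<and> F \<subseteq> I \<and> rational_Delta_fan F P}"


section \<open>Cylinder fan based spaces\<close>

text \<open>The index set \<open>K\<close> plays the role of the cardinal. It is a parameter because a definition cannot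
  quantify existentially over the type of its elements.\<close>

definition cylinder_fan_based :: "'k set \<Rightarrow> 't topology \<Rightarrow> bool" where
  "cylinder_fan_based K T \<longleftrightarrow>
     spectral_space T \<and>
     (\<exists>h. bij_betw h (compact_opens T) (cylinder_fans K) \<and>
          (\<forall>U\<in>compact_opens T. \<forall>V\<in>compact_opens T. U \<subseteq> V \<longleftrightarrow> h V \<subseteq> h U))"

end

theory Submission
  imports Defs "HOL-Algebra.FiniteProduct"
begin

text \<open>
  A point of a cylinder fan based space \<open>T\<close> is a prime filter of the lattice of cylinder fans. Since the
  radical classes are cylinder fans, it singles out some \<open>v \<in> {0,1}\<^sup>K\<close> and, within that class, a filter of
  zero sets of \<open>\<ell>\<close>-group terms: by stellar subdivision, the nonempty rational fans in a quadrant
  are exactly these zero sets. This filter is either a prime filter or consists of all zero sets; in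
  the latter case the point is the only closed point of the fibre over \<open>v\<close>. The remaining points of the
  fibre are the prime \<open>\<ell>\<close>-ideals of the \<open>\<ell>\<close>-group \<open>G\<^sub>K\<close> of functions on the positive
  orthant that are given by terms.

  A closed set \<open>Y\<close> with a single closed point \<open>M\<close> therefore lies in one fibre, is cut out there by
  an \<open>\<ell>\<close>-ideal \<open>J\<close> of \<open>G\<^sub>K\<close>, and \<open>Y - {M}\<close> is the spectrum of \<open>G\<^sub>K / J\<close>. Conversely, an \<open>\<ell>\<close>-group \<open>G\<close>
  is generated by its positive elements, so terms over \<open>K = G\<close> can be evaluated in it. What is needed
  is that, for \<open>P\<close> prime, membership in \<open>P\<close> of the value of a term depends only on the zero set of
  the term in the real orthant: modulo \<open>P\<close> the generators form a point of the orthant over a totally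
  ordered group, and any finite sign pattern of integer functionals at such a point occurs at a real one.
\<close>

section \<open>Stellar subdivisions of the positive orthant\<close>

text \<open>The obstacle is that the quotients of \<open>G\<close> by prime ideals are totally
  ordered groups of any kind, whereas fans know only real points. A point is therefore represented
  by the set \<open>Q\<close> of integer functionals that are nonnegative at it. This treats real
  points and points over a quotient alike, and a subdivision step only has to ask for one more sign
  in \<open>Q\<close>. The covering property of a complex is thus proved once and used twice: for
  real points, when a zero set is shown to be a fan, and for points over a quotient, when signs are
  transferred to the reals. The closed point \<open>M\<close> arises because the origin lies in
  every zero set: the family of all terms never produces the empty fan, so it is a point of the
  space, although the ideal belonging to it is the whole group and hence not prime. Removing
  \<open>M\<close> discards exactly this improper ideal.\<close>

definition pair :: "'i set \<Rightarrow> ('i \<Rightarrow> int) \<Rightarrow> ('i \<Rightarrow> 'b::comm_ring_1) \<Rightarrow> 'b" where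
  "pair F l x = (\<Sum>i\<in>F. of_int (l i) * x i)"

definition unit_vec :: "'i \<Rightarrow> 'i \<Rightarrow> int" where
  "unit_vec i = (\<lambda>j. if j = i then 1 else 0)"

text \<open>A set \<open>Q\<close> of integer functionals with this property plays the role of a point of the positive
  orthant, namely the set of functionals that are nonnegative there. The coordinates of the point may
  lie in any totally ordered group.\<close>

definition pos_cone :: "'i set \<Rightarrow> ('i \<Rightarrow> int) set \<Rightarrow> bool" where
  "pos_cone F Q \<longleftrightarrow>
     (\<forall>a\<in>Q. \<forall>b\<in>Q. (\<lambda>i. a i + b i) \<in> Q) \<and>
     (\<forall>a. a \<in> Q \<or> (\<lambda>i. - a i) \<in> Q) \<and>
     (\<forall>i\<in>F. unit_vec i \<in> Q)"

text \<open>The functionals \<open>c\<close> form \<open>N\<close> times the basis dual to \<open>S\<close>; the factor \<open>N\<close> keeps them integral.\<close>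

definition dual_basis ::
  "'i set \<Rightarrow> ('i \<Rightarrow> int) set \<Rightarrow> int \<Rightarrow> (('i \<Rightarrow> int) \<Rightarrow> 'i \<Rightarrow> int) \<Rightarrow> bool" where
  "dual_basis F S N c \<longleftrightarrow> N > 0 \<and>
     (\<forall>s\<in>S. \<forall>t\<in>S. pair F (c s) t = (if s = t then N else 0)) \<and>
     (\<forall>i\<in>F. \<forall>j. (\<Sum>s\<in>S. s i * c s j) = (if i = j then N else 0))"

abbreviation comb :: "(('i \<Rightarrow> int) \<Rightarrow> real) \<Rightarrow> ('i \<Rightarrow> int) set \<Rightarrow> 'i \<Rightarrow> real" where
  "comb c S i \<equiv> \<Sum>s\<in>S. c s * real_of_int (s i)"

text \<open>Only the maximal cones are recorded, by their generators. The uniqueness of coefficients says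
  at once that generators are linearly independent and that two cones meet in a common face. The last
  condition says that the cones cover the orthant, over every totally ordered group.\<close>

definition orthant_complex :: "'i set \<Rightarrow> ('i \<Rightarrow> int) set set \<Rightarrow> bool" where
  "orthant_complex F B \<longleftrightarrow> finite B \<and>
     (\<forall>S\<in>B. finite S \<and> (\<forall>s\<in>S. \<forall>i. 0 \<le> s i \<and> (i \<notin> F \<longrightarrow> s i = 0)) \<and>
        (\<exists>N c. dual_basis F S N c)) \<and>
     (\<forall>S\<in>B. \<forall>T\<in>B. \<forall>(c :: ('i \<Rightarrow> int) \<Rightarrow> real) (d :: ('i \<Rightarrow> int) \<Rightarrow> real).
        (\<forall>s. 0 \<le> c s \<and> 0 \<le> d s \<and> (s \<notin> S \<longrightarrow> c s = 0) \<and> (s \<notin> T \<longrightarrow> d s = 0)) \<and>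
        (\<forall>i. comb c S i = comb d T i) \<longrightarrow> c = d) \<and>
     (\<forall>Q. pos_cone F Q \<longrightarrow> (\<exists>S\<in>B. \<exists>N c. dual_basis F S N c \<and> (\<forall>s\<in>S. c s \<in> Q)))"

section \<open>Point cones, the pairing and dual bases\<close>

lemma pos_cone_add: "pos_cone F Q \<Longrightarrow> a \<in> Q \<Longrightarrow> b \<in> Q \<Longrightarrow> (\<lambda>i. a i + b i) \<in> Q"
  and pos_cone_total: "pos_cone F Q \<Longrightarrow> a \<in> Q \<or> (\<lambda>i. - a i) \<in> Q"
  and pos_cone_unit_vec: "pos_cone F Q \<Longrightarrow> i \<in> F \<Longrightarrow> unit_vec i \<in> Q"
  unfolding pos_cone_def by auto

lemma pos_cone_zero:
  assumes "pos_cone F Q" shows "(\<lambda>i. 0) \<in> Q"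
  using pos_cone_total[OF assms, of "\<lambda>i. 0"] by simp

lemma pos_cone_scale:
  assumes "pos_cone F Q" "a \<in> Q" "0 \<le> n" shows "(\<lambda>i. n * a i) \<in> Q"
  using assms(3)
proof (induction n rule: int_ge_induct)
  case base then show ?case using pos_cone_zero[OF assms(1)] by simp
next
  case (step n)
  have "(\<lambda>i. n * a i + a i) \<in> Q" using pos_cone_add[OF assms(1) step.IH assms(2)] .
  then show ?case by (simp add: algebra_simps)
qed

lemma pos_cone_sum:
  assumes "pos_cone F Q" "finite S" "\<And>s. s \<in> S \<Longrightarrow> f s \<in> Q"
  shows "(\<lambda>i. \<Sum>s\<in>S. f s i) \<in> Q"
  using assms(2,3)
proof (induction S rule: finite_induct)
  case empty show ?case using pos_cone_zero[OF assms(1)] by simp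
next
  case (insert x S)
  have "(\<lambda>i. \<Sum>s\<in>S. f s i) \<in> Q" using insert by simp
  from pos_cone_add[OF assms(1) _ this, of "f x"] show ?case using insert by simp
qed

text \<open>Needed since expansion in a dual basis yields only the multiple \<open>N * l\<close> of
  a functional. If \<open>a\<close> were missing, \<open>n - 1\<close> copies of \<open>- a\<close>
  could be added to \<open>n * a\<close>, and the sum is \<open>a\<close> again.\<close>

lemma pos_cone_divide:
  assumes "pos_cone F Q" "(\<lambda>i. n * a i) \<in> Q" "0 < n" shows "a \<in> Q"
proof (rule ccontr)
  assume "a \<notin> Q"
  then have "(\<lambda>i. - a i) \<in> Q" using pos_cone_total[OF assms(1)] by blast
  from pos_cone_scale[OF assms(1) this, of "n - 1"] assms(3)
  have "(\<lambda>i. (n - 1) * - a i) \<in> Q" by simp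
  from pos_cone_add[OF assms(1,2) this] have "(\<lambda>i. n * a i + (n - 1) * - a i) \<in> Q" .
  then show False using \<open>a \<notin> Q\<close> by (simp add: algebra_simps)
qed

lemma pair_add_right: "pair F l (\<lambda>i. x i + y i) = pair F l x + pair F l y"
  unfolding pair_def by (simp add: sum.distrib algebra_simps)

lemma pair_add_left: "pair F (\<lambda>i. l i + m i) x = pair F l x + pair F m x"
  unfolding pair_def by (simp add: sum.distrib algebra_simps)

lemma pair_diff_left: "pair F (\<lambda>i. l i - m i) x = pair F l x - pair F m x"
  unfolding pair_def by (simp add: sum_subtractf algebra_simps)

lemma pair_minus_left: "pair F (\<lambda>i. - l i) x = - pair F l x"
  unfolding pair_def by (simp add: sum_negf)

lemma pair_scale_right: "pair F l (\<lambda>i. a * x i) = a * pair F l x"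
  unfolding pair_def by (simp add: sum_distrib_left algebra_simps)

lemma pair_scale_left: "pair F (\<lambda>i. a * l i) x = of_int a * pair F l x"
  unfolding pair_def by (simp add: sum_distrib_left algebra_simps)

lemma pair_sum_right: "pair F l (\<lambda>i. \<Sum>s\<in>S. f s i) = (\<Sum>s\<in>S. pair F l (f s))"
  unfolding pair_def by (subst sum.swap) (simp add: sum_distrib_left)

lemma pair_unit_vec:
  assumes "finite F" "i \<in> F" shows "pair F (unit_vec i) x = x i"
proof -
  have "pair F (unit_vec i) x = (\<Sum>j\<in>F. if j = i then x j else 0)"
    unfolding pair_def unit_vec_def by (rule sum.cong) auto
  then show ?thesis using assms by (simp add: sum.delta)
qed

lemma pair_real: "pair F l (\<lambda>i. real_of_int (s i)) = real_of_int (pair F l s)"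
  unfolding pair_def by simp

text \<open>The coefficients of a functional in the dual basis are its values on the generators.
  Hence a functional that is nonnegative on the generators belongs to every point cone that contains
  the dual basis.\<close>

lemma dual_basis_expand:
  assumes "dual_basis F S N c" "finite F" "\<And>i. i \<notin> F \<Longrightarrow> l i = 0"
  shows "(\<Sum>s\<in>S. pair F l s * c s j) = N * l j"
proof -
  have "(\<Sum>s\<in>S. pair F l s * c s j) = (\<Sum>s\<in>S. \<Sum>i\<in>F. l i * (s i * c s j))"
    unfolding pair_def sum_distrib_right by (intro sum.cong) (simp_all add: algebra_simps)
  also have "\<dots> = (\<Sum>i\<in>F. l i * (\<Sum>s\<in>S. s i * c s j))"
    by (subst sum.swap) (simp add: sum_distrib_left)
  also have "\<dots> = (\<Sum>i\<in>F. if i = j then l i * N else 0)"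
    using assms(1) unfolding dual_basis_def by (intro sum.cong) auto
  also have "\<dots> = N * l j" using assms(2,3) by (simp add: sum.delta)
  finally show ?thesis .
qed

text \<open>The counterpart for points: the coordinate of \<open>x\<close> along \<open>s\<close> is
  \<open>pair F (c s) x / N\<close>.\<close>

lemma dual_basis_expand_real:
  fixes x :: "'i \<Rightarrow> real"
  assumes "dual_basis F S N c" "finite F" "i \<in> F"
  shows "(\<Sum>s\<in>S. pair F (c s) x * s i) = N * x i"
proof -
  have "(\<Sum>s\<in>S. pair F (c s) x * s i) = (\<Sum>s\<in>S. \<Sum>j\<in>F. x j * of_int (s i * c s j))"
    unfolding pair_def sum_distrib_right by (intro sum.cong) (simp_all add: algebra_simps)
  also have "\<dots> = (\<Sum>j\<in>F. x j * of_int (\<Sum>s\<in>S. s i * c s j))"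
    by (subst sum.swap) (simp add: sum_distrib_left)
  also have "\<dots> = (\<Sum>j\<in>F. if i = j then x j * N else 0)"
    using assms(1,3) unfolding dual_basis_def by (intro sum.cong) auto
  also have "\<dots> = N * x i" using assms(2,3) by (simp add: sum.delta)
  finally show ?thesis .
qed

text \<open>Solving \<open>w = \<alpha> s + \<beta> t\<close> for \<open>s\<close> turns coordinates
  \<open>p\<close> along \<open>s\<close> and \<open>q\<close> along \<open>t\<close> into
  \<open>p / \<alpha>\<close> along \<open>w\<close> and \<open>q - \<beta> p / \<alpha>\<close>
  along \<open>t\<close>. The new scale \<open>\<alpha> * N\<close> clears the denominators.\<close>

lemma dual_basis_exchange:
  assumes d: "dual_basis F S N c" and fin: "finite S" and st: "s \<in> S" "t \<in> S" "s \<noteq> t"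
    and "0 < \<alpha>" and w: "w = (\<lambda>i. \<alpha> * s i + \<beta> * t i)" "w \<notin> S"
  shows "dual_basis F (insert w (S - {s})) (\<alpha> * N)
    (\<lambda>u. if u = w then c s else if u = t then (\<lambda>j. \<alpha> * c t j - \<beta> * c s j) else (\<lambda>j. \<alpha> * c u j))"
    (is "dual_basis F ?S ?N ?c")
  unfolding dual_basis_def
proof (intro conjI ballI allI)
  have N: "0 < N" and dd: "\<And>u v. u \<in> S \<Longrightarrow> v \<in> S \<Longrightarrow> pair F (c u) v = (if u = v then N else 0)"
    and ee: "\<And>i j. i \<in> F \<Longrightarrow> (\<Sum>s\<in>S. s i * c s j) = (if i = j then N else 0)"
    using d unfolding dual_basis_def by auto
  show "0 < \<alpha> * N" using N \<open>0 < \<alpha>\<close> by simp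
  have pw: "pair F l w = \<alpha> * pair F l s + \<beta> * pair F l t" for l
    unfolding w by (simp add: pair_add_right pair_scale_right)
  have nw: "s \<noteq> w" "t \<noteq> w" "\<And>u. u \<in> S \<Longrightarrow> u \<noteq> w" using st w(2) by auto
  fix u v assume "u \<in> ?S" "v \<in> ?S"
  then show "pair F (?c u) v = (if u = v then ?N else 0)"
    using st nw by (auto simp: pw dd pair_diff_left pair_scale_left)
next
  fix i j assume i: "i \<in> F"
  have nw: "s \<noteq> w" "t \<noteq> w" using st w(2) by auto
  have ee: "(\<Sum>s\<in>S. s i * c s j) = (if i = j then N else 0)"
    using d i unfolding dual_basis_def by auto
  have S: "S = insert s (insert t (S - {s,t}))" using st by auto
  have *: "(\<Sum>u\<in>S - {s,t}. u i * ?c u j) = \<alpha> * (\<Sum>u\<in>S - {s,t}. u i * c u j)"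
    unfolding sum_distrib_left using w(2) by (intro sum.cong) auto
  have S': "?S = insert w (insert t (S - {s,t}))" using st by auto
  have "(\<Sum>u\<in>?S. u i * ?c u j) = w i * c s j + (t i * (\<alpha> * c t j - \<beta> * c s j) + \<alpha> * (\<Sum>u\<in>S - {s,t}. u i * c u j))"
    unfolding S' using fin nw w(2) * by (subst sum.insert; simp)+
  also have "\<dots> = \<alpha> * (s i * c s j + (t i * c t j + (\<Sum>u\<in>S - {s,t}. u i * c u j)))"
    unfolding w by (simp add: algebra_simps)
  also have "s i * c s j + (t i * c t j + (\<Sum>u\<in>S - {s,t}. u i * c u j)) = (\<Sum>u\<in>S. u i * c u j)"
    using fin st(3) by (subst (2) S, subst sum.insert; simp)+
  finally show "(\<Sum>u\<in>?S. u i * ?c u j) = (if i = j then ?N else 0)" using ee by simp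
qed

section \<open>Subdivision of an edge\<close>

definition stellar :: "('i \<Rightarrow> int) set set \<Rightarrow> ('i \<Rightarrow> int) \<Rightarrow> ('i \<Rightarrow> int) \<Rightarrow> ('i \<Rightarrow> int) \<Rightarrow> ('i \<Rightarrow> int) set set" where
  "stellar B s t w = {S \<in> B. \<not> (s \<in> S \<and> t \<in> S)} \<union>
     (\<lambda>S. insert w (S - {s})) ` {S \<in> B. s \<in> S \<and> t \<in> S} \<union>
     (\<lambda>S. insert w (S - {t})) ` {S \<in> B. s \<in> S \<and> t \<in> S}"

lemma stellar_cases:
  assumes "A \<in> stellar B s t w"
  obtains S where "S \<in> B" "A \<subseteq> insert w S" "\<not> (s \<in> A \<and> t \<in> A) \<or> s = w \<or> t = w"
    "w \<in> A \<Longrightarrow> w \<notin> S \<Longrightarrow> s \<in> S \<and> t \<in> S"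
  using assms unfolding stellar_def by blast

lemma orthant_complexD:
  assumes "orthant_complex F B"
  shows "finite B" "\<And>S. S \<in> B \<Longrightarrow> finite S"
    "\<And>S s i. S \<in> B \<Longrightarrow> s \<in> S \<Longrightarrow> 0 \<le> s i" "\<And>S s i. S \<in> B \<Longrightarrow> s \<in> S \<Longrightarrow> i \<notin> F \<Longrightarrow> s i = 0"
    "\<And>S. S \<in> B \<Longrightarrow> \<exists>N c. dual_basis F S N c"
    "\<And>Q. pos_cone F Q \<Longrightarrow> \<exists>S\<in>B. \<exists>N c. dual_basis F S N c \<and> (\<forall>s\<in>S. c s \<in> Q)"
proof -
  note a = assms[unfolded orthant_complex_def]
  note b = a[THEN conjunct1] a[THEN conjunct2, THEN conjunct1]
    a[THEN conjunct2, THEN conjunct2, THEN conjunct2]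
  show "finite B" "\<And>S. S \<in> B \<Longrightarrow> finite S"
    "\<And>S s i. S \<in> B \<Longrightarrow> s \<in> S \<Longrightarrow> 0 \<le> s i" "\<And>S s i. S \<in> B \<Longrightarrow> s \<in> S \<Longrightarrow> i \<notin> F \<Longrightarrow> s i = 0"
    "\<And>S. S \<in> B \<Longrightarrow> \<exists>N c. dual_basis F S N c"
    "\<And>Q. pos_cone F Q \<Longrightarrow> \<exists>S\<in>B. \<exists>N c. dual_basis F S N c \<and> (\<forall>s\<in>S. c s \<in> Q)"
    using b by auto
qed

lemma orthant_complex_unique:
  fixes c d :: "('i \<Rightarrow> int) \<Rightarrow> real"
  assumes "orthant_complex F B" "S \<in> B" "T \<in> B" "\<And>s. 0 \<le> c s" "\<And>s. 0 \<le> d s"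
    "\<And>s. s \<notin> S \<Longrightarrow> c s = 0" "\<And>s. s \<notin> T \<Longrightarrow> d s = 0"
    "\<And>i. comb c S i = comb d T i"
  shows "c = d"
  using assms(1)[unfolded orthant_complex_def, THEN conjunct2, THEN conjunct2, THEN conjunct1,
      rule_format, OF assms(2,3), of c d] assms(4-) by simp

text \<open>If \<open>w\<close> were already a generator, it would have two representations, one
  with positive coefficients at both \<open>s\<close> and \<open>t\<close>, the other with support
  \<open>{w}\<close>. Uniqueness would force \<open>s = w = t\<close>.\<close>

lemma stellar_vertex_new:
  assumes B: "orthant_complex F B" and S: "S \<in> B" "s \<in> S" "t \<in> S" "s \<noteq> t"
    and pos: "0 < \<alpha>" "0 < \<beta>" and w: "w = (\<lambda>i. \<alpha> * s i + \<beta> * t i)" and T: "T \<in> B"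
  shows "w \<notin> T"
proof
  assume "w \<in> T"
  define c where "c = (\<lambda>u. if u = s then real_of_int \<alpha> else if u = t then \<beta> else 0)"
  define d where "d = (\<lambda>u. if u = w then 1 else 0 :: real)"
  have fin: "finite S" "finite T" using orthant_complexD(2)[OF B] S T by auto
  have "c = d"
  proof (rule orthant_complex_unique[OF B S(1) T])
    fix i
    have "comb c S i = comb c {s,t} i"
      using S fin by (intro sum.mono_neutral_right) (auto simp: c_def)
    also have "\<dots> = w i" using S(4) unfolding w c_def by simp
    also have "\<dots> = comb d {w} i" unfolding d_def by simp
    also have "\<dots> = comb d T i"
      using \<open>w \<in> T\<close> fin by (intro sum.mono_neutral_left) (auto simp: d_def)
    finally show "comb c S i = comb d T i" .
  qed (use pos S \<open>w \<in> T\<close> in \<open>auto simp: c_def d_def\<close>)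
  then have "c s = d s" "c t = d t" by auto
  then show False using pos S(4) unfolding c_def d_def by (auto split: if_splits)
qed

text \<open>The coefficients with respect to the old generators, if \<open>w\<close> stands for \<open>a s + b t\<close>.\<close>

definition coarsen ::
  "('i \<Rightarrow> int) \<Rightarrow> ('i \<Rightarrow> int) \<Rightarrow> ('i \<Rightarrow> int) \<Rightarrow> real \<Rightarrow> real \<Rightarrow> (('i \<Rightarrow> int) \<Rightarrow> real) \<Rightarrow> ('i \<Rightarrow> int) \<Rightarrow> real"
  where "coarsen s t w a b c =
    (\<lambda>u. if u = w then 0 else c u + c w * (if u = s then a else if u = t then b else 0))"

text \<open>Every refined cone lies in an old one, and \<open>coarsen\<close> translates the
  coefficients. The last clause records that no refined cone contains both end points of the edge;
  from it the coefficient at \<open>w\<close> can be recovered.\<close>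

lemma stellar_comb:
  fixes c :: "('i \<Rightarrow> int) \<Rightarrow> real"
  assumes A: "A \<in> stellar B s t w" and fin: "\<And>S. S \<in> B \<Longrightarrow> finite S" and st: "s \<noteq> t"
    and new: "\<And>S. S \<in> B \<Longrightarrow> w \<notin> S" "s \<noteq> w" "t \<noteq> w" and w: "w = (\<lambda>i. \<alpha> * s i + \<beta> * t i)"
    and c: "\<And>u. u \<notin> A \<Longrightarrow> c u = 0"
  shows "\<exists>S\<in>B. (\<forall>u. u \<notin> S \<longrightarrow> coarsen s t w \<alpha> \<beta> c u = 0) \<and>
    (\<forall>i. comb (coarsen s t w \<alpha> \<beta> c) S i = comb c A i) \<and> (c s = 0 \<or> c t = 0)"
proof -
  obtain S where S: "S \<in> B" "A \<subseteq> insert w S" "\<not> (s \<in> A \<and> t \<in> A)" "w \<in> A \<Longrightarrow> s \<in> S \<and> t \<in> S"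
    using stellar_cases[OF A] new by metis
  let ?f = "coarsen s t w \<alpha> \<beta> c"
  have fS: "finite S" using fin S by auto
  have wS: "w \<notin> S" using new S by auto
  have 1: "?f u = 0" if "u \<notin> S" for u
  proof (cases "u = w")
    case False
    then have "c u = 0" using that S(2) c by blast
    moreover have "c w = 0 \<or> u \<noteq> s \<and> u \<noteq> t" using that S(4) c by blast
    ultimately show ?thesis by (auto simp: coarsen_def)
  qed (simp add: coarsen_def)
  have 2: "comb ?f S i = comb c A i" for i
  proof -
    have "comb ?f S i = comb c S i + (\<Sum>u\<in>S. c w * (if u = s then \<alpha> else if u = t then \<beta> else 0) * u i)"
      unfolding sum.distrib[symmetric] using wS by (intro sum.cong) (auto simp: algebra_simps coarsen_def)
    also have "(\<Sum>u\<in>S. c w * (if u = s then \<alpha> else if u = t then \<beta> else 0) * u i) = c w * w i"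
    proof (cases "w \<in> A")
      case True
      then have "(\<Sum>u\<in>S. c w * (if u = s then \<alpha> else if u = t then \<beta> else 0) * u i) = (\<Sum>u\<in>{s,t}. c w * (if u = s then \<alpha> else if u = t then \<beta> else 0) * u i)"
        using S(4) fS by (intro sum.mono_neutral_right) auto
      also have "\<dots> = c w * w i" using st by (simp add: w algebra_simps)
      finally show ?thesis .
    qed (use c in simp)
    also have "comb c S i + c w * w i = comb c (insert w S) i"
      using fS wS by simp
    also have "\<dots> = comb c A i"
      using S(2) fS c by (intro sum.mono_neutral_right) auto
    finally show ?thesis .
  qed
  have 3: "c s = 0 \<or> c t = 0" using S(3) c by auto
  show ?thesis using S(1) 1 2 3 by (intro bexI[of _ S] conjI allI impI)
qed

lemma stellar_orthant_complex:
  assumes B: "orthant_complex F B" and S: "S \<in> B" "s \<in> S" "t \<in> S" "s \<noteq> t"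
    and pos: "0 < \<alpha>" "0 < \<beta>" and w: "w = (\<lambda>i. \<alpha> * s i + \<beta> * t i)"
  shows "orthant_complex F (stellar B s t w)"
proof -
  note BD = orthant_complexD[OF B]
  have new: "w \<notin> T" if "T \<in> B" for T using stellar_vertex_new[OF B S pos w that] .
  have nst: "s \<noteq> w" "t \<noteq> w" using new[OF S(1)] S by auto
  have w': "w = (\<lambda>i. \<beta> * t i + \<alpha> * s i)" using w by (simp add: add.commute)
  have 1: "finite (stellar B s t w)" unfolding stellar_def using BD(1) by auto
  have 2: "finite A \<and> (\<forall>u\<in>A. \<forall>i. 0 \<le> u i \<and> (i \<notin> F \<longrightarrow> u i = 0))" if A: "A \<in> stellar B s t w" for A
  proof -
    obtain T where T: "T \<in> B" "A \<subseteq> insert w T" using stellar_cases[OF A] by blast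
    then have "finite A" using BD(2) by (meson finite.insertI finite_subset)
    moreover have "0 \<le> w i \<and> (i \<notin> F \<longrightarrow> w i = 0)" for i
      using BD(3)[OF S(1) S(2)] BD(3)[OF S(1) S(3)] BD(4)[OF S(1) S(2)] BD(4)[OF S(1) S(3)] pos
      unfolding w by simp
    moreover have "0 \<le> u i \<and> (i \<notin> F \<longrightarrow> u i = 0)" if "u \<in> T" for u i
      using BD(3,4)[OF T(1) that] by simp
    ultimately show ?thesis using T(2) by auto
  qed
  have 3: "\<exists>N c. dual_basis F A N c" if "A \<in> stellar B s t w" for A
    using that unfolding stellar_def
  proof (elim UnE imageE; clarsimp)
    fix T assume T: "T \<in> B" "s \<in> T" "t \<in> T"
    obtain N c where "dual_basis F T N c" using BD(5)[OF T(1)] by blast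
    from dual_basis_exchange[OF this BD(2)[OF T(1)] T(2,3) S(4) pos(1) w new[OF T(1)]]
    show "\<exists>N c. dual_basis F (insert w (T - {s})) N c" by blast
  next
    fix T assume T: "T \<in> B" "s \<in> T" "t \<in> T"
    obtain N c where "dual_basis F T N c" using BD(5)[OF T(1)] by blast
    from dual_basis_exchange[OF this BD(2)[OF T(1)] T(3,2) S(4)[symmetric] pos(2) w' new[OF T(1)]]
    show "\<exists>N c. dual_basis F (insert w (T - {t})) N c" by blast
  qed (use BD(5) in blast)
  have 4: "c = d" if A: "A \<in> stellar B s t w" "A' \<in> stellar B s t w"
      and c: "\<And>u. 0 \<le> c u" "\<And>u. 0 \<le> d u" "\<And>u. u \<notin> A \<Longrightarrow> c u = 0" "\<And>u. u \<notin> A' \<Longrightarrow> d u = 0"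
      and e: "\<And>i. comb c A i = comb d A' i" for A A' and c d :: "('a \<Rightarrow> int) \<Rightarrow> real"
  proof -
    let ?f = "coarsen s t w \<alpha> \<beta>"
    obtain T where T0: "T \<in> B" "(\<forall>u. u \<notin> T \<longrightarrow> ?f c u = 0) \<and>
        (\<forall>i. comb (?f c) T i = comb c A i) \<and> (c s = 0 \<or> c t = 0)"
      using stellar_comb[where c=c, OF A(1) BD(2) S(4) new nst w c(3)] ..
    have T: "T \<in> B" "\<And>u. u \<notin> T \<Longrightarrow> ?f c u = 0"
      "\<And>i. comb (?f c) T i = comb c A i" "c s = 0 \<or> c t = 0"
      using T0 by auto
    obtain T' where T'0: "T' \<in> B" "(\<forall>u. u \<notin> T' \<longrightarrow> ?f d u = 0) \<and>
        (\<forall>i. comb (?f d) T' i = comb d A' i) \<and> (d s = 0 \<or> d t = 0)"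
      using stellar_comb[where c=d, OF A(2) BD(2) S(4) new nst w c(4)] ..
    have T': "T' \<in> B" "\<And>u. u \<notin> T' \<Longrightarrow> ?f d u = 0"
      "\<And>i. comb (?f d) T' i = comb d A' i" "d s = 0 \<or> d t = 0"
      using T'0 by auto
    have nn: "0 \<le> ?f c u" "0 \<le> ?f d u" for u using c(1,2)[of u] c(1,2)[of w] pos by (auto simp: coarsen_def)
    have "?f c = ?f d"
      by (rule orthant_complex_unique[OF B T(1) T'(1)]) (use nn T(2,3) T'(2,3) e in auto)
    then have f: "?f c u = ?f d u" for u by metis
    have fs: "c s + c w * \<alpha> = d s + d w * \<alpha>" and ft: "c t + c w * \<beta> = d t + d w * \<beta>"
      using f[of s] f[of t] nst S(4) by (auto simp: coarsen_def)
    \<comment> \<open>By \<open>fs\<close> and \<open>ft\<close> a smaller coefficient at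
      \<open>w\<close> would have to be compensated by strictly larger ones at both \<open>s\<close>
      and \<open>t\<close>, but one of these is zero.\<close>
    have "\<not> c w < d w"
    proof
      assume "c w < d w"
      then have "c w * \<alpha> < d w * \<alpha>" "c w * \<beta> < d w * \<beta>" using pos by auto
      then show False using fs ft T(4) c(2)[of s] c(2)[of t] by linarith
    qed
    moreover have "\<not> d w < c w"
    proof
      assume "d w < c w"
      then have "d w * \<alpha> < c w * \<alpha>" "d w * \<beta> < c w * \<beta>" using pos by auto
      then show False using fs ft T'(4) c(1)[of s] c(1)[of t] by linarith
    qed
    ultimately have ww: "c w = d w" by simp
    show "c = d"
    proof
      fix u show "c u = d u" using f[of u] ww by (cases "u = w") (auto simp: coarsen_def)
    qed
  qed
  have 5: "\<exists>A\<in>stellar B s t w. \<exists>N c. dual_basis F A N c \<and> (\<forall>u\<in>A. c u \<in> Q)" if Q: "pos_cone F Q" for Q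
  proof -
    obtain T N c where T: "T \<in> B" "dual_basis F T N c" "\<And>u. u \<in> T \<Longrightarrow> c u \<in> Q" using BD(6)[OF Q] by blast
    show ?thesis
    proof (cases "s \<in> T \<and> t \<in> T")
      case False
      then have "T \<in> stellar B s t w" unfolding stellar_def using T by auto
      then show ?thesis using T by blast
    next
      case True
      have sc: "(\<lambda>j. n * c u j) \<in> Q" if "u \<in> T" "0 < n" for u n
        using pos_cone_scale[OF Q T(3)[OF that(1)], of n] that by simp
      \<comment> \<open>The first functional is the new coordinate along \<open>t\<close> once
        \<open>s\<close> is exchanged for \<open>w\<close>; its negative is the new coordinate along
        \<open>s\<close> once \<open>t\<close> is exchanged. Its sign decides which half contains
        the point.\<close>
      consider "(\<lambda>j. \<alpha> * c t j - \<beta> * c s j) \<in> Q" | "(\<lambda>j. \<beta> * c s j - \<alpha> * c t j) \<in> Q"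
        using pos_cone_total[OF Q, of "\<lambda>j. \<alpha> * c t j - \<beta> * c s j"] by auto
      then show ?thesis
      proof cases
        case 1
        have "insert w (T - {s}) \<in> stellar B s t w" unfolding stellar_def using T True by auto
        moreover have "dual_basis F (insert w (T - {s})) (\<alpha> * N) (\<lambda>u. if u = w then c s else if u = t
            then (\<lambda>j. \<alpha> * c t j - \<beta> * c s j) else (\<lambda>j. \<alpha> * c u j))" (is "dual_basis _ _ _ ?c")
          using dual_basis_exchange[OF T(2) BD(2)[OF T(1)] _ _ S(4) pos(1) w new[OF T(1)]] True by simp
        moreover have "\<forall>u\<in>insert w (T - {s}). ?c u \<in> Q"
          using True 1 T(3) sc pos by auto
        ultimately show ?thesis by (intro bexI exI conjI)
      next
        case 2
        have "insert w (T - {t}) \<in> stellar B s t w" unfolding stellar_def using T True by auto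
        moreover have "dual_basis F (insert w (T - {t})) (\<beta> * N) (\<lambda>u. if u = w then c t else if u = s
            then (\<lambda>j. \<beta> * c s j - \<alpha> * c t j) else (\<lambda>j. \<beta> * c u j))" (is "dual_basis _ _ _ ?c")
          using dual_basis_exchange[OF T(2) BD(2)[OF T(1)] _ _ S(4)[symmetric] pos(2) w' new[OF T(1)]] True by simp
        moreover have "\<forall>u\<in>insert w (T - {t}). ?c u \<in> Q"
          using True 2 T(3) sc pos by auto
        ultimately show ?thesis by (intro bexI exI conjI)
      qed
    qed
  qed
  show ?thesis unfolding orthant_complex_def
    apply (intro conjI)
    subgoal by (rule 1)
    subgoal using 2 3 by simp
    subgoal using 4 by simp
    subgoal using 5 by simp
    done
qed

text \<open>The unit vectors are their own dual basis, with \<open>N = 1\<close>, and the covering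
  property is the clause of \<open>pos_cone\<close> on unit vectors.\<close>

lemma orthant_complex_standard:
  assumes "finite F" shows "orthant_complex F {unit_vec ` F}"
proof -
  have inj: "inj_on unit_vec F" unfolding inj_on_def unit_vec_def by (metis zero_neq_one)
  have eval: "(\<Sum>s\<in>unit_vec ` F. c s * of_int (s i)) = (if i \<in> F then c (unit_vec i) else 0)"
    for c :: "('a \<Rightarrow> int) \<Rightarrow> 'b::comm_ring_1" and i
  proof -
    have "(\<Sum>s\<in>unit_vec ` F. c s * of_int (s i)) = (\<Sum>j\<in>F. if j = i then c (unit_vec j) else 0)"
      unfolding sum.reindex[OF inj] unit_vec_def by (auto intro!: sum.cong)
    then show ?thesis using assms by (simp add: sum.delta)
  qed
  have dual: "dual_basis F (unit_vec ` F) 1 (\<lambda>s. s)"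
    unfolding dual_basis_def
  proof (intro conjI ballI allI)
    fix s t :: "'a \<Rightarrow> int" assume "s \<in> unit_vec ` F" "t \<in> unit_vec ` F"
    then obtain i j where ij: "s = unit_vec i" "i \<in> F" "t = unit_vec j" by auto
    then have "pair F s t = unit_vec j i" using pair_unit_vec[OF assms] by simp
    moreover have "unit_vec i = unit_vec j \<longleftrightarrow> i = j"
      unfolding unit_vec_def by (metis zero_neq_one)
    ultimately show "pair F s t = (if s = t then 1 else 0)"
      using ij by (simp add: unit_vec_def)
  next
    fix i j assume "i \<in> F"
    then show "(\<Sum>s\<in>unit_vec ` F. s i * s j) = (if i = j then 1 else 0)"
      using eval[of "\<lambda>s. s j" i] by (auto simp: unit_vec_def algebra_simps)
  qed simp
  have uniq: "c = d" if "\<And>s. s \<notin> unit_vec ` F \<Longrightarrow> c s = 0" "\<And>s. s \<notin> unit_vec ` F \<Longrightarrow> d s = 0"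
    "\<And>i. (\<Sum>s\<in>unit_vec ` F. c s * s i) = (\<Sum>s\<in>unit_vec ` F. d s * s i)" for c d :: "('a \<Rightarrow> int) \<Rightarrow> real"
  proof
    fix s show "c s = d s"
    proof (cases "s \<in> unit_vec ` F")
      case True
      then obtain i where "i \<in> F" "s = unit_vec i" by auto
      then show ?thesis using that(3)[of i] eval[of c i] eval[of d i] by simp
    qed (use that in simp)
  qed
  have nn: "\<forall>s\<in>unit_vec ` F. \<forall>i. 0 \<le> s i \<and> (i \<notin> F \<longrightarrow> s i = 0)" by (auto simp: unit_vec_def)
  show ?thesis unfolding orthant_complex_def
    apply (intro conjI)
    subgoal by simp
    subgoal using assms nn dual by auto
    subgoal using uniq by simp
    subgoal using dual pos_cone_unit_vec by (intro allI impI bexI exI conjI) auto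
    done
qed

section \<open>Complexes on whose cones given functionals keep their sign\<close>

definition sign_definite :: "'i set \<Rightarrow> ('i \<Rightarrow> int) set \<Rightarrow> ('i \<Rightarrow> int) \<Rightarrow> bool" where
  "sign_definite F S l \<longleftrightarrow> (\<forall>s\<in>S. 0 \<le> pair F l s) \<or> (\<forall>s\<in>S. pair F l s \<le> 0)"

definition bad_edges :: "'i set \<Rightarrow> ('i \<Rightarrow> int) \<Rightarrow> ('i \<Rightarrow> int) set set \<Rightarrow> (('i \<Rightarrow> int) \<times> ('i \<Rightarrow> int)) set" where
  "bad_edges F l B = {(s, t). 0 < pair F l s \<and> pair F l t < 0 \<and> (\<exists>S\<in>B. s \<in> S \<and> t \<in> S)}"

text \<open>Refining for a further functional must not spoil those already treated: the value at the
  new vertex is a positive combination of the values at \<open>s\<close> and \<open>t\<close>, which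
  do not have opposite signs.\<close>

lemma stellar_sign_definite:
  assumes S: "S \<in> B" "s \<in> S" "t \<in> S" and pos: "0 < \<alpha>" "0 < \<beta>"
    and w: "w = (\<lambda>i. \<alpha> * s i + \<beta> * t i)"
    and sd: "\<And>S. S \<in> B \<Longrightarrow> sign_definite F S l" and A: "A \<in> stellar B s t w"
  shows "sign_definite F A l"
proof -
  have pw: "pair F l w = \<alpha> * pair F l s + \<beta> * pair F l t"
    unfolding w by (simp add: pair_add_right pair_scale_right)
  have *: "sign_definite F (insert w T) l" if T: "T \<in> B" "s \<in> T" "t \<in> T" for T
  proof -
    consider "\<forall>s\<in>T. 0 \<le> pair F l s" | "\<forall>s\<in>T. pair F l s \<le> 0"
      using sd[OF T(1)] unfolding sign_definite_def by blast
    then show ?thesis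
    proof cases
      case 1 then show ?thesis using T pos pw unfolding sign_definite_def by auto
    next
      case 2
      then have "\<alpha> * pair F l s \<le> 0" "\<beta> * pair F l t \<le> 0" using T pos by (auto simp: mult_le_0_iff)
      then show ?thesis using 2 pw unfolding sign_definite_def by auto
    qed
  qed
  show ?thesis using A unfolding stellar_def
  proof (elim UnE imageE; clarsimp)
    fix T assume "T \<in> B" "s \<in> T" "t \<in> T"
    then show "sign_definite F (insert w (T - {s})) l" using * unfolding sign_definite_def by blast
  next
    fix T assume "T \<in> B" "s \<in> T" "t \<in> T"
    then show "sign_definite F (insert w (T - {t})) l" using * unfolding sign_definite_def by blast
  qed (use sd in blast)
qed

text \<open>An edge with end points on both sides of the hyperplane \<open>l = 0\<close> is subdivided at its intersection
  with the hyperplane. This removes the edge without creating new ones of this kind.\<close>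

lemma refine_sign_definite:
  assumes "orthant_complex F B" "\<And>S m. S \<in> B \<Longrightarrow> m \<in> D \<Longrightarrow> sign_definite F S m"
  shows "\<exists>B'. orthant_complex F B' \<and> (\<forall>S\<in>B'. \<forall>m\<in>insert l D. sign_definite F S m)"
  using assms
proof (induction "card (bad_edges F l B)" arbitrary: B rule: less_induct)
  case less
  show ?case
  proof (cases "bad_edges F l B = {}")
    case True
    then have "sign_definite F S l" if "S \<in> B" for S
      using that unfolding bad_edges_def sign_definite_def by (auto, meson not_le)
    then show ?thesis using less by blast
  next
    case False
    then obtain s t S where st: "0 < pair F l s" "pair F l t < 0" "S \<in> B" "s \<in> S" "t \<in> S"
      unfolding bad_edges_def by auto
    \<comment> \<open>With these weights the contributions of \<open>s\<close> and \<open>t\<close>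
      to the value of \<open>l\<close> at \<open>w\<close> cancel. Both are positive because
      \<open>l\<close> changes sign along the edge.\<close>
    define \<alpha> where "\<alpha> = - pair F l t"
    define \<beta> where "\<beta> = pair F l s"
    define w where "w = (\<lambda>i. \<alpha> * s i + \<beta> * t i)"
    have pos: "0 < \<alpha>" "0 < \<beta>" using st unfolding \<alpha>_def \<beta>_def by auto
    have ne: "s \<noteq> t" using st by auto
    have "pair F l w = \<alpha> * pair F l s + \<beta> * pair F l t"
      unfolding w_def by (simp add: pair_add_right pair_scale_right)
    then have pw: "pair F l w = 0" unfolding \<alpha>_def \<beta>_def by simp
    have oc: "orthant_complex F (stellar B s t w)"
      using stellar_orthant_complex[OF less(2) st(3,4,5) ne pos w_def] .
    have "bad_edges F l (stellar B s t w) \<subseteq> bad_edges F l B - {(s,t)}"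
    proof
      fix p assume "p \<in> bad_edges F l (stellar B s t w)"
      then obtain u v A where p: "p = (u,v)" "0 < pair F l u" "pair F l v < 0" "A \<in> stellar B s t w" "u \<in> A" "v \<in> A"
        unfolding bad_edges_def by auto
      have nw: "u \<noteq> w" "v \<noteq> w" "s \<noteq> w" "t \<noteq> w" using p pw st by auto
      obtain T where "T \<in> B" "A \<subseteq> insert w T" "\<not> (s \<in> A \<and> t \<in> A)"
        using stellar_cases[OF p(4)] nw by metis
      then show "p \<in> bad_edges F l B - {(s,t)}" using p nw unfolding bad_edges_def by auto
    qed
    moreover have "(s,t) \<in> bad_edges F l B" using st unfolding bad_edges_def by auto
    moreover have "finite (bad_edges F l B)"
    proof (rule finite_subset)
      show "bad_edges F l B \<subseteq> \<Union>B \<times> \<Union>B" unfolding bad_edges_def by auto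
      show "finite (\<Union>B \<times> \<Union>B)" using orthant_complexD(1,2)[OF less(2)] by auto
    qed
    ultimately have "card (bad_edges F l (stellar B s t w)) < card (bad_edges F l B)"
      by (intro psubset_card_mono) auto
    from less(1)[OF this oc] show ?thesis
      using stellar_sign_definite[OF st(3,4,5) pos w_def less(3)] by blast
  qed
qed

lemma exists_sign_definite_complex:
  assumes "finite F" "finite D"
  shows "\<exists>B. orthant_complex F B \<and> (\<forall>S\<in>B. \<forall>l\<in>D. sign_definite F S l)"
  using assms(2)
proof (induction D rule: finite_induct)
  case empty show ?case using orthant_complex_standard[OF assms(1)] by blast
next
  case (insert l D)
  then show ?case using refine_sign_definite by metis
qed

section \<open>Terms and piecewise linear functions\<close>

datatype (lvars: 'i) lterm = LVar 'i | LZero | LAdd "'i lterm" "'i lterm" | LNeg "'i lterm"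
  | LSup "'i lterm" "'i lterm"

text \<open>The absolute value makes a variable range over the nonnegative reals and lets the same term
  describe a function on each quadrant.\<close>

primrec leval :: "'i lterm \<Rightarrow> ('i \<Rightarrow> real) \<Rightarrow> real" where
  "leval (LVar i) x = \<bar>x i\<bar>"
| "leval LZero x = 0"
| "leval (LAdd s t) x = leval s x + leval t x"
| "leval (LNeg t) x = - leval t x"
| "leval (LSup s t) x = max (leval s x) (leval t x)"

definition zero_set :: "'i lterm \<Rightarrow> ('i \<Rightarrow> real) set" where
  "zero_set t = {x. leval t x = 0}"

text \<open>The functional that agrees with a term near the point given by \<open>Q\<close>; the comparisons that may
  occur in its computation are collected in \<open>crit\<close>.\<close>

primrec lin :: "('i \<Rightarrow> int) set \<Rightarrow> 'i lterm \<Rightarrow> 'i \<Rightarrow> int" where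
  "lin Q (LVar i) = unit_vec i"
| "lin Q LZero = (\<lambda>j. 0)"
| "lin Q (LAdd s t) = (\<lambda>j. lin Q s j + lin Q t j)"
| "lin Q (LNeg t) = (\<lambda>j. - lin Q t j)"
| "lin Q (LSup s t) = (if (\<lambda>j. lin Q s j - lin Q t j) \<in> Q then lin Q s else lin Q t)"

text \<open>A finite set containing \<open>lin Q t\<close> for every \<open>Q\<close>. Its
  finiteness reduces a statement about all points to finitely many sign conditions.\<close>

primrec pieces :: "'i lterm \<Rightarrow> ('i \<Rightarrow> int) set" where
  "pieces (LVar i) = {unit_vec i}"
| "pieces LZero = {\<lambda>j. 0}"
| "pieces (LAdd s t) = (\<lambda>(l, m) j. l j + m j) ` (pieces s \<times> pieces t)"
| "pieces (LNeg t) = (\<lambda>l j. - l j) ` pieces t"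
| "pieces (LSup s t) = pieces s \<union> pieces t"

primrec crit :: "'i lterm \<Rightarrow> ('i \<Rightarrow> int) set" where
  "crit (LVar i) = {}"
| "crit LZero = {}"
| "crit (LAdd s t) = crit s \<union> crit t"
| "crit (LNeg t) = crit t"
| "crit (LSup s t) = crit s \<union> crit t \<union> (\<lambda>(l, m) j. l j - m j) ` (pieces s \<times> pieces t)"

lemma finite_lvars: "finite (lvars t)"
  by (induction t) auto

lemma finite_pieces: "finite (pieces t)"
  by (induction t) auto

lemma finite_crit: "finite (crit t)"
  by (induction t) (auto simp: finite_pieces)

lemma pieces_support: "l \<in> pieces t \<Longrightarrow> lvars t \<subseteq> F \<Longrightarrow> i \<notin> F \<Longrightarrow> l i = 0"
  by (induction t arbitrary: l) (fastforce simp: unit_vec_def)+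

lemma crit_support: "l \<in> crit t \<Longrightarrow> lvars t \<subseteq> F \<Longrightarrow> i \<notin> F \<Longrightarrow> l i = 0"
  by (induction t arbitrary: l) (auto simp: pieces_support)

lemma lin_in_pieces: "lin Q t \<in> pieces t"
  by (induction t) (auto simp: image_iff split: if_splits, (metis)?)

lemma leval_cong: "(\<And>i. i \<in> lvars t \<Longrightarrow> \<bar>x i\<bar> = \<bar>y i\<bar>) \<Longrightarrow> leval t x = leval t y"
  by (induction t) auto

lemma leval_zero [simp]: "leval t (\<lambda>i. 0) = 0"
  by (induction t) auto

lemma crit_diff_lin: "(\<lambda>j. lin Q s j - lin Q t j) \<in> crit (LSup s t)"
  using lin_in_pieces[of Q s] lin_in_pieces[of Q t]
  by (auto intro!: image_eqI[where x="(lin Q s, lin Q t)"])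

text \<open>The signs at \<open>x\<close> need to agree with \<open>Q\<close> only weakly: where a
  comparison is a tie, both branches of the maximum have the same value. The lemma thus applies on
  closed cones, boundary included.\<close>

lemma leval_eq_pair_lin:
  assumes "finite F" "lvars t \<subseteq> F" "\<And>i. i \<in> F \<Longrightarrow> 0 \<le> x i"
    and "\<And>l. l \<in> crit t \<Longrightarrow> l \<in> Q \<Longrightarrow> 0 \<le> pair F l x" "\<And>l. l \<in> crit t \<Longrightarrow> l \<notin> Q \<Longrightarrow> pair F l x \<le> 0"
  shows "leval t x = pair F (lin Q t) x"
  using assms
proof (induction t)
  case (LVar i) then show ?case by (simp add: pair_unit_vec)
next
  case LZero then show ?case by (simp add: pair_def)
next
  case (LAdd s t) then show ?case by (simp add: pair_add_left)
next
  case (LNeg t) then show ?case by (simp add: pair_minus_left)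
next
  case (LSup s t)
  then have IH: "leval s x = pair F (lin Q s) x" "leval t x = pair F (lin Q t) x" by auto
  have "(\<lambda>j. lin Q s j - lin Q t j) \<in> Q \<Longrightarrow> pair F (lin Q t) x \<le> pair F (lin Q s) x"
    "(\<lambda>j. lin Q s j - lin Q t j) \<notin> Q \<Longrightarrow> pair F (lin Q s) x \<le> pair F (lin Q t) x"
    using LSup.prems(4,5)[OF crit_diff_lin] by (auto simp: pair_diff_left)
  then show ?case using IH by auto
qed

text \<open>In a cone of a sign definite complex containing the given point, the sum of those generators
  whose coefficients are strictly positive has the required signs.\<close>

lemma pos_cone_realization:
  assumes F: "finite F" and D: "finite D" "\<And>l i. l \<in> D \<Longrightarrow> i \<notin> F \<Longrightarrow> l i = 0" and Q: "pos_cone F Q"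
  shows "\<exists>x :: 'i \<Rightarrow> real. (\<forall>i. 0 \<le> x i) \<and> (\<forall>l\<in>D. 0 \<le> pair F l x \<longleftrightarrow> l \<in> Q)"
proof -
  obtain B where B: "orthant_complex F B" "\<And>S l. S \<in> B \<Longrightarrow> l \<in> D \<Longrightarrow> sign_definite F S l"
    using exists_sign_definite_complex[OF F D(1)] by blast
  obtain S N c where S: "S \<in> B" "dual_basis F S N c" "\<And>s. s \<in> S \<Longrightarrow> c s \<in> Q"
    using orthant_complexD(6)[OF B(1) Q] by blast
  have fS: "finite S" and N: "0 < N" using orthant_complexD(2)[OF B(1) S(1)] S(2) unfolding dual_basis_def by auto
  \<comment> \<open>Since \<open>c s\<close> lies in \<open>Q\<close>, the absence of its negative
    means that the coordinate along \<open>s\<close> is strictly positive.\<close>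
  define P where "P = {s \<in> S. (\<lambda>j. - c s j) \<notin> Q}"
  have fP: "finite P" "P \<subseteq> S" unfolding P_def using fS by auto
  define x where "x = (\<lambda>i. real_of_int (\<Sum>s\<in>P. s i))"
  have px: "pair F l x = real_of_int (\<Sum>s\<in>P. pair F l s)" for l
    unfolding x_def pair_real pair_sum_right ..
  have x0: "0 \<le> x i" for i
    unfolding x_def using orthant_complexD(3)[OF B(1) S(1)] fP(2) by (simp add: sum_nonneg subset_iff)
  have "0 \<le> pair F l x \<longleftrightarrow> l \<in> Q" if l: "l \<in> D" for l
  proof -
    have ex: "(\<Sum>s\<in>S. pair F l s * c s j) = N * l j" for j
      using dual_basis_expand[OF S(2) F D(2)[OF l]] .
    consider (p) "\<forall>s\<in>S. 0 \<le> pair F l s" | (n) "\<forall>s\<in>S. pair F l s \<le> 0"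
      using B(2)[OF S(1) l] unfolding sign_definite_def by blast
    then show ?thesis
    proof cases
      case p
      then have "0 \<le> pair F l x" unfolding px using fP by (simp add: sum_nonneg subset_iff)
      moreover have "(\<lambda>j. \<Sum>s\<in>S. pair F l s * c s j) \<in> Q"
        by (rule pos_cone_sum[OF Q fS], rule pos_cone_scale[OF Q S(3)]) (use p in auto)
      then have "l \<in> Q" unfolding ex by (rule pos_cone_divide[OF Q _ N])
      ultimately show ?thesis by simp
    next
      case n
      show ?thesis
      proof
        assume "0 \<le> pair F l x"
        then have "0 \<le> (\<Sum>s\<in>P. pair F l s)" unfolding px by (simp only: of_int_0_le_iff)
        \<comment> \<open>The summands are nonnegative and their sum is at most zero, so
          \<open>l\<close> vanishes on \<open>P\<close>. For the other generators
          \<open>- c s\<close> is in \<open>Q\<close> as well, so a nonpositive coefficient does no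
          harm.\<close>
        then have "(\<Sum>s\<in>P. - pair F l s) = 0"
          using n fP sum_nonneg[of P "\<lambda>s. - pair F l s"] by (auto simp: sum_negf subset_iff)
        then have z: "pair F l s = 0" if "s \<in> P" for s
          using that n fP by (subst (asm) sum_nonneg_eq_0_iff) auto
        have "(\<lambda>j. \<Sum>s\<in>S. pair F l s * c s j) \<in> Q"
        proof (rule pos_cone_sum[OF Q fS])
          fix s assume s: "s \<in> S"
          show "(\<lambda>j. pair F l s * c s j) \<in> Q"
          proof (cases "s \<in> P")
            case True then show ?thesis using z pos_cone_zero[OF Q] by simp
          next
            case False
            then have "(\<lambda>j. - c s j) \<in> Q" using s unfolding P_def by simp
            from pos_cone_scale[OF Q this, of "- pair F l s"] show ?thesis using n s by simp
          qed
        qed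
        then show "l \<in> Q" unfolding ex by (rule pos_cone_divide[OF Q _ N])
      next
        assume lQ: "l \<in> Q"
        have "pair F l s = 0" if s: "s \<in> P" for s
        proof (rule ccontr)
          assume "pair F l s \<noteq> 0"
          then have neg: "0 < - pair F l s" using n s fP by (metis less_eq_real_def neg_0_less_iff_less order_less_le subsetD)
          have sS: "s \<in> S" using s fP by auto
          \<comment> \<open>Cancelling from \<open>N * l\<close> all terms of its expansion except
            that of \<open>s\<close> leaves a positive multiple of \<open>- c s\<close> in
            \<open>Q\<close>, against the choice of \<open>P\<close>.\<close>
          have "(\<lambda>j. \<Sum>u\<in>S - {s}. - pair F l u * c u j) \<in> Q"
            by (rule pos_cone_sum[OF Q], use fS in simp, rule pos_cone_scale[OF Q S(3)]) (use n in auto)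
          from pos_cone_add[OF Q pos_cone_scale[OF Q lQ, of N] this]
          have "(\<lambda>j. N * l j + (\<Sum>u\<in>S - {s}. - pair F l u * c u j)) \<in> Q" using N by simp
          moreover have "N * l j + (\<Sum>u\<in>S - {s}. - pair F l u * c u j) = - pair F l s * (- c s j)" for j
            unfolding ex[symmetric] using sS fS by (simp add: sum.remove[of S s] sum_negf)
          ultimately have "(\<lambda>j. - pair F l s * (- c s j)) \<in> Q" by simp
          from pos_cone_divide[OF Q this neg] show False using s unfolding P_def by simp
        qed
        then show "0 \<le> pair F l x" unfolding px by simp
      qed
    qed
  qed
  then show ?thesis using x0 by blast
qed

text \<open>The bridge from the reals to arbitrary totally ordered groups. Evaluating
  \<open>s\<close> and \<open>t\<close> at the point given by \<open>Q\<close> involves only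
  finitely many functionals; some real point gives them the same signs, and the inclusion of zero
  sets is applied there.\<close>

lemma zero_set_transfer:
  assumes F: "finite F" "lvars s \<subseteq> F" "lvars t \<subseteq> F" and Q: "pos_cone F Q"
    and st: "zero_set s \<subseteq> zero_set t" and s: "lin Q s \<in> Q" "(\<lambda>j. - lin Q s j) \<in> Q"
  shows "lin Q t \<in> Q" "(\<lambda>j. - lin Q t j) \<in> Q"
proof -
  let ?P = "pieces s \<union> pieces t"
  \<comment> \<open>The negatives are included so that vanishing of a functional is visible from
    signs alone.\<close>
  define D where "D = crit s \<union> crit t \<union> ?P \<union> (\<lambda>l j. - l j) ` ?P"
  have "finite D" unfolding D_def by (simp add: finite_pieces finite_crit)
  moreover have "l i = 0" if "l \<in> D" "i \<notin> F" for l i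
    using that F unfolding D_def by (auto simp: pieces_support crit_support)
  ultimately obtain x :: "'a \<Rightarrow> real" where x: "\<And>i. 0 \<le> x i" "\<And>l. l \<in> D \<Longrightarrow> 0 \<le> pair F l x \<longleftrightarrow> l \<in> Q"
    using pos_cone_realization[OF F(1) _ _ Q] by metis
  have ev: "leval u x = pair F (lin Q u) x" if "u = s \<or> u = t" for u
    by (rule leval_eq_pair_lin[OF F(1)]) (use that F x in \<open>auto simp: D_def, (meson UnCI linear)+\<close>)
  have mem: "lin Q u \<in> D" "(\<lambda>j. - lin Q u j) \<in> D" if "u = s \<or> u = t" for u
    using that lin_in_pieces[of Q u] unfolding D_def by auto
  have "leval s x = 0"
    using ev[of s] x(2)[OF mem(1)] x(2)[OF mem(2)] s by (fastforce simp: pair_minus_left)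
  then have "leval t x = 0" using st unfolding zero_set_def by auto
  then show "lin Q t \<in> Q" "(\<lambda>j. - lin Q t j) \<in> Q"
    using ev[of t] x(2)[OF mem(1)[of t]] x(2)[OF mem(2)[of t]] by (simp_all add: pair_minus_left)
qed

section \<open>Rational fans as zero sets of terms\<close>

lemma lookup_scaleR: "Poly_Mapping.lookup (r *\<^sub>R x) i = r * Poly_Mapping.lookup x i"
  for x :: "'i \<Rightarrow>\<^sub>0 real"
  by (simp add: scaleR_poly_mapping_def)

lemma continuous_on_lookup: "continuous_on A (\<lambda>x :: 'i \<Rightarrow>\<^sub>0 real. Poly_Mapping.lookup x i)"
proof (rule continuous_onI)
  fix x :: "'i \<Rightarrow>\<^sub>0 real" and e :: real
  assume "0 < e"
  have "dist (Poly_Mapping.lookup y i) (Poly_Mapping.lookup x i) \<le> dist y x" for y :: "'i \<Rightarrow>\<^sub>0 real"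
  proof (cases "i \<in> Poly_Mapping.keys y \<union> Poly_Mapping.keys x")
    case True
    then show ?thesis unfolding dist_poly_mapping_def by (intro member_le_sum) auto
  next
    case False
    then show ?thesis by (simp add: in_keys_iff)
  qed
  then show "\<exists>d>0. \<forall>y\<in>A. dist y x < d \<longrightarrow> dist (Poly_Mapping.lookup y i) (Poly_Mapping.lookup x i) \<le> e"
    using \<open>0 < e\<close> by (meson le_less_trans less_imp_le)
qed

text \<open>Fans require closed cones. For rational ones this comes from the inequalities, since
  coordinates are continuous for the distance that sums coordinate distances.\<close>

lemma closed_rational_cone:
  assumes "rational_cone F \<sigma>" shows "closed \<sigma>"
proof -
  obtain A :: "('a \<Rightarrow> rat) set" where A: "\<sigma> = {x \<in> coordinate_space F. \<forall>a\<in>A. 0 \<le> (\<Sum>i\<in>F. of_rat (a i) * Poly_Mapping.lookup x i)}"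
    using assms unfolding rational_cone_def by blast
  have "coordinate_space F = (\<Inter>i\<in>-F. {x :: 'a \<Rightarrow>\<^sub>0 real. Poly_Mapping.lookup x i = 0})"
    unfolding coordinate_space_def by (auto simp: in_keys_iff subset_iff)
  then have "\<sigma> = (\<Inter>i\<in>-F. {x. Poly_Mapping.lookup x i = 0}) \<inter>
      (\<Inter>a\<in>A. {x. 0 \<le> (\<Sum>i\<in>F. of_rat (a i) * Poly_Mapping.lookup x i)})"
    unfolding A by auto
  also have "closed \<dots>"
    by (intro closed_Int closed_INT ballI closed_Collect_eq closed_Collect_le continuous_intros continuous_on_lookup)
  finally show ?thesis .
qed

lemma convex_cone_hull_finite:
  assumes "finite S"
  shows "convex_cone hull S = {\<Sum>s\<in>S. c s *\<^sub>R s | c. \<forall>s. 0 \<le> (c s :: real)}" (is "_ = ?R")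
proof (rule hull_unique)
  show "S \<subseteq> ?R"
  proof
    fix s assume s: "s \<in> S"
    have "s = (\<Sum>t\<in>S. (if t = s then 1 else 0 :: real) *\<^sub>R t)"
      using s assms by (simp add: if_distrib[of "\<lambda>r. r *\<^sub>R _"] sum.delta cong: if_cong)
    then show "s \<in> ?R" by (intro CollectI exI[of _ "\<lambda>t. if t = s then 1 else 0"]) auto
  qed
  have "0 \<in> ?R" by (intro CollectI exI[of _ "\<lambda>_. 0"]) auto
  moreover have "x + y \<in> ?R" if "x \<in> ?R" "y \<in> ?R" for x y
  proof -
    obtain c where "x = (\<Sum>s\<in>S. c s *\<^sub>R s)" "\<forall>s. 0 \<le> c s" using \<open>x \<in> ?R\<close> by blast
    moreover obtain d where "y = (\<Sum>s\<in>S. d s *\<^sub>R s)" "\<forall>s. 0 \<le> d s" using \<open>y \<in> ?R\<close> by blast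
    ultimately show ?thesis
      by (intro CollectI exI[of _ "\<lambda>s. c s + d s"]) (auto simp: sum.distrib scaleR_add_left)
  qed
  moreover have "r *\<^sub>R x \<in> ?R" if xr: "x \<in> ?R" "0 \<le> r" for x r
  proof -
    obtain c where "x = (\<Sum>s\<in>S. c s *\<^sub>R s)" "\<forall>s. 0 \<le> c s"
      using xr(1) by blast
    then show ?thesis
      using xr by (intro CollectI exI[of _ "\<lambda>s. r * c s"]) (auto simp: scaleR_sum_right)
  qed
  ultimately show "convex_cone ?R" unfolding convex_cone_iff by blast
next
  fix T assume T: "S \<subseteq> T" "convex_cone T"
  have "(\<Sum>s\<in>S'. c s *\<^sub>R s) \<in> T" if "\<forall>s. 0 \<le> c s" "S' \<subseteq> S" for c S'
  proof -
    have "finite S'" using that assms by (meson finite_subset)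
    then show ?thesis using that(2)
      by (induction S' rule: finite_induct)
        (use T that in \<open>auto simp: convex_cone_contains_0 intro!: convex_cone_add convex_cone_scaleR\<close>)
  qed
  then show "?R \<subseteq> T" by auto
qed

text \<open>Extremality of faces: by independence the coefficients of \<open>x\<close> and
  \<open>y\<close> at a generator outside \<open>T\<close> add up to zero, and both are
  nonnegative.\<close>

lemma convex_cone_hull_face:
  assumes S: "finite S" "independent S" "T \<subseteq> S"
    and x: "x \<in> convex_cone hull S" and y: "y \<in> convex_cone hull S"
    and xy: "x + y \<in> convex_cone hull T"
  shows "x \<in> convex_cone hull T"
proof -
  have fT: "finite T" using S by (meson finite_subset)
  obtain c where c: "x = (\<Sum>s\<in>S. c s *\<^sub>R s)" "\<And>s. 0 \<le> c s"
    using x unfolding convex_cone_hull_finite[OF S(1)] by blast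
  obtain d where d: "y = (\<Sum>s\<in>S. d s *\<^sub>R s)" "\<And>s. 0 \<le> d s"
    using y unfolding convex_cone_hull_finite[OF S(1)] by blast
  obtain e where e: "x + y = (\<Sum>s\<in>T. e s *\<^sub>R s)"
    using xy unfolding convex_cone_hull_finite[OF fT] by blast
  define u where "u s = c s + d s - (if s \<in> T then e s else 0)" for s
  have "(\<Sum>s\<in>T. e s *\<^sub>R s) = (\<Sum>s\<in>S. (if s \<in> T then e s else 0) *\<^sub>R s)"
    using S by (intro sum.mono_neutral_cong_left) auto
  then have "(\<Sum>s\<in>S. u s *\<^sub>R s) = 0"
    using e c(1) d(1) unfolding u_def by (simp add: scaleR_left_diff_distrib scaleR_add_left sum.distrib sum_subtractf)
  then have u0: "u s = 0" if "s \<in> S" for s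
    using S(1,2) that independentD[of S S u s] by auto
  have "c s = 0" if "s \<in> S - T" for s
    using u0[of s] c(2)[of s] d(2)[of s] that unfolding u_def by auto
  then have "x = (\<Sum>s\<in>T. c s *\<^sub>R s)"
    unfolding c(1) using S by (intro sum.mono_neutral_right) auto
  then show ?thesis unfolding convex_cone_hull_finite[OF fT] using c(2) by auto
qed

text \<open>The definition of a face refers to an arbitrary set of independent generators, hence the detour
  through the extremality of faces.\<close>

lemma cone_face_of_convex_cone_hull:
  assumes W: "finite W" and f: "cone_face_of \<tau> (convex_cone hull W)"
  shows "\<exists>W'\<subseteq>W. \<tau> = convex_cone hull W'"
proof -
  obtain S T where S: "finite S" "independent S" "convex_cone hull W = convex_cone hull S" "T \<subseteq> S"
    and \<tau>: "\<tau> = convex_cone hull T"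
    using f unfolding cone_face_of_def by blast
  have "\<tau> = convex_cone hull (W \<inter> \<tau>)"
  proof
    show "convex_cone hull (W \<inter> \<tau>) \<subseteq> \<tau>"
      unfolding \<tau> by (intro hull_minimal convex_cone_convex_cone_hull) auto
    have "T \<subseteq> convex_cone hull (W \<inter> \<tau>)"
    proof
      fix t assume t: "t \<in> T"
      then have "t \<in> convex_cone hull W" using S by (auto intro: hull_inc)
      then obtain c where c: "t = (\<Sum>w\<in>W. c w *\<^sub>R w)" "\<And>w. 0 \<le> c w"
        unfolding convex_cone_hull_finite[OF W] by blast
      have inW: "(\<Sum>w\<in>W'. c w *\<^sub>R w) \<in> convex_cone hull S" if "W' \<subseteq> W" for W'
      proof -
        have "finite W'" using W that by (meson finite_subset)
        then have "(\<Sum>w\<in>W'. c w *\<^sub>R w) \<in> convex_cone hull W'"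
          unfolding convex_cone_hull_finite[OF \<open>finite W'\<close>] using c(2) by auto
        then show ?thesis using hull_mono[OF that] S(3) by blast
      qed
      \<comment> \<open>Splitting \<open>t\<close> into its term at \<open>w\<close> and the rest
        gives two members of the cone whose sum is in the face; extremality puts the term into the
        face, and its coefficient can be divided out.\<close>
      have w: "w \<in> \<tau>" if "w \<in> W" "c w \<noteq> 0" for w
      proof -
        have "t = c w *\<^sub>R w + (\<Sum>w\<in>W - {w}. c w *\<^sub>R w)"
          unfolding c(1) using that W by (simp add: sum.remove)
        then have "c w *\<^sub>R w \<in> \<tau>" unfolding \<tau>
          using convex_cone_hull_face[OF S(1,2,4), of "c w *\<^sub>R w" "\<Sum>w\<in>W - {w}. c w *\<^sub>R w"]
            inW[of "{w}"] inW[of "W - {w}"] that t hull_inc by fastforce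
        then have "(1 / c w) *\<^sub>R c w *\<^sub>R w \<in> \<tau>"
          unfolding \<tau> by (rule convex_cone_hull_mul) (use c(2) in simp)
        then show ?thesis using that by simp
      qed
      have "t = (\<Sum>w\<in>W \<inter> \<tau>. c w *\<^sub>R w)"
        unfolding c(1) using W w by (intro sum.mono_neutral_right) auto
      moreover have "finite (W \<inter> \<tau>)" using W by auto
      ultimately show "t \<in> convex_cone hull (W \<inter> \<tau>)"
        using c(2) by (auto simp: convex_cone_hull_finite)
    qed
    then show "\<tau> \<subseteq> convex_cone hull (W \<inter> \<tau>)"
      unfolding \<tau> by (intro hull_minimal convex_cone_convex_cone_hull)
  qed
  then show ?thesis by blast
qed

section \<open>Transport of the orthant to a quadrant\<close>

definition quad_sign :: "('i \<Rightarrow> int) \<Rightarrow> 'i \<Rightarrow> int" where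
  "quad_sign v i = (if v i = 0 then 1 else - 1)"

text \<open>A reflection, so that complexes need to be built only in the positive orthant.
  Coordinates outside \<open>F\<close> are cut off, which keeps the support finite when
  \<open>F\<close> is.\<close>

definition to_quadrant :: "'i set \<Rightarrow> ('i \<Rightarrow> int) \<Rightarrow> ('i \<Rightarrow> real) \<Rightarrow> 'i \<Rightarrow>\<^sub>0 real" where
  "to_quadrant F v x = Abs_poly_mapping (\<lambda>i. if i \<in> F then real_of_int (quad_sign v i) * x i else 0)"

lemma quad_sign_simps [simp]: "quad_sign v i * quad_sign v i = 1" "\<bar>quad_sign v i\<bar> = 1"
  "\<bar>real_of_int (quad_sign v i)\<bar> = 1"
  "real_of_int (quad_sign v i) * (real_of_int (quad_sign v i) * r) = r"
  by (auto simp: quad_sign_def)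

lemma lookup_to_quadrant:
  assumes "finite F"
  shows "Poly_Mapping.lookup (to_quadrant F v x) i = (if i \<in> F then real_of_int (quad_sign v i) * x i else 0)"
proof -
  have "finite {i. (if i \<in> F then real_of_int (quad_sign v i) * x i else 0) \<noteq> 0}"
    by (rule finite_subset[OF _ assms]) auto
  then show ?thesis unfolding to_quadrant_def by simp
qed

lemma to_quadrant_sum:
  assumes "finite F"
  shows "(\<Sum>s\<in>S. r s *\<^sub>R to_quadrant F v (f s)) = to_quadrant F v (\<lambda>i. \<Sum>s\<in>S. r s * f s i)"
  by (rule poly_mapping_eqI)
    (simp add: lookup_sum lookup_scaleR lookup_to_quadrant assms sum_distrib_left algebra_simps)

lemma to_quadrant_eq_iff:
  assumes "finite F"
  shows "to_quadrant F v x = to_quadrant F v y \<longleftrightarrow> (\<forall>i\<in>F. x i = y i)"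
proof
  assume eq: "to_quadrant F v x = to_quadrant F v y"
  show "\<forall>i\<in>F. x i = y i"
  proof
    fix i assume "i \<in> F"
    then have "real_of_int (quad_sign v i) * x i = real_of_int (quad_sign v i) * y i"
      using arg_cong[OF eq, of "\<lambda>z. Poly_Mapping.lookup z i"] assms by (simp add: lookup_to_quadrant)
    then show "x i = y i" by (simp add: quad_sign_def split: if_splits)
  qed
qed (auto intro!: poly_mapping_eqI simp: lookup_to_quadrant assms)

lemma to_quadrant_in_quadrant:
  assumes "finite F" "\<And>i. i \<in> F \<Longrightarrow> 0 \<le> x i"
  shows "to_quadrant F v x \<in> quadrant F v"
  using assms unfolding quadrant_def coordinate_space_def
  by (auto simp: lookup_to_quadrant in_keys_iff quad_sign_def split: if_splits)

lemma quadrant_eq_to_quadrant: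
  assumes "finite F" "v \<in> F \<rightarrow>\<^sub>E {0, 1}" "x \<in> quadrant F v"
  shows "x = to_quadrant F v (\<lambda>i. \<bar>Poly_Mapping.lookup x i\<bar>)"
proof (rule poly_mapping_eqI)
  fix i
  show "Poly_Mapping.lookup x i = Poly_Mapping.lookup (to_quadrant F v (\<lambda>i. \<bar>Poly_Mapping.lookup x i\<bar>)) i"
  proof (cases "i \<in> F")
    case True
    then have "v i = 0 \<or> v i = 1" using assms(2) by auto
    then show ?thesis
      using assms True by (auto simp: lookup_to_quadrant quad_sign_def quadrant_def)
  next
    case False
    then show ?thesis using assms by (auto simp: lookup_to_quadrant quadrant_def coordinate_space_def in_keys_iff)
  qed
qed

lemma leval_to_quadrant:
  assumes "finite F" "lvars t \<subseteq> F"
  shows "leval t (Poly_Mapping.lookup (to_quadrant F v x)) = leval t x"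
  using assms by (intro leval_cong) (auto simp: lookup_to_quadrant abs_mult subset_iff)

abbreviation lvec :: "'i set \<Rightarrow> ('i \<Rightarrow> int) \<Rightarrow> ('i \<Rightarrow> int) \<Rightarrow> 'i \<Rightarrow>\<^sub>0 real" where
  "lvec F v s \<equiv> to_quadrant F v (\<lambda>i. real_of_int (s i))"

lemma inj_on_vec:
  assumes "finite F" "\<And>s i. s \<in> A \<Longrightarrow> i \<notin> F \<Longrightarrow> s i = 0"
  shows "inj_on (lvec F v) A"
proof (rule inj_onI)
  fix s t assume "s \<in> A" "t \<in> A" "lvec F v s = lvec F v t"
  then have "s i = t i" for i
    using assms(2)[of s i] assms(2)[of t i] by (cases "i \<in> F") (auto simp: to_quadrant_eq_iff[OF assms(1)])
  then show "s = t" by auto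
qed

text \<open>The coefficients are indexed by integer vectors and vanish off \<open>A\<close>; this is
  the form in which uniqueness is stated in \<open>orthant_complex\<close>.\<close>

lemma hull_vec:
  assumes "finite F" "finite A" "\<And>s i. s \<in> A \<Longrightarrow> i \<notin> F \<Longrightarrow> s i = 0"
  shows "convex_cone hull (lvec F v ` A) =
    {to_quadrant F v (comb c A) | c. \<forall>s. 0 \<le> c s \<and> (s \<notin> A \<longrightarrow> c s = 0)}" (is "_ = ?R")
proof -
  have inj: "inj_on (lvec F v) A" by (rule inj_on_vec[OF assms(1)]) (rule assms(3))
  have "convex_cone hull (lvec F v ` A) = {\<Sum>s\<in>A. c (lvec F v s) *\<^sub>R lvec F v s | c. \<forall>s. 0 \<le> (c s :: real)}"
    unfolding convex_cone_hull_finite[OF finite_imageI[OF assms(2)]] sum.reindex[OF inj] by simp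
  also have "\<dots> = ?R"
  proof (intro Set.set_eqI iffI; clarsimp)
    fix c :: "('a \<Rightarrow>\<^sub>0 real) \<Rightarrow> real" assume c: "\<forall>s. 0 \<le> c s"
    have "(\<Sum>s\<in>A. c (lvec F v s) *\<^sub>R lvec F v s) = to_quadrant F v (\<lambda>i. \<Sum>s\<in>A. (if s \<in> A then c (lvec F v s) else 0) * real_of_int (s i))"
      unfolding to_quadrant_sum[OF assms(1)] by simp
    then show "\<exists>d :: ('a \<Rightarrow> int) \<Rightarrow> real. (\<Sum>s\<in>A. c (lvec F v s) *\<^sub>R lvec F v s) = to_quadrant F v (comb d A) \<and>
        (\<forall>s. 0 \<le> d s \<and> (s \<notin> A \<longrightarrow> d s = 0))"
      using c by (intro exI[of _ "\<lambda>s. if s \<in> A then c (lvec F v s) else 0"]) auto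
  next
    fix c :: "('a \<Rightarrow> int) \<Rightarrow> real" assume c: "\<forall>s. 0 \<le> c s \<and> (s \<notin> A \<longrightarrow> c s = 0)"
    define d where "d x = (if x \<in> lvec F v ` A then c (the_inv_into A (lvec F v) x) else 0)" for x
    have "d (lvec F v s) = c s" if "s \<in> A" for s
      unfolding d_def the_inv_into_f_f[OF inj that] using that by simp
    then have "to_quadrant F v (comb c A) = (\<Sum>s\<in>A. d (lvec F v s) *\<^sub>R lvec F v s)"
      unfolding to_quadrant_sum[OF assms(1)] by simp
    moreover have "\<forall>x. 0 \<le> d x" using c unfolding d_def by auto
    ultimately show "\<exists>d. to_quadrant F v (comb c A) = (\<Sum>s\<in>A. d (lvec F v s) *\<^sub>R lvec F v s) \<and> (\<forall>s. 0 \<le> d s)"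
      by blast
  qed
  finally show ?thesis .
qed

lemma pair_comb: "pair F l (comb c A) = (\<Sum>s\<in>A. c s * real_of_int (pair F l s))"
  unfolding pair_sum_right pair_scale_right pair_real ..

text \<open>Applied to a vanishing combination, the dual functional \<open>c a\<close> leaves
  \<open>N\<close> times the coefficient of \<open>a\<close>.\<close>

lemma independent_vec:
  assumes F: "finite F" and d: "dual_basis F S N c" and S: "finite S" "\<And>s i. s \<in> S \<Longrightarrow> i \<notin> F \<Longrightarrow> s i = 0" and A: "A \<subseteq> S"
  shows "independent (lvec F v ` A)"
proof (rule independent_if_scalars_zero)
  have fA: "finite A" using S A by (meson finite_subset)
  then show "finite (lvec F v ` A)" by simp
  have inj: "inj_on (lvec F v) A" by (rule inj_on_vec[OF F]) (use S A in auto)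
  fix f x assume z: "(\<Sum>x\<in>lvec F v ` A. f x *\<^sub>R x) = 0" and "x \<in> lvec F v ` A"
  then obtain a where a: "a \<in> A" "x = lvec F v a" by blast
  have z0: "to_quadrant F v (\<lambda>i. 0) = 0"
    by (rule poly_mapping_eqI) (simp add: lookup_to_quadrant[OF F])
  have "to_quadrant F v (\<lambda>i. \<Sum>s\<in>A. f (lvec F v s) * real_of_int (s i)) = to_quadrant F v (\<lambda>i. 0)"
    using z unfolding sum.reindex[OF inj] o_def to_quadrant_sum[OF F] z0 .
  then have "(\<Sum>s\<in>A. f (lvec F v s) * real_of_int (s i)) = 0" if "i \<in> F" for i
    using that to_quadrant_eq_iff[OF F] by auto
  then have "pair F (c a) (\<lambda>i. \<Sum>s\<in>A. f (lvec F v s) * real_of_int (s i)) = 0" unfolding pair_def by simp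
  then have "(\<Sum>s\<in>A. f (lvec F v s) * (if a = s then N else 0)) = 0"
  proof -
    have "(\<Sum>s\<in>A. f (lvec F v s) * (if a = s then N else 0)) = (\<Sum>s\<in>A. f (lvec F v s) * pair F (c a) s)"
    proof (rule sum.cong)
      fix s assume "s \<in> A"
      then have "a \<in> S" "s \<in> S" using a A by auto
      then have "pair F (c a) s = (if a = s then N else 0)" using d unfolding dual_basis_def by blast
      then show "f (lvec F v s) * (if a = s then N else 0) = f (lvec F v s) * pair F (c a) s" by simp
    qed simp
    then show ?thesis using \<open>pair F (c a) _ = 0\<close> unfolding pair_comb by simp
  qed
  then have "f (lvec F v a) * N = 0" using fA a by (simp add: if_distrib sum.delta cong: if_cong)
  then show "f x = 0" using d a unfolding dual_basis_def by auto
qed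

lemma rational_cone_vec:
  assumes F: "finite F" and d: "dual_basis F S N c" and S: "finite S" "\<And>s i. s \<in> S \<Longrightarrow> i \<notin> F \<Longrightarrow> s i = 0" and A: "A \<subseteq> S"
  shows "rational_cone F (convex_cone hull (lvec F v ` A))"
proof -
  have fA: "finite A" using S A by (meson finite_subset)
  have N: "0 < N" and dd: "\<And>s t. s \<in> S \<Longrightarrow> t \<in> S \<Longrightarrow> pair F (c s) t = (if s = t then N else 0)"
    using d unfolding dual_basis_def by auto
  have hv: "convex_cone hull (lvec F v ` A) =
      {to_quadrant F v (comb c A) | c. \<forall>s. 0 \<le> c s \<and> (s \<notin> A \<longrightarrow> c s = 0)}"
    by (rule hull_vec[OF F fA]) (use S A in auto)
  \<comment> \<open>The inequalities say that all coordinates given by \<open>c s\<close> are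
    nonnegative and that those with \<open>s\<close> outside \<open>A\<close> are also nonpositive.
    The factor \<open>quad_sign\<close> undoes the reflection.\<close>
  define f :: "int \<Rightarrow> ('a \<Rightarrow> int) \<Rightarrow> 'a \<Rightarrow> rat" where "f k s = (\<lambda>i. of_int (k * (c s i * quad_sign v i)))" for k s
  define R where "R = f 1 ` S \<union> f (-1) ` (S - A)"
  have ev: "(\<Sum>i\<in>F. of_rat (f k s i) * Poly_Mapping.lookup (to_quadrant F v x) i) = k * pair F (c s) x" for k s x
    unfolding pair_def sum_distrib_left f_def
    by (rule sum.cong) (auto simp: lookup_to_quadrant[OF F] of_rat_mult algebra_simps)
  have "convex_cone hull (lvec F v ` A) = {x \<in> coordinate_space F. \<forall>a\<in>R. 0 \<le> (\<Sum>i\<in>F. of_rat (a i) * Poly_Mapping.lookup x i)}"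
  proof (rule Set.set_eqI, rule iffI)
    fix x assume "x \<in> convex_cone hull (lvec F v ` A)"
    then obtain e where x: "x = to_quadrant F v (comb e A)" and e: "\<And>s. 0 \<le> e s"
      unfolding hv by blast
    have p: "pair F (c s) (comb e A) = (if s \<in> A then e s * N else 0)" if "s \<in> S" for s
    proof -
      have "pair F (c s) (comb e A) = (\<Sum>t\<in>A. if s = t then e t * N else 0)"
        unfolding pair_comb using dd that A by (intro sum.cong) auto
      then show ?thesis using fA by (simp add: sum.delta)
    qed
    have "x \<in> coordinate_space F" unfolding x coordinate_space_def by (auto simp: in_keys_iff lookup_to_quadrant[OF F] split: if_splits)
    moreover have "0 \<le> (\<Sum>i\<in>F. of_rat (a i) * Poly_Mapping.lookup x i)" if "a \<in> R" for a
      using that unfolding R_def x by (auto simp: ev p) (use e N in auto)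
    ultimately show "x \<in> {x \<in> coordinate_space F. \<forall>a\<in>R. 0 \<le> (\<Sum>i\<in>F. of_rat (a i) * Poly_Mapping.lookup x i)}" by simp
  next
    fix x assume "x \<in> {x \<in> coordinate_space F. \<forall>a\<in>R. 0 \<le> (\<Sum>i\<in>F. of_rat (a i) * Poly_Mapping.lookup x i)}"
    then have xc: "x \<in> coordinate_space F" and xR: "\<And>a. a \<in> R \<Longrightarrow> 0 \<le> (\<Sum>i\<in>F. of_rat (a i) * Poly_Mapping.lookup x i)" by auto
    define y where "y i = real_of_int (quad_sign v i) * Poly_Mapping.lookup x i" for i
    have x: "x = to_quadrant F v y"
      using xc by (intro poly_mapping_eqI) (auto simp: lookup_to_quadrant[OF F] y_def coordinate_space_def in_keys_iff)
    have p: "0 \<le> pair F (c s) y" if "s \<in> S" for s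
      using xR[of "f 1 s"] that unfolding R_def x ev by auto
    have m: "pair F (c s) y = 0" if "s \<in> S - A" for s
      using xR[of "f (-1) s"] p[of s] that unfolding R_def x ev by auto
    define e where "e s = (if s \<in> A then pair F (c s) y / N else 0)" for s
    have "y i = comb e A i" if "i \<in> F" for i
    proof -
      have "N * y i = (\<Sum>s\<in>S. pair F (c s) y * real_of_int (s i))" using dual_basis_expand_real[OF d F that] by simp
      also have "\<dots> = (\<Sum>s\<in>A. pair F (c s) y * real_of_int (s i))" using A S m by (intro sum.mono_neutral_right) auto
      also have "\<dots> = N * comb e A i" unfolding e_def sum_distrib_left using N by (intro sum.cong) auto
      finally show ?thesis using N by simp
    qed
    then have "x = to_quadrant F v (comb e A)" unfolding x using to_quadrant_eq_iff[OF F] by auto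
    moreover have "\<forall>s. 0 \<le> e s \<and> (s \<notin> A \<longrightarrow> e s = 0)" unfolding e_def using p A N by auto
    ultimately show "x \<in> convex_cone hull (lvec F v ` A)"
      unfolding hv by blast
  qed
  moreover have "finite R" unfolding R_def using S by auto
  ultimately show ?thesis unfolding rational_cone_def by blast
qed

text \<open>Sign definite comparisons make the term linear on the cone. The set of functionals
  nonnegative on all generators need not be a \<open>pos_cone\<close>, but \<open>lin\<close> only
  uses it to settle comparisons, and on those it gives the right answer.\<close>

lemma leval_on_cone:
  fixes e :: "('i \<Rightarrow> int) \<Rightarrow> real"
  assumes F: "finite F" "lvars t \<subseteq> F" and S: "\<And>s i. s \<in> S \<Longrightarrow> 0 \<le> s i"
    and sd: "\<And>l. l \<in> crit t \<Longrightarrow> sign_definite F S l" and e: "\<And>s. 0 \<le> e s" and A: "A \<subseteq> S"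
  shows "leval t (comb e A) = (\<Sum>s\<in>A. e s * real_of_int (pair F (lin {l. \<forall>s\<in>S. 0 \<le> pair F l s} t) s))"
  unfolding pair_comb[symmetric]
proof (rule leval_eq_pair_lin[OF F])
  show "0 \<le> comb e A i" for i using S e A by (intro sum_nonneg mult_nonneg_nonneg) auto
  fix l assume l: "l \<in> crit t"
  show "0 \<le> pair F l (comb e A)" if "l \<in> {l. \<forall>s\<in>S. 0 \<le> pair F l s}"
    unfolding pair_comb using that e A by (intro sum_nonneg mult_nonneg_nonneg) auto
  show "pair F l (comb e A) \<le> 0" if "l \<notin> {l. \<forall>s\<in>S. 0 \<le> pair F l s}"
    unfolding pair_comb using that sd[OF l] e A unfolding sign_definite_def
    by (intro sum_nonpos mult_nonneg_nonpos) auto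
qed

section \<open>Zero sets of terms: intersections, unions, and the fans they form\<close>

definition labs :: "'i lterm \<Rightarrow> 'i lterm" where "labs t = LSup t (LNeg t)"
definition linf :: "'i lterm \<Rightarrow> 'i lterm \<Rightarrow> 'i lterm" where "linf s t = LNeg (LSup (LNeg s) (LNeg t))"
definition lconj :: "'i lterm \<Rightarrow> 'i lterm \<Rightarrow> 'i lterm" where "lconj s t = LAdd (labs s) (labs t)"
definition ldisj :: "'i lterm \<Rightarrow> 'i lterm \<Rightarrow> 'i lterm" where "ldisj s t = linf (labs s) (labs t)"

lemma leval_labs [simp]: "leval (labs t) x = \<bar>leval t x\<bar>"
  and leval_linf [simp]: "leval (linf s t) x = min (leval s x) (leval t x)"
  and leval_lconj [simp]: "leval (lconj s t) x = 0 \<longleftrightarrow> leval s x = 0 \<and> leval t x = 0"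
  and leval_ldisj [simp]: "leval (ldisj s t) x = 0 \<longleftrightarrow> leval s x = 0 \<or> leval t x = 0"
  by (auto simp: labs_def linf_def lconj_def ldisj_def)

lemma lvars_connectives [simp]: "lvars (labs t) = lvars t" "lvars (linf s t) = lvars s \<union> lvars t"
  "lvars (lconj s t) = lvars s \<union> lvars t" "lvars (ldisj s t) = lvars s \<union> lvars t"
  by (auto simp: labs_def linf_def lconj_def ldisj_def)

abbreviation quadrant_zeros :: "'i set \<Rightarrow> ('i \<Rightarrow> int) \<Rightarrow> 'i lterm \<Rightarrow> ('i \<Rightarrow>\<^sub>0 real) set" where
  "quadrant_zeros F v t \<equiv> {x \<in> quadrant F v. leval t (Poly_Mapping.lookup x) = 0}"

text \<open>On each cone of a suitable complex the term is linear and of constant sign, so its zeros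
  there form the face spanned by the generators at which it vanishes.\<close>

lemma zero_set_is_fan:
  assumes F: "finite F" and v: "v \<in> F \<rightarrow>\<^sub>E {0, 1}" and t: "lvars t \<subseteq> F"
  shows "\<exists>\<phi>. rational_fan F \<phi> \<and> \<Union>\<phi> = quadrant_zeros F v t"
proof -
  \<comment> \<open>The pieces are included so that the term itself, and not only the comparisons
    inside it, keeps its sign on each cone.\<close>
  obtain B where B: "orthant_complex F B"
    and sd: "\<And>S l. S \<in> B \<Longrightarrow> l \<in> crit t \<union> pieces t \<Longrightarrow> sign_definite F S l"
    using exists_sign_definite_complex[OF F, of "crit t \<union> pieces t"] by (auto simp: finite_crit finite_pieces)
  note BD = orthant_complexD[OF B]
  define L where "L S = lin {l. \<forall>s\<in>S. 0 \<le> pair F l s} t" for S :: "('a \<Rightarrow> int) set"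
  have ev: "leval t (comb e A) = (\<Sum>s\<in>A. e s * real_of_int (pair F (L S) s))"
    if "S \<in> B" "A \<subseteq> S" "\<And>s. 0 \<le> e s" for S A e
    unfolding L_def by (rule leval_on_cone[OF F t]) (use that sd BD(3) in auto)
  have ev1: "leval t (\<lambda>i. real_of_int (a i)) = pair F (L S) a" if "S \<in> B" "a \<in> S" for S a
    using ev[of S "{a}" "\<lambda>_. 1"] that by simp
  have Lsd: "sign_definite F S (L S)" if "S \<in> B" for S
    using sd[OF that] lin_in_pieces unfolding L_def by blast
  define Z where "Z = {a :: 'a \<Rightarrow> int. leval t (\<lambda>i. real_of_int (a i)) = 0}"
  define \<phi> where "\<phi> = {convex_cone hull (lvec F v ` A) | A. \<exists>S\<in>B. A \<subseteq> S \<inter> Z}"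
  have hv: "convex_cone hull (lvec F v ` A) =
      {to_quadrant F v (comb c A) | c. \<forall>s. 0 \<le> c s \<and> (s \<notin> A \<longrightarrow> c s = 0)}"
    if "S \<in> B" "A \<subseteq> S" for S A
    by (rule hull_vec[OF F]) (use that BD(2,4) in \<open>auto intro: finite_subset\<close>)
  have "finite \<phi>"
  proof (rule finite_subset)
    show "\<phi> \<subseteq> (\<lambda>A. convex_cone hull (lvec F v ` A)) ` (\<Union>S\<in>B. Pow S)" unfolding \<phi>_def by auto
    show "finite ((\<lambda>A. convex_cone hull (lvec F v ` A)) ` (\<Union>S\<in>B. Pow S))" using BD(1,2) by auto
  qed
  have ind: "independent (lvec F v ` A)" "rational_cone F (convex_cone hull (lvec F v ` A))" "finite A"
    if SA: "S \<in> B" "A \<subseteq> S" for S A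
  proof -
    obtain N c where d: "dual_basis F S N c" using BD(5)[OF SA(1)] by blast
    show "independent (lvec F v ` A)"
      by (rule independent_vec[OF F d BD(2)[OF SA(1)]]) (use BD(4)[OF SA(1)] SA(2) in auto)
    show "rational_cone F (convex_cone hull (lvec F v ` A))"
      by (rule rational_cone_vec[OF F d BD(2)[OF SA(1)]]) (use BD(4)[OF SA(1)] SA(2) in auto)
    show "finite A" using SA BD(2) by (meson finite_subset)
  qed
  have simplicial: "simplicial_cone \<sigma> \<and> closed \<sigma> \<and> rational_cone F \<sigma>" if s: "\<sigma> \<in> \<phi>" for \<sigma>
  proof -
    obtain S A where SA: "S \<in> B" "A \<subseteq> S" "\<sigma> = convex_cone hull (lvec F v ` A)"
      using s unfolding \<phi>_def by blast
    then show ?thesis unfolding simplicial_cone_def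
      using ind[OF SA(1,2)] closed_rational_cone by (metis finite_imageI)
  qed
  have faces: "\<tau> \<in> \<phi>" if \<sigma>: "\<sigma> \<in> \<phi>" "cone_face_of \<tau> \<sigma>" for \<sigma> \<tau>
  proof -
    obtain S A where SA: "S \<in> B" "A \<subseteq> S \<inter> Z" "\<sigma> = convex_cone hull (lvec F v ` A)"
      using \<sigma>(1) unfolding \<phi>_def by blast
    then have "finite (lvec F v ` A)" using ind(3)[of S A] by auto
    then obtain W where "W \<subseteq> lvec F v ` A" "\<tau> = convex_cone hull W"
      using cone_face_of_convex_cone_hull \<sigma>(2) SA(3) by metis
    then obtain A' where "A' \<subseteq> A" "\<tau> = convex_cone hull (lvec F v ` A')" by (metis subset_imageE)
    then show ?thesis unfolding \<phi>_def using SA by blast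
  qed
  have inter: "\<sigma> \<inter> \<tau> \<in> \<phi>" if st: "\<sigma> \<in> \<phi>" "\<tau> \<in> \<phi>" for \<sigma> \<tau>
  proof -
    obtain S A where SA: "S \<in> B" "A \<subseteq> S \<inter> Z" "\<sigma> = convex_cone hull (lvec F v ` A)"
      using st(1) unfolding \<phi>_def by blast
    obtain T A' where TA: "T \<in> B" "A' \<subseteq> T \<inter> Z" "\<tau> = convex_cone hull (lvec F v ` A')"
      using st(2) unfolding \<phi>_def by blast
    have "\<sigma> \<inter> \<tau> \<subseteq> convex_cone hull (lvec F v ` (A \<inter> A'))"
    proof
      fix x assume x: "x \<in> \<sigma> \<inter> \<tau>"
      obtain c where c: "x = to_quadrant F v (comb c A)"
        "\<And>s. 0 \<le> c s" "\<And>s. s \<notin> A \<Longrightarrow> c s = 0"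
        using x hv[OF SA(1), of A] SA(2,3) by auto
      obtain d where d: "x = to_quadrant F v (comb d A')"
        "\<And>s. 0 \<le> d s" "\<And>s. s \<notin> A' \<Longrightarrow> d s = 0"
        using x hv[OF TA(1), of A'] TA(2,3) by auto
      have 1: "comb c S i = comb c A i" for i
        using SA BD(2) c(3) by (intro sum.mono_neutral_right) auto
      have 2: "comb d T i = comb d A' i" for i
        using TA BD(2) d(3) by (intro sum.mono_neutral_right) auto
      \<comment> \<open>Both representations of \<open>x\<close> have nonnegative coefficients on
        cones of one complex, so they coincide and are supported on the common generators.\<close>
      have "c = d"
      proof (rule orthant_complex_unique[OF B SA(1) TA(1) c(2) d(2)])
        show "c s = 0" if "s \<notin> S" for s using that c(3) SA by blast
        show "d s = 0" if "s \<notin> T" for s using that d(3) TA by blast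
        fix i
        have "comb c A i = comb d A' i"
        proof (cases "i \<in> F")
          case True
          then show ?thesis using trans[OF c(1)[symmetric] d(1), unfolded to_quadrant_eq_iff[OF F]] by (rule bspec[rotated])
        next
          case False
          then have z: "s i = 0" if "s \<in> A \<union> A'" for s using that SA TA BD(4) by blast
          have "comb c A i = 0" "comb d A' i = 0"
            using z by (auto intro!: sum.neutral)
          then show ?thesis by simp
        qed
        then show "comb c S i = comb d T i"
          unfolding 1 2 .
      qed
      then have "comb c A i = comb c (A \<inter> A') i" for i
        using d(3) ind(3)[OF SA(1), of A] SA(2) by (intro sum.mono_neutral_right) auto
      then have "x = to_quadrant F v (comb c (A \<inter> A'))" using c(1) by simp
      moreover have "\<forall>s. 0 \<le> c s \<and> (s \<notin> A \<inter> A' \<longrightarrow> c s = 0)" using c d \<open>c = d\<close> by auto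
      ultimately show "x \<in> convex_cone hull (lvec F v ` (A \<inter> A'))"
        using hv[OF SA(1), of "A \<inter> A'"] SA(2) by blast
    qed
    moreover have "convex_cone hull (lvec F v ` (A \<inter> A')) \<subseteq> \<sigma> \<inter> \<tau>"
      unfolding SA(3) TA(3) by (intro Int_greatest hull_mono image_mono) auto
    ultimately have "\<sigma> \<inter> \<tau> = convex_cone hull (lvec F v ` (A \<inter> A'))" by blast
    then show ?thesis unfolding \<phi>_def using SA by blast
  qed
  have "rational_fan F \<phi>"
    unfolding rational_fan_def fan_def using \<open>finite \<phi>\<close> simplicial faces inter by blast
  moreover have "\<Union>\<phi> = quadrant_zeros F v t"
  proof (intro equalityI subsetI)
    fix x assume "x \<in> \<Union>\<phi>"
    then obtain S A where SA: "S \<in> B" "A \<subseteq> S \<inter> Z" "x \<in> convex_cone hull (lvec F v ` A)"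
      unfolding \<phi>_def by blast
    then obtain c where c: "x = to_quadrant F v (comb c A)" "\<And>s. 0 \<le> c s"
      using hv[OF SA(1), of A] by auto
    have "x \<in> quadrant F v"
      unfolding c(1) using SA BD(3)[OF SA(1)] c(2)
      by (intro to_quadrant_in_quadrant[OF F] sum_nonneg mult_nonneg_nonneg) auto
    moreover have "leval t (Poly_Mapping.lookup x) = 0"
    proof -
      have "pair F (L S) a = 0" if "a \<in> A" for a
      proof -
        have "a \<in> S" "a \<in> Z" using that SA(2) by auto
        then show ?thesis using ev1[OF SA(1), of a] unfolding Z_def by simp
      qed
      then show ?thesis
        unfolding c(1) leval_to_quadrant[OF F t] using ev[OF SA(1), of A c] SA(2) c(2) by simp
    qed
    ultimately show "x \<in> quadrant_zeros F v t" by simp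
  next
    fix x assume "x \<in> quadrant_zeros F v t"
    then have x: "x \<in> quadrant F v" "leval t (Poly_Mapping.lookup x) = 0" by auto
    define y where "y i = \<bar>Poly_Mapping.lookup x i\<bar>" for i
    have xy: "x = to_quadrant F v y" unfolding y_def using quadrant_eq_to_quadrant[OF F v x(1)] .
    \<comment> \<open>The real point \<open>y\<close> seen as a \<open>pos_cone\<close>: the
      covering property then finds a cone that contains it.\<close>
    define Q where "Q = {l. 0 \<le> pair F l y}"
    have "pos_cone F Q" unfolding pos_cone_def Q_def
      by (auto simp: pair_add_left pair_minus_left pair_unit_vec[OF F] y_def)
    then obtain S N c where S: "S \<in> B" "dual_basis F S N c" "\<And>s. s \<in> S \<Longrightarrow> c s \<in> Q" using BD(6) by blast
    have N: "0 < N" using S(2) unfolding dual_basis_def by simp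
    define e where "e s = (if s \<in> S then pair F (c s) y / N else 0)" for s
    define A where "A = {s \<in> S. e s \<noteq> 0}"
    have e0: "0 \<le> e s" for s using S(3) N unfolding e_def Q_def by auto
    have AS: "A \<subseteq> S" "finite A" unfolding A_def using BD(2)[OF S(1)] by auto
    have y: "y i = comb e A i" if "i \<in> F" for i
    proof -
      have "N * y i = (\<Sum>s\<in>S. pair F (c s) y * real_of_int (s i))" using dual_basis_expand_real[OF S(2) F that] by simp
      also have "\<dots> = N * comb e S i"
        unfolding e_def sum_distrib_left using N by (intro sum.cong) auto
      also have "comb e S i = comb e A i"
        unfolding A_def using BD(2)[OF S(1)] by (intro sum.mono_neutral_right) auto
      finally show ?thesis using N by simp
    qed
    then have x': "x = to_quadrant F v (comb e A)"
      unfolding xy to_quadrant_eq_iff[OF F] by blast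
    have sum0: "(\<Sum>s\<in>A. e s * real_of_int (pair F (L S) s)) = 0"
      using x(2) ev[OF S(1) AS(1) e0] unfolding x' leval_to_quadrant[OF F t] by simp
    \<comment> \<open>The summands in \<open>sum0\<close> have a common sign, so each is zero, while
      the coefficients of members of \<open>A\<close> are not.\<close>
    have "pair F (L S) a = 0" if a: "a \<in> A" for a
    proof -
      consider "\<forall>s\<in>S. 0 \<le> pair F (L S) s" | "\<forall>s\<in>S. pair F (L S) s \<le> 0"
        using Lsd[OF S(1)] unfolding sign_definite_def by blast
      then have "e a * real_of_int (pair F (L S) a) = 0"
      proof cases
        case 1
        have "\<forall>s\<in>A. e s * real_of_int (pair F (L S) s) = 0"
          using sum0 1 e0 AS by (subst (asm) sum_nonneg_eq_0_iff) auto
        then show ?thesis using a by blast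
      next
        case 2
        have "(\<Sum>s\<in>A. - (e s * real_of_int (pair F (L S) s))) = 0" using sum0 by (simp add: sum_negf)
        then have "\<forall>s\<in>A. - (e s * real_of_int (pair F (L S) s)) = 0"
          using 2 e0 AS by (subst (asm) sum_nonneg_eq_0_iff) (auto simp: mult_nonneg_nonpos subset_iff)
        then show ?thesis using a by simp
      qed
      then show ?thesis using a unfolding A_def by simp
    qed
    then have "A \<subseteq> S \<inter> Z" using ev1[OF S(1)] AS(1) unfolding Z_def by auto
    moreover have "x \<in> convex_cone hull (lvec F v ` A)"
    proof -
      have "\<forall>s. 0 \<le> e s \<and> (s \<notin> A \<longrightarrow> e s = 0)" using e0 unfolding A_def e_def by auto
      then show ?thesis unfolding hv[OF S(1) AS(1)] using x' by blast
    qed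
    ultimately show "x \<in> \<Union>\<phi>" unfolding \<phi>_def using S(1) by blast
  qed
  ultimately show ?thesis by blast
qed

section \<open>From rational cones and fans back to terms\<close>

lemma exists_lterm_multiple:
  "\<exists>t'. lvars t' \<subseteq> lvars t \<and> (\<forall>x. leval t' x = real_of_int n * leval t x)"
proof -
  have nat: "\<exists>t'. lvars t' \<subseteq> lvars t \<and> (\<forall>x. leval t' x = real k * leval t x)" for k :: nat
  proof (induction k)
    case 0 show ?case by (rule exI[of _ LZero]) simp
  next
    case (Suc k)
    then obtain t' where "lvars t' \<subseteq> lvars t" "\<And>x. leval t' x = real k * leval t x" by blast
    then show ?case by (intro exI[of _ "LAdd t' t"]) (auto simp: algebra_simps)
  qed
  show ?thesis
  proof (cases n rule: int_cases2)
    case (nonneg k) then show ?thesis using nat[of k] by simp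
  next
    case (nonpos k)
    obtain t' where "lvars t' \<subseteq> lvars t" "\<And>x. leval t' x = real k * leval t x" using nat[of k] by blast
    then show ?thesis using nonpos by (intro exI[of _ "LNeg t'"]) auto
  qed
qed

lemma exists_lterm_functional:
  assumes "finite F"
  shows "\<exists>t. lvars t \<subseteq> F \<and> (\<forall>x. leval t x = (\<Sum>i\<in>F. real_of_int (m i) * \<bar>x i\<bar>))"
  using assms
proof (induction F rule: finite_induct)
  case empty show ?case by (rule exI[of _ LZero]) simp
next
  case (insert i F)
  then obtain t where t: "lvars t \<subseteq> F" "\<And>x. leval t x = (\<Sum>i\<in>F. real_of_int (m i) * \<bar>x i\<bar>)" by blast
  obtain u where "lvars u \<subseteq> {i}" "\<And>x. leval u x = real_of_int (m i) * \<bar>x i\<bar>"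
    using exists_lterm_multiple[of "LVar i" "m i"] by auto
  then show ?case using t insert by (intro exI[of _ "LAdd u t"]) auto
qed

lemma exists_common_denominator:
  fixes a :: "'i \<Rightarrow> rat"
  assumes "finite F"
  shows "\<exists>C > 0. \<exists>m. \<forall>i\<in>F. real_of_rat (a i) * real_of_int C = real_of_int (m i)"
  using assms
proof (induction F rule: finite_induct)
  case empty show ?case by (intro exI[of _ 1]) simp
next
  case (insert i F)
  then obtain C m where C: "C > 0" "\<And>j. j \<in> F \<Longrightarrow> real_of_rat (a j) * real_of_int C = real_of_int (m j)" by blast
  obtain p q where pq: "quotient_of (a i) = (p, q)" by force
  have q: "q > 0" using quotient_of_denom_pos[OF pq] .
  have ai: "real_of_rat (a i) * q = p"
    using q unfolding quotient_of_div[OF pq] by (simp add: of_rat_divide)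
  define m' where "m' j = (if j = i then p * C else m j * q)" for j
  have "real_of_rat (a j) * real_of_int (C * q) = real_of_int (m' j)" if "j \<in> insert i F" for j
  proof (cases "j = i")
    case True
    have "real_of_rat (a i) * real_of_int (C * q) = (real_of_rat (a i) * q) * C" by simp
    then show ?thesis unfolding ai using True by (simp add: m'_def)
  next
    case False
    then have "real_of_rat (a j) * real_of_int (C * q) = (real_of_rat (a j) * real_of_int C) * q" by simp
    also have "\<dots> = real_of_int (m j) * q" using C(2) that False by simp
    finally show ?thesis using False by (simp add: m'_def)
  qed
  then show ?case using C(1) q by (metis mult_pos_pos)
qed

text \<open>Clearing denominators and writing each coordinate as its sign times its absolute value
  turns the functional into a term \<open>u\<close>. On the quadrant, the maximum of
  \<open>- u\<close> and zero vanishes exactly on the half-space.\<close>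

lemma rational_halfspace_lterm:
  fixes a :: "'i \<Rightarrow> rat"
  assumes F: "finite F" and v: "v \<in> F \<rightarrow>\<^sub>E {0, 1}"
  shows "\<exists>t. lvars t \<subseteq> F \<and> (\<forall>x\<in>quadrant F v. leval t (Poly_Mapping.lookup x) = 0 \<longleftrightarrow>
    0 \<le> (\<Sum>i\<in>F. real_of_rat (a i) * Poly_Mapping.lookup x i))"
proof -
  obtain C m where C: "C > 0" "\<And>i. i \<in> F \<Longrightarrow> real_of_rat (a i) * real_of_int C = real_of_int (m i)"
    using exists_common_denominator[OF F] by metis
  obtain u where u: "lvars u \<subseteq> F" "\<And>x. leval u x = (\<Sum>i\<in>F. real_of_int (m i * quad_sign v i) * \<bar>x i\<bar>)"
    using exists_lterm_functional[OF F, of "\<lambda>i. m i * quad_sign v i"] by auto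
  have "leval u (Poly_Mapping.lookup x) = C * (\<Sum>i\<in>F. real_of_rat (a i) * Poly_Mapping.lookup x i)"
    if x: "x \<in> quadrant F v" for x
    unfolding u sum_distrib_left
  proof (rule sum.cong)
    fix i assume i: "i \<in> F"
    have "Poly_Mapping.lookup x i = real_of_int (quad_sign v i) * \<bar>Poly_Mapping.lookup x i\<bar>"
      using quadrant_eq_to_quadrant[OF F v x] lookup_to_quadrant[OF F] i by metis
    then show "real_of_int (m i * quad_sign v i) * \<bar>Poly_Mapping.lookup x i\<bar> =
        real_of_int C * (real_of_rat (a i) * Poly_Mapping.lookup x i)"
      using C(2)[OF i] by (metis mult.assoc mult.commute of_int_mult)
  qed simp
  then have "leval (LSup (LNeg u) LZero) (Poly_Mapping.lookup x) = 0 \<longleftrightarrow>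
      0 \<le> (\<Sum>i\<in>F. real_of_rat (a i) * Poly_Mapping.lookup x i)" if "x \<in> quadrant F v" for x
    using that C(1) by (auto simp: max_def zero_le_mult_iff split: if_splits)
  then show ?thesis using u(1) by (intro exI[of _ "LSup (LNeg u) LZero"]) auto
qed

lemma rational_cone_lterm:
  assumes F: "finite F" and v: "v \<in> F \<rightarrow>\<^sub>E {0, 1}" and \<sigma>: "rational_cone F \<sigma>" "\<sigma> \<subseteq> quadrant F v"
  shows "\<exists>t. lvars t \<subseteq> F \<and> \<sigma> = quadrant_zeros F v t"
proof -
  obtain A :: "('a \<Rightarrow> rat) set" where A: "finite A"
    "\<sigma> = {x \<in> coordinate_space F. \<forall>a\<in>A. 0 \<le> (\<Sum>i\<in>F. of_rat (a i) * Poly_Mapping.lookup x i)}"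
    using \<sigma>(1) unfolding rational_cone_def by blast
  have ex: "\<exists>t. lvars t \<subseteq> F \<and> (\<forall>x\<in>quadrant F v. leval t (Poly_Mapping.lookup x) = 0 \<longleftrightarrow>
    (\<forall>a\<in>A. 0 \<le> (\<Sum>i\<in>F. real_of_rat (a i) * Poly_Mapping.lookup x i)))"
    using A(1)
  proof (induction A rule: finite_induct)
    case empty show ?case by (rule exI[of _ LZero]) simp
  next
    case (insert a A)
    then obtain t where "lvars t \<subseteq> F" "\<forall>x\<in>quadrant F v. leval t (Poly_Mapping.lookup x) = 0 \<longleftrightarrow>
      (\<forall>a\<in>A. 0 \<le> (\<Sum>i\<in>F. real_of_rat (a i) * Poly_Mapping.lookup x i))" by blast
    moreover obtain u where "lvars u \<subseteq> F" "\<forall>x\<in>quadrant F v. leval u (Poly_Mapping.lookup x) = 0 \<longleftrightarrow>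
      0 \<le> (\<Sum>i\<in>F. real_of_rat (a i) * Poly_Mapping.lookup x i)"
      using rational_halfspace_lterm[OF F v] by blast
    ultimately show ?case by (intro exI[of _ "lconj u t"]) simp
  qed
  have "\<sigma> = {x \<in> quadrant F v. \<forall>a\<in>A. 0 \<le> (\<Sum>i\<in>F. of_rat (a i) * Poly_Mapping.lookup x i)}"
    using A(2) \<sigma>(2) unfolding quadrant_def by blast
  then show ?thesis using ex by auto
qed

lemma rational_fan_lterm:
  assumes F: "finite F" and v: "v \<in> F \<rightarrow>\<^sub>E {0, 1}" and \<phi>: "rational_fan F \<phi>" "\<Union>\<phi> \<subseteq> quadrant F v" "\<phi> \<noteq> {}"
  shows "\<exists>t. lvars t \<subseteq> F \<and> \<Union>\<phi> = quadrant_zeros F v t"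
proof -
  have "finite \<phi>" "\<And>\<sigma>. \<sigma> \<in> \<phi> \<Longrightarrow> rational_cone F \<sigma> \<and> \<sigma> \<subseteq> quadrant F v"
    using \<phi> unfolding rational_fan_def fan_def by auto
  then show ?thesis using \<phi>(3)
  proof (induction \<phi> rule: finite_induct)
    case (insert \<sigma> \<phi>)
    obtain t where t: "lvars t \<subseteq> F" "\<sigma> = quadrant_zeros F v t"
      using rational_cone_lterm[OF F v] insert.prems by blast
    show ?case
    proof (cases "\<phi> = {}")
      case True then show ?thesis using t by auto
    next
      case False
      then obtain u where "lvars u \<subseteq> F" "\<Union>\<phi> = quadrant_zeros F v u"
        using insert by auto
      then show ?thesis using t by (intro exI[of _ "ldisj t u"]) auto
    qed
  qed simp
qed

lemma of_quadrant_image: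
  assumes F: "finite F" and v: "v \<in> F \<rightarrow>\<^sub>E {0, 1}" and t: "lvars t \<subseteq> F"
  shows "of_quadrant F v ` quadrant_zeros F v t =
    {f \<in> radical_class F v. leval t (\<lambda>i. snd (f i)) = 0}"
proof (intro equalityI subsetI)
  fix f assume "f \<in> of_quadrant F v ` quadrant_zeros F v t"
  then obtain x where x: "x \<in> quadrant F v" "leval t (Poly_Mapping.lookup x) = 0" and f: "f = (\<lambda>i\<in>F. (v i, Poly_Mapping.lookup x i))"
    unfolding of_quadrant_def by auto
  have "f i \<in> Delta" if "i \<in> F" for i
  proof -
    have "v i = 0 \<or> v i = 1" using v that by auto
    then show ?thesis using x(1) that unfolding f Delta_def lex_le_def quadrant_def by auto
  qed
  moreover have "leval t (\<lambda>i. snd (f i)) = leval t (Poly_Mapping.lookup x)"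
    using t by (intro leval_cong) (auto simp: f)
  ultimately show "f \<in> {f \<in> radical_class F v. leval t (\<lambda>i. snd (f i)) = 0}"
    unfolding radical_class_def using x(2) by (auto simp: f)
next
  fix f assume "f \<in> {f \<in> radical_class F v. leval t (\<lambda>i. snd (f i)) = 0}"
  then have f: "f \<in> F \<rightarrow>\<^sub>E Delta" "\<And>i. i \<in> F \<Longrightarrow> fst (f i) = v i" "leval t (\<lambda>i. snd (f i)) = 0"
    unfolding radical_class_def by auto
  define x where "x = to_quadrant F v (\<lambda>i. \<bar>snd (f i)\<bar>)"
  have "leval t (Poly_Mapping.lookup x) = leval t (\<lambda>i. \<bar>snd (f i)\<bar>)"
    unfolding x_def by (rule leval_to_quadrant[OF F t])
  also have "\<dots> = 0" unfolding f(3)[symmetric] by (rule leval_cong) simp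
  finally have "x \<in> quadrant_zeros F v t"
    unfolding x_def using to_quadrant_in_quadrant[OF F, of "\<lambda>i. \<bar>snd (f i)\<bar>"] by simp
  moreover have "f = of_quadrant F v x"
  proof
    fix i show "f i = of_quadrant F v x i"
    proof (cases "i \<in> F")
      case True
      then have "f i \<in> Delta" using f(1) by auto
      then have "snd (f i) = quad_sign v i * \<bar>snd (f i)\<bar>"
        using f(2)[OF True] unfolding Delta_def lex_le_def quad_sign_def by auto
      then show ?thesis using True f(2)[OF True] unfolding of_quadrant_def x_def
        by (auto simp: lookup_to_quadrant[OF F] prod_eq_iff)
    next
      case False
      then show ?thesis using f(1) unfolding of_quadrant_def by (auto simp: PiE_def extensional_def)
    qed
  qed
  ultimately show "f \<in> of_quadrant F v ` quadrant_zeros F v t" by blast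
qed

text \<open>Eliminates the geometry of fans in favour of an optional term for each radical class;
  everything later about cylinder fans rests on this description.\<close>

lemma rational_Delta_fan_iff:
  assumes F: "finite F"
  shows "rational_Delta_fan F P \<longleftrightarrow> P \<subseteq> Delta_power F \<and> (\<forall>v \<in> F \<rightarrow>\<^sub>E {0, 1}. \<exists>z.
    (\<forall>t. z = Some t \<longrightarrow> lvars t \<subseteq> F) \<and>
    P \<inter> radical_class F v = {f \<in> radical_class F v. \<exists>t. z = Some t \<and> leval t (\<lambda>i. snd (f i)) = 0})"
proof -
  have "(\<exists>\<phi>. rational_fan F \<phi> \<and> \<Union>\<phi> \<subseteq> quadrant F v \<and> P \<inter> radical_class F v = of_quadrant F v ` \<Union>\<phi>) \<longleftrightarrow>
    (\<exists>z. (\<forall>t. z = Some t \<longrightarrow> lvars t \<subseteq> F) \<and>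
    P \<inter> radical_class F v = {f \<in> radical_class F v. \<exists>t. z = Some t \<and> leval t (\<lambda>i. snd (f i)) = 0})"
    (is "?L \<longleftrightarrow> ?R") if v: "v \<in> F \<rightarrow>\<^sub>E {0, 1}" for v
  proof
    assume ?L
    then obtain \<phi> where \<phi>: "rational_fan F \<phi>" "\<Union>\<phi> \<subseteq> quadrant F v" "P \<inter> radical_class F v = of_quadrant F v ` \<Union>\<phi>" by blast
    show ?R
    proof (cases "\<phi> = {}")
      case True then show ?thesis using \<phi> by (intro exI[of _ None]) auto
    next
      case False
      then obtain t where "lvars t \<subseteq> F" "\<Union>\<phi> = quadrant_zeros F v t"
        using rational_fan_lterm[OF F v \<phi>(1,2)] by blast
      then show ?thesis using \<phi>(3) of_quadrant_image[OF F v] by (intro exI[of _ "Some t"]) auto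
    qed
  next
    assume ?R
    then obtain z where z: "\<And>t. z = Some t \<Longrightarrow> lvars t \<subseteq> F"
      "P \<inter> radical_class F v = {f \<in> radical_class F v. \<exists>t. z = Some t \<and> leval t (\<lambda>i. snd (f i)) = 0}" by auto
    show ?L
    proof (cases z)
      case None
      then show ?thesis using z by (intro exI[of _ "{}"]) (auto simp: rational_fan_def fan_def)
    next
      case (Some t)
      then obtain \<phi> where "rational_fan F \<phi>" "\<Union>\<phi> = quadrant_zeros F v t"
        using zero_set_is_fan[OF F v z(1)[OF Some]] by (elim exE conjE)
      then show ?thesis using z Some of_quadrant_image[OF F v z(1)[OF Some]] by (intro exI[of _ \<phi>]) auto
    qed
  qed
  then show ?thesis unfolding rational_Delta_fan_def by simp
qed

section \<open>The lattice of cylinder fans\<close>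

text \<open>The value \<^const>\<open>None\<close> stands for the empty fan, which is not the zero set of a term.\<close>

definition cylinder :: "'i set \<Rightarrow> 'i set \<Rightarrow> (('i \<Rightarrow> int) \<Rightarrow> 'i lterm option) \<Rightarrow> ('i \<Rightarrow> int \<times> real) set" where
  "cylinder K F \<tau> = {f \<in> Delta_power K. \<exists>t. \<tau> (\<lambda>i\<in>F. fst (f i)) = Some t \<and> leval t (\<lambda>i. snd (f i)) = 0}"

definition lterm_family :: "'i set \<Rightarrow> (('i \<Rightarrow> int) \<Rightarrow> 'i lterm option) \<Rightarrow> bool" where
  "lterm_family F \<tau> \<longleftrightarrow> (\<forall>v t. \<tau> v = Some t \<longrightarrow> lvars t \<subseteq> F)"

lemma fst_Delta: "p \<in> Delta \<Longrightarrow> fst p = 0 \<or> fst p = 1"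
  unfolding Delta_def lex_le_def by auto

lemma cylinder_fans_iff:
  "C \<in> cylinder_fans K \<longleftrightarrow> (\<exists>F \<tau>. finite F \<and> F \<subseteq> K \<and> lterm_family F \<tau> \<and> C = cylinder K F \<tau>)"
proof
  assume "C \<in> cylinder_fans K"
  then obtain F P where F: "finite F" "F \<subseteq> K" and P: "rational_Delta_fan F P"
    and C: "C = {f \<in> Delta_power K. restrict f F \<in> P}"
    unfolding cylinder_fans_def by blast
  have "\<forall>v \<in> F \<rightarrow>\<^sub>E {0, 1}. \<exists>z. (\<forall>t. z = Some t \<longrightarrow> lvars t \<subseteq> F) \<and>
    P \<inter> radical_class F v = {f \<in> radical_class F v. \<exists>t. z = Some t \<and> leval t (\<lambda>i. snd (f i)) = 0}"
    using P unfolding rational_Delta_fan_iff[OF F(1)] by blast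
  then obtain \<tau> where \<tau>: "\<forall>v \<in> F \<rightarrow>\<^sub>E {0, 1}. (\<forall>t. \<tau> v = Some t \<longrightarrow> lvars t \<subseteq> F) \<and>
    P \<inter> radical_class F v = {f \<in> radical_class F v. \<exists>t. \<tau> v = Some t \<and> leval t (\<lambda>i. snd (f i)) = 0}"
    by (rule bchoice[THEN exE])
  \<comment> \<open>The choice function is constrained only at vectors of a radical class; elsewhere
    the value \<open>None\<close> makes the bound on variables hold trivially.\<close>
  define \<tau>' where "\<tau>' v = (if v \<in> F \<rightarrow>\<^sub>E {0, 1} then \<tau> v else None)" for v
  have fam: "lterm_family F \<tau>'" unfolding lterm_family_def \<tau>'_def using \<tau> by auto
  have "restrict f F \<in> P \<longleftrightarrow> (\<exists>t. \<tau>' (\<lambda>i\<in>F. fst (f i)) = Some t \<and> leval t (\<lambda>i. snd (f i)) = 0)"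
    if f: "f \<in> Delta_power K" for f
  proof -
    let ?v = "\<lambda>i\<in>F. fst (f i)"
    have fD: "f i \<in> Delta" if "i \<in> F" for i using f F that by auto
    have v: "?v \<in> F \<rightarrow>\<^sub>E {0, 1}" using fst_Delta[OF fD] by auto
    have r: "restrict f F \<in> radical_class F ?v" unfolding radical_class_def using fD by auto
    have "restrict f F \<in> P \<longleftrightarrow> restrict f F \<in> P \<inter> radical_class F ?v" using r by blast
    also have "\<dots> \<longleftrightarrow> (\<exists>t. \<tau> ?v = Some t \<and> leval t (\<lambda>i. snd (restrict f F i)) = 0)"
      using \<tau>[rule_format, OF v] r by auto
    also have "\<dots> \<longleftrightarrow> (\<exists>t. \<tau>' ?v = Some t \<and> leval t (\<lambda>i. snd (f i)) = 0)"
    proof -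
      have "leval t (\<lambda>i. snd (restrict f F i)) = leval t (\<lambda>i. snd (f i))" if "\<tau> ?v = Some t" for t
        using \<tau>[rule_format, OF v] that by (intro leval_cong) auto
      then show ?thesis unfolding \<tau>'_def using v by auto
    qed
    finally show ?thesis .
  qed
  then have "C = cylinder K F \<tau>'" unfolding C cylinder_def by blast
  then show "\<exists>F \<tau>. finite F \<and> F \<subseteq> K \<and> lterm_family F \<tau> \<and> C = cylinder K F \<tau>" using F fam by blast
next
  assume "\<exists>F \<tau>. finite F \<and> F \<subseteq> K \<and> lterm_family F \<tau> \<and> C = cylinder K F \<tau>"
  then obtain F \<tau> where F: "finite F" "F \<subseteq> K" and \<tau>: "lterm_family F \<tau>" and C: "C = cylinder K F \<tau>" by blast
  define P where "P = {f \<in> Delta_power F. \<exists>t. \<tau> (\<lambda>i\<in>F. fst (f i)) = Some t \<and> leval t (\<lambda>i. snd (f i)) = 0}"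
  have *: "P \<inter> radical_class F v = {f \<in> radical_class F v. \<exists>t. \<tau> v = Some t \<and> leval t (\<lambda>i. snd (f i)) = 0}"
    if v: "v \<in> F \<rightarrow>\<^sub>E {0, 1}" for v
  proof -
    have "(\<lambda>i\<in>F. fst (f i)) = v" if "f \<in> radical_class F v" for f
      using that v unfolding radical_class_def by (auto simp: PiE_def extensional_def restrict_def)
    then show ?thesis unfolding P_def radical_class_def by auto
  qed
  have "rational_Delta_fan F P"
    unfolding rational_Delta_fan_iff[OF F(1)]
  proof (intro conjI ballI)
    show "P \<subseteq> Delta_power F" unfolding P_def by auto
    fix v :: "'a \<Rightarrow> int" assume "v \<in> F \<rightarrow>\<^sub>E {0, 1}"
    then show "\<exists>z. (\<forall>t. z = Some t \<longrightarrow> lvars t \<subseteq> F) \<and>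
      P \<inter> radical_class F v = {f \<in> radical_class F v. \<exists>t. z = Some t \<and> leval t (\<lambda>i. snd (f i)) = 0}"
      using * \<tau> unfolding lterm_family_def by (intro exI[of _ "\<tau> v"] conjI) auto
  qed
  moreover have "C = {f \<in> Delta_power K. restrict f F \<in> P}"
  proof -
    have "restrict f F \<in> P \<longleftrightarrow> (\<exists>t. \<tau> (\<lambda>i\<in>F. fst (f i)) = Some t \<and> leval t (\<lambda>i. snd (f i)) = 0)"
      if f: "f \<in> Delta_power K" for f
    proof -
      have "restrict f F \<in> Delta_power F" using f F by auto
      moreover have "(\<lambda>i\<in>F. fst (restrict f F i)) = (\<lambda>i\<in>F. fst (f i))" by auto
      moreover have "leval t (\<lambda>i. snd (restrict f F i)) = leval t (\<lambda>i. snd (f i))"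
        if "\<tau> (\<lambda>i\<in>F. fst (f i)) = Some t" for t
        using \<tau> that unfolding lterm_family_def by (intro leval_cong) (metis restrict_apply' subsetD)
      ultimately show ?thesis unfolding P_def by auto
    qed
    then show ?thesis unfolding C cylinder_def by blast
  qed
  ultimately show "C \<in> cylinder_fans K" unfolding cylinder_fans_def using F by blast
qed

lemma cylinder_extend:
  assumes "F \<subseteq> F'"
  shows "cylinder K F \<tau> = cylinder K F' (\<lambda>v. \<tau> (restrict v F))"
proof -
  have "restrict (\<lambda>i\<in>F'. fst (f i)) F = (\<lambda>i\<in>F. fst (f i))" for f :: "'a \<Rightarrow> int \<times> real"
    using assms by (auto simp: restrict_def subset_iff intro!: ext)
  then show ?thesis unfolding cylinder_def by simp
qed

text \<open>The extra set \<open>F\<close> allows a germ on the coordinates \<open>F\<close> to be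
  compared with both cylinders on one set of coordinates.\<close>

lemma cylinder_fans_common_support:
  assumes "C \<in> cylinder_fans K" "D \<in> cylinder_fans K" "finite F" "F \<subseteq> K"
  shows "\<exists>F' \<tau> \<sigma>. finite F' \<and> F \<subseteq> F' \<and> F' \<subseteq> K \<and> lterm_family F' \<tau> \<and> lterm_family F' \<sigma> \<and>
    C = cylinder K F' \<tau> \<and> D = cylinder K F' \<sigma>"
proof -
  obtain F1 \<tau> where 1: "finite F1" "F1 \<subseteq> K" "lterm_family F1 \<tau>" "C = cylinder K F1 \<tau>"
    using assms(1) unfolding cylinder_fans_iff by (elim exE conjE)
  obtain F2 \<sigma> where 2: "finite F2" "F2 \<subseteq> K" "lterm_family F2 \<sigma>" "D = cylinder K F2 \<sigma>"
    using assms(2) unfolding cylinder_fans_iff by (elim exE conjE)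
  let ?F = "F \<union> F1 \<union> F2"
  have "C = cylinder K ?F (\<lambda>v. \<tau> (restrict v F1))" "D = cylinder K ?F (\<lambda>v. \<sigma> (restrict v F2))"
    unfolding 1(4) 2(4) by (rule cylinder_extend, blast)+
  moreover have "lterm_family ?F (\<lambda>v. \<tau> (restrict v F1))" "lterm_family ?F (\<lambda>v. \<sigma> (restrict v F2))"
    using 1(3) 2(3) unfolding lterm_family_def by blast+
  moreover have "finite ?F" "?F \<subseteq> K" "F \<subseteq> ?F" using 1 2 assms by auto
  ultimately show ?thesis by (intro exI conjI)
qed

fun opt_disj :: "'i lterm option \<Rightarrow> 'i lterm option \<Rightarrow> 'i lterm option" where
  "opt_disj (Some s) (Some t) = Some (ldisj s t)"
| "opt_disj None x = x"
| "opt_disj x None = x"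

fun opt_conj :: "'i lterm option \<Rightarrow> 'i lterm option \<Rightarrow> 'i lterm option" where
  "opt_conj (Some s) (Some t) = Some (lconj s t)"
| "opt_conj _ _ = None"

lemma opt_disj_iff: "(\<exists>t. opt_disj x y = Some t \<and> leval t z = 0) \<longleftrightarrow>
    (\<exists>t. x = Some t \<and> leval t z = 0) \<or> (\<exists>t. y = Some t \<and> leval t z = 0)"
  by (cases x; cases y) auto

lemma opt_conj_iff: "(\<exists>t. opt_conj x y = Some t \<and> leval t z = 0) \<longleftrightarrow>
    (\<exists>t. x = Some t \<and> leval t z = 0) \<and> (\<exists>t. y = Some t \<and> leval t z = 0)"
  by (cases x; cases y) auto

lemma lterm_family_opt:
  assumes "lterm_family F \<tau>" "lterm_family F \<sigma>"
  shows "lterm_family F (\<lambda>v. opt_disj (\<tau> v) (\<sigma> v))" "lterm_family F (\<lambda>v. opt_conj (\<tau> v) (\<sigma> v))"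
proof -
  have "lvars t \<subseteq> F" if "opt_disj (\<tau> v) (\<sigma> v) = Some t" for v t
    using that assms unfolding lterm_family_def by (cases "\<tau> v"; cases "\<sigma> v"; fastforce)
  moreover have "lvars t \<subseteq> F" if "opt_conj (\<tau> v) (\<sigma> v) = Some t" for v t
    using that assms unfolding lterm_family_def by (cases "\<tau> v"; cases "\<sigma> v"; fastforce)
  ultimately show "lterm_family F (\<lambda>v. opt_disj (\<tau> v) (\<sigma> v))" "lterm_family F (\<lambda>v. opt_conj (\<tau> v) (\<sigma> v))"
    unfolding lterm_family_def by auto
qed

lemma cylinder_Un: "cylinder K F \<tau> \<union> cylinder K F \<sigma> = cylinder K F (\<lambda>v. opt_disj (\<tau> v) (\<sigma> v))"
  unfolding cylinder_def opt_disj_iff by blast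

lemma cylinder_Int: "cylinder K F \<tau> \<inter> cylinder K F \<sigma> = cylinder K F (\<lambda>v. opt_conj (\<tau> v) (\<sigma> v))"
  unfolding cylinder_def opt_conj_iff by blast

section \<open>Stone duality for lattices of sets\<close>

locale set_lattice =
  fixes L :: "'a set set" and X :: "'a set"
  assumes empty_in: "{} \<in> L" and top_in: "X \<in> L" and le_top: "C \<in> L \<Longrightarrow> C \<subseteq> X"
    and Un_in: "C \<in> L \<Longrightarrow> D \<in> L \<Longrightarrow> C \<union> D \<in> L" and Int_in: "C \<in> L \<Longrightarrow> D \<in> L \<Longrightarrow> C \<inter> D \<in> L"

lemma set_lattice_cylinder_fans: "set_lattice (cylinder_fans K) (Delta_power K)"
proof
  show "{} \<in> cylinder_fans K" unfolding cylinder_fans_iff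
    by (intro exI[of _ "{}"] exI[of _ "\<lambda>_. None"]) (auto simp: lterm_family_def cylinder_def)
  show "Delta_power K \<in> cylinder_fans K" unfolding cylinder_fans_iff
    by (intro exI[of _ "{}"] exI[of _ "\<lambda>_. Some LZero"]) (auto simp: lterm_family_def cylinder_def)
  show "C \<subseteq> Delta_power K" if "C \<in> cylinder_fans K" for C
    using that unfolding cylinder_fans_iff cylinder_def by blast
  fix C D assume "C \<in> cylinder_fans K" "D \<in> cylinder_fans K"
  from cylinder_fans_common_support[OF this, of "{}"]
  obtain F \<tau> \<sigma> where *: "finite F" "F \<subseteq> K" "lterm_family F \<tau>" "lterm_family F \<sigma>"
    "C = cylinder K F \<tau>" "D = cylinder K F \<sigma>" by auto
  show "C \<union> D \<in> cylinder_fans K"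
    unfolding cylinder_fans_iff *(5,6) cylinder_Un
    by (intro exI conjI, rule *(1), rule *(2), rule lterm_family_opt(1)[OF *(3,4)], rule refl)
  show "C \<inter> D \<in> cylinder_fans K"
    unfolding cylinder_fans_iff *(5,6) cylinder_Int
    by (intro exI conjI, rule *(1), rule *(2), rule lterm_family_opt(2)[OF *(3,4)], rule refl)
qed

section \<open>Prime filters and the space they form\<close>

definition prime_filter :: "'a set set \<Rightarrow> 'a set set \<Rightarrow> bool" where
  "prime_filter L p \<longleftrightarrow> p \<subseteq> L \<and> p \<noteq> {} \<and> {} \<notin> p \<and>
     (\<forall>C\<in>p. \<forall>D\<in>L. C \<subseteq> D \<longrightarrow> D \<in> p) \<and> (\<forall>C\<in>p. \<forall>D\<in>p. C \<inter> D \<in> p) \<and>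
     (\<forall>C\<in>L. \<forall>D\<in>L. C \<union> D \<in> p \<longrightarrow> C \<in> p \<or> D \<in> p)"

text \<open>The points avoiding \<open>C\<close>, so that larger sets give smaller open sets: this
  is where the order is reversed.\<close>

definition basic_open :: "'a set set \<Rightarrow> 'a set \<Rightarrow> 'a set set set" where
  "basic_open L C = {p. prime_filter L p \<and> C \<notin> p}"

definition stone_space :: "'a set set \<Rightarrow> 'a set set topology" where
  "stone_space L = topology (arbitrary union_of (\<lambda>U. \<exists>C\<in>L. U = basic_open L C))"

context set_lattice
begin

text \<open>Prime filter theorem, by Zorn: a filter maximal among those that contain
  \<open>\<D>\<close> and omit \<open>C\<close> is prime. The intersection with \<open>X\<close>
  gives the empty family the meet \<open>X\<close>.\<close>

lemma exists_prime_filter: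
  assumes D: "\<D> \<subseteq> L" and C: "C \<in> L"
    and avoid: "\<And>\<F>. finite \<F> \<Longrightarrow> \<F> \<subseteq> \<D> \<Longrightarrow> \<not> X \<inter> \<Inter>\<F> \<subseteq> C"
  shows "\<exists>p. prime_filter L p \<and> \<D> \<subseteq> p \<and> C \<notin> p"
proof -
  define \<A> where "\<A> = {q. q \<subseteq> L \<and> \<D> \<subseteq> q \<and> X \<in> q \<and> C \<notin> q \<and>
    (\<forall>A\<in>q. \<forall>B\<in>L. A \<subseteq> B \<longrightarrow> B \<in> q) \<and> (\<forall>A\<in>q. \<forall>B\<in>q. A \<inter> B \<in> q)}"
  have "{E \<in> L. \<exists>\<F>. finite \<F> \<and> \<F> \<subseteq> \<D> \<and> X \<inter> \<Inter>\<F> \<subseteq> E} \<in> \<A>" (is "?q \<in> \<A>")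
    unfolding \<A>_def
  proof (rule CollectI, intro conjI ballI impI)
    show "?q \<subseteq> L" by blast
    show "\<D> \<subseteq> ?q"
    proof
      fix E assume "E \<in> \<D>"
      then show "E \<in> ?q" using D by (intro CollectI conjI exI[of _ "{E}"]) auto
    qed
    show "X \<in> ?q" using top_in by (intro CollectI conjI exI[of _ "{}"]) auto
    show "C \<notin> ?q" using avoid by blast
    show "B \<in> ?q" if "A \<in> ?q" "B \<in> L" "A \<subseteq> B" for A B using that by blast
    fix A B assume "A \<in> ?q" "B \<in> ?q"
    then obtain \<F> \<G> where "A \<in> L" "B \<in> L" "finite \<F>" "\<F> \<subseteq> \<D>" "X \<inter> \<Inter>\<F> \<subseteq> A" "finite \<G>" "\<G> \<subseteq> \<D>" "X \<inter> \<Inter>\<G> \<subseteq> B"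
      by blast
    then show "A \<inter> B \<in> ?q" using Int_in by (intro CollectI conjI exI[of _ "\<F> \<union> \<G>"]) auto
  qed
  then have "\<A> \<noteq> {}" by blast
  moreover have "\<Union>\<C> \<in> \<A>" if ch: "\<C> \<noteq> {}" "subset.chain \<A> \<C>" for \<C>
  proof -
    have sub: "\<C> \<subseteq> \<A>" and lin: "\<And>p q. p \<in> \<C> \<Longrightarrow> q \<in> \<C> \<Longrightarrow> p \<subseteq> q \<or> q \<subseteq> p"
      using ch(2) unfolding subset.chain_def by auto
    have memA: "q \<subseteq> L" "\<D> \<subseteq> q" "X \<in> q" "C \<notin> q" "\<And>A B. A \<in> q \<Longrightarrow> B \<in> L \<Longrightarrow> A \<subseteq> B \<Longrightarrow> B \<in> q"
      "\<And>A B. A \<in> q \<Longrightarrow> B \<in> q \<Longrightarrow> A \<inter> B \<in> q" if "q \<in> \<C>" for q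
      using sub that unfolding \<A>_def by auto
    show ?thesis unfolding \<A>_def
    proof (rule CollectI, intro conjI ballI impI)
      show "\<Union>\<C> \<subseteq> L" using memA by blast
      show "\<D> \<subseteq> \<Union>\<C>" "X \<in> \<Union>\<C>" using memA ch(1) by blast+
      show "C \<notin> \<Union>\<C>" using memA by blast
      show "B \<in> \<Union>\<C>" if "A \<in> \<Union>\<C>" "B \<in> L" "A \<subseteq> B" for A B using that memA by blast
      fix A B assume "A \<in> \<Union>\<C>" "B \<in> \<Union>\<C>"
      then obtain p q where "p \<in> \<C>" "q \<in> \<C>" "A \<in> p" "B \<in> q" by blast
      with lin[of p q] have "\<exists>r\<in>\<C>. A \<in> r \<and> B \<in> r" by blast
      then show "A \<inter> B \<in> \<Union>\<C>" using memA(6) by blast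
    qed
  qed
  ultimately obtain q where q: "q \<in> \<A>" "\<And>r. r \<in> \<A> \<Longrightarrow> q \<subseteq> r \<Longrightarrow> r = q"
    using subset_Zorn_nonempty[of \<A>] by metis
  have qL: "q \<subseteq> L" "\<D> \<subseteq> q" "X \<in> q" "C \<notin> q" and up: "\<And>A B. A \<in> q \<Longrightarrow> B \<in> L \<Longrightarrow> A \<subseteq> B \<Longrightarrow> B \<in> q"
    and Int: "\<And>A B. A \<in> q \<Longrightarrow> B \<in> q \<Longrightarrow> A \<inter> B \<in> q"
    using q(1) unfolding \<A>_def by auto
  \<comment> \<open>By maximality a set outside \<open>q\<close> cannot be adjoined without forcing
    \<open>C\<close> into the filter.\<close>
  have ext: "\<exists>Q\<in>q. Q \<inter> A \<subseteq> C" if A: "A \<in> L" "A \<notin> q" for A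
  proof (rule ccontr)
    assume no: "\<not> (\<exists>Q\<in>q. Q \<inter> A \<subseteq> C)"
    let ?r = "{E \<in> L. \<exists>Q\<in>q. Q \<inter> A \<subseteq> E}"
    have "?r \<in> \<A>" unfolding \<A>_def
    proof (rule CollectI, intro conjI ballI impI)
      show "?r \<subseteq> L" by blast
      show "\<D> \<subseteq> ?r" "X \<in> ?r" using qL by blast+
      show "C \<notin> ?r" using no by blast
      show "F \<in> ?r" if "E \<in> ?r" "F \<in> L" "E \<subseteq> F" for E F using that by blast
      fix E F assume "E \<in> ?r" "F \<in> ?r"
      then obtain Q R where "E \<in> L" "F \<in> L" "Q \<in> q" "R \<in> q" "Q \<inter> A \<subseteq> E" "R \<inter> A \<subseteq> F" by blast
      then show "E \<inter> F \<in> ?r" using Int Int_in by (intro CollectI conjI bexI[of _ "Q \<inter> R"]) auto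
    qed
    moreover have "q \<subseteq> ?r" using qL by blast
    ultimately have "?r = q" using q(2) by blast
    moreover have "A \<in> ?r" using A qL by blast
    ultimately show False using A by blast
  qed
  have "prime_filter L q" unfolding prime_filter_def
  proof (intro conjI ballI impI)
    show "q \<subseteq> L" "q \<noteq> {}" using qL by auto
    show "{} \<notin> q" using up[of "{}" C] C qL by blast
    show "B \<in> q" if "A \<in> q" "B \<in> L" "A \<subseteq> B" for A B using up that by blast
    show "A \<inter> B \<in> q" if "A \<in> q" "B \<in> q" for A B using Int that by blast
    fix A B assume AB: "A \<in> L" "B \<in> L" "A \<union> B \<in> q"
    show "A \<in> q \<or> B \<in> q"
    proof (rule ccontr)
      assume "\<not> (A \<in> q \<or> B \<in> q)"
      then obtain Q R where QR: "Q \<in> q" "R \<in> q" "Q \<inter> A \<subseteq> C" "R \<inter> B \<subseteq> C" using ext AB by meson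
      have "(Q \<inter> R) \<inter> (A \<union> B) \<in> q" using Int QR AB by simp
      moreover have "(Q \<inter> R) \<inter> (A \<union> B) \<subseteq> C" using QR by blast
      ultimately show False using up[of "(Q \<inter> R) \<inter> (A \<union> B)" C] C qL(4) by simp
    qed
  qed
  then show ?thesis using qL by blast
qed

lemma prime_filterD:
  assumes "prime_filter L p"
  shows "p \<subseteq> L" "{} \<notin> p" "X \<in> p" "\<And>C D. C \<in> p \<Longrightarrow> D \<in> L \<Longrightarrow> C \<subseteq> D \<Longrightarrow> D \<in> p"
    "\<And>C D. C \<in> p \<Longrightarrow> D \<in> p \<Longrightarrow> C \<inter> D \<in> p" "\<And>C D. C \<in> L \<Longrightarrow> D \<in> L \<Longrightarrow> C \<union> D \<in> p \<Longrightarrow> C \<in> p \<or> D \<in> p"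
proof -
  show *: "p \<subseteq> L" "{} \<notin> p" "\<And>C D. C \<in> p \<Longrightarrow> D \<in> L \<Longrightarrow> C \<subseteq> D \<Longrightarrow> D \<in> p"
    "\<And>C D. C \<in> p \<Longrightarrow> D \<in> p \<Longrightarrow> C \<inter> D \<in> p" "\<And>C D. C \<in> L \<Longrightarrow> D \<in> L \<Longrightarrow> C \<union> D \<in> p \<Longrightarrow> C \<in> p \<or> D \<in> p"
    using assms unfolding prime_filter_def by blast+
  obtain C where "C \<in> p" using assms unfolding prime_filter_def by blast
  then show "X \<in> p" using *(1,3) top_in le_top by blast
qed

lemma basic_open_Un: "C \<in> L \<Longrightarrow> D \<in> L \<Longrightarrow> basic_open L (C \<union> D) = basic_open L C \<inter> basic_open L D"
  unfolding basic_open_def using prime_filterD(4,6) Un_in by blast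

lemma basic_open_Int: "C \<in> L \<Longrightarrow> D \<in> L \<Longrightarrow> basic_open L (C \<inter> D) = basic_open L C \<union> basic_open L D"
  unfolding basic_open_def using prime_filterD(4,5) Int_in by blast

lemma basic_open_empty: "basic_open L {} = {p. prime_filter L p}"
  unfolding basic_open_def using prime_filterD(2) by blast

lemma basic_open_top: "basic_open L X = {}"
  unfolding basic_open_def using prime_filterD(3) by blast

text \<open>If \<open>D\<close> were not contained in \<open>C\<close>, a prime filter containing
  \<open>D\<close> but not \<open>C\<close> would be a point of the first set only.\<close>

lemma basic_open_subset_iff:
  assumes "C \<in> L" "D \<in> L" shows "basic_open L C \<subseteq> basic_open L D \<longleftrightarrow> D \<subseteq> C"
proof
  assume sub: "basic_open L C \<subseteq> basic_open L D"
  show "D \<subseteq> C"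
  proof (rule ccontr)
    assume "\<not> D \<subseteq> C"
    have "\<not> X \<inter> \<Inter>\<F> \<subseteq> C" if "\<F> \<subseteq> {D}" for \<F>
      using that \<open>\<not> D \<subseteq> C\<close> le_top[OF assms(2)] by blast
    then obtain p where "prime_filter L p" "D \<in> p" "C \<notin> p"
      using exists_prime_filter[of "{D}" C] assms by blast
    then show False using sub unfolding basic_open_def by blast
  qed
next
  assume "D \<subseteq> C"
  then show "basic_open L C \<subseteq> basic_open L D"
    unfolding basic_open_def using prime_filterD(4) assms by blast
qed

lemma openin_stone_space:
  "openin (stone_space L) S \<longleftrightarrow> (\<exists>\<C>\<subseteq>L. S = (\<Union>C\<in>\<C>. basic_open L C))"
proof -
  have "istopology (arbitrary union_of (\<lambda>U. \<exists>C\<in>L. U = basic_open L C))"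
  proof (rule istopology_base)
    fix S T assume "\<exists>C\<in>L. S = basic_open L C" "\<exists>C\<in>L. T = basic_open L C"
    then show "\<exists>C\<in>L. S \<inter> T = basic_open L C" using basic_open_Un Un_in by metis
  qed
  then have *: "openin (stone_space L) = arbitrary union_of (\<lambda>U. \<exists>C\<in>L. U = basic_open L C)"
    unfolding stone_space_def by simp
  show ?thesis unfolding *
  proof
    assume "(arbitrary union_of (\<lambda>U. \<exists>C\<in>L. U = basic_open L C)) S"
    then obtain \<U> where U: "\<U> \<subseteq> {U. \<exists>C\<in>L. U = basic_open L C}" "\<Union>\<U> = S"
      unfolding union_of_def by auto
    then show "\<exists>\<C>\<subseteq>L. S = (\<Union>C\<in>\<C>. basic_open L C)"
      by (intro exI[of _ "{C \<in> L. basic_open L C \<in> \<U>}"]) blast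
  next
    assume "\<exists>\<C>\<subseteq>L. S = (\<Union>C\<in>\<C>. basic_open L C)"
    then obtain \<C> where "\<C> \<subseteq> L" "S = (\<Union>C\<in>\<C>. basic_open L C)" by blast
    then show "(arbitrary union_of (\<lambda>U. \<exists>C\<in>L. U = basic_open L C)) S"
      unfolding union_of_def by (intro exI[of _ "basic_open L ` \<C>"]) (auto simp: arbitrary_def)
  qed
qed

lemma openin_basic_open: "C \<in> L \<Longrightarrow> openin (stone_space L) (basic_open L C)"
  unfolding openin_stone_space by (intro exI[of _ "{C}"]) auto

lemma topspace_stone_space: "topspace (stone_space L) = {p. prime_filter L p}"
proof
  show "topspace (stone_space L) \<subseteq> {p. prime_filter L p}"
    using openin_topspace[of "stone_space L"] unfolding openin_stone_space basic_open_def by blast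
  show "{p. prime_filter L p} \<subseteq> topspace (stone_space L)"
    using openin_subset[OF openin_basic_open[OF empty_in]] unfolding basic_open_empty .
qed

lemma finite_Inter_in: "finite \<F> \<Longrightarrow> \<F> \<subseteq> L \<Longrightarrow> X \<inter> \<Inter>\<F> \<in> L"
proof (induction \<F> rule: finite_induct)
  case (insert C \<F>)
  then have "C \<inter> (X \<inter> \<Inter>\<F>) \<in> L" using Int_in by simp
  then show ?case by (simp add: Int_left_commute)
qed (simp add: top_in)

lemma basic_open_finite_Inter:
  "finite \<F> \<Longrightarrow> \<F> \<subseteq> L \<Longrightarrow> basic_open L (X \<inter> \<Inter>\<F>) = (\<Union>C\<in>\<F>. basic_open L C)"
proof (induction \<F> rule: finite_induct)
  case (insert C \<F>)
  have "X \<inter> \<Inter>(insert C \<F>) = C \<inter> (X \<inter> \<Inter>\<F>)" by auto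
  then show ?case using insert basic_open_Int[of C "X \<inter> \<Inter>\<F>"] finite_Inter_in[of \<F>] by simp
qed (simp add: basic_open_top)

text \<open>Compactness is the finiteness in the prime filter theorem: if no finite intersection of
  members of \<open>\<D>\<close> were below \<open>C\<close>, some prime filter would contain all of
  \<open>\<D>\<close> and omit \<open>C\<close>, and would be left uncovered.\<close>

lemma compactin_basic_open:
  assumes C: "C \<in> L" shows "compactin (stone_space L) (basic_open L C)"
  unfolding compactin_def
proof (intro conjI allI impI)
  show "basic_open L C \<subseteq> topspace (stone_space L)" using openin_subset[OF openin_basic_open[OF C]] .
  fix \<U> assume U: "Ball \<U> (openin (stone_space L)) \<and> basic_open L C \<subseteq> \<Union>\<U>"
  define \<D> where "\<D> = {D \<in> L. \<exists>U\<in>\<U>. basic_open L D \<subseteq> U}"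
  have cov: "basic_open L C \<subseteq> (\<Union>D\<in>\<D>. basic_open L D)"
  proof
    fix p assume "p \<in> basic_open L C"
    then obtain V where V: "V \<in> \<U>" "p \<in> V" using U by blast
    then obtain \<C> where "\<C> \<subseteq> L" "V = (\<Union>C\<in>\<C>. basic_open L C)" using U openin_stone_space by metis
    then show "p \<in> (\<Union>D\<in>\<D>. basic_open L D)" unfolding \<D>_def using V by blast
  qed
  have "\<exists>\<F>. finite \<F> \<and> \<F> \<subseteq> \<D> \<and> X \<inter> \<Inter>\<F> \<subseteq> C"
  proof (rule ccontr)
    assume "\<not> ?thesis"
    then obtain p where "prime_filter L p" "\<D> \<subseteq> p" "C \<notin> p"
      using exists_prime_filter[of \<D> C] C unfolding \<D>_def by blast
    then show False using cov unfolding basic_open_def by blast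
  qed
  then obtain \<F> where F: "finite \<F>" "\<F> \<subseteq> \<D>" "X \<inter> \<Inter>\<F> \<subseteq> C" by blast
  have FL: "\<F> \<subseteq> L" using F unfolding \<D>_def by blast
  have "basic_open L C \<subseteq> (\<Union>D\<in>\<F>. basic_open L D)"
    using basic_open_subset_iff[OF C finite_Inter_in[OF F(1) FL]] F(3) basic_open_finite_Inter[OF F(1) FL] by simp
  moreover have "\<forall>D\<in>\<F>. \<exists>U. U \<in> \<U> \<and> basic_open L D \<subseteq> U"
    using F(2) unfolding \<D>_def by blast
  then obtain u where u: "\<forall>D\<in>\<F>. u D \<in> \<U> \<and> basic_open L D \<subseteq> u D"
    by (rule bchoice[THEN exE])
  ultimately have "basic_open L C \<subseteq> \<Union>(u ` \<F>)" by blast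
  moreover have "finite (u ` \<F>)" "u ` \<F> \<subseteq> \<U>" using F(1) u by auto
  ultimately show "\<exists>\<F>. finite \<F> \<and> \<F> \<subseteq> \<U> \<and> basic_open L C \<subseteq> \<Union>\<F>" by blast
qed

lemma compact_opens_stone_space: "compact_opens (stone_space L) = basic_open L ` L"
proof
  show "basic_open L ` L \<subseteq> compact_opens (stone_space L)"
    unfolding compact_opens_def using compactin_basic_open openin_basic_open by blast
  show "compact_opens (stone_space L) \<subseteq> basic_open L ` L"
  proof
    fix U assume "U \<in> compact_opens (stone_space L)"
    then have U: "compactin (stone_space L) U" "openin (stone_space L) U" unfolding compact_opens_def by auto
    obtain \<C> where C: "\<C> \<subseteq> L" "U = (\<Union>C\<in>\<C>. basic_open L C)" using U(2) openin_stone_space by metis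
    obtain \<V> where V: "finite \<V>" "\<V> \<subseteq> basic_open L ` \<C>" "U \<subseteq> \<Union>\<V>"
      using compactinD[OF U(1), of "basic_open L ` \<C>"] C openin_basic_open by blast
    obtain \<F> where F: "\<F> \<subseteq> \<C>" "finite \<F>" "\<V> = basic_open L ` \<F>"
      using finite_subset_image[OF V(1,2)] by blast
    have "U = (\<Union>C\<in>\<F>. basic_open L C)" using V C F by blast
    then have "U = basic_open L (X \<inter> \<Inter>\<F>)" using basic_open_finite_Inter F C by auto
    then show "U \<in> basic_open L ` L" using finite_Inter_in[of \<F>] F C by blast
  qed
qed

text \<open>The generic point of \<open>Z\<close> is the intersection of the filters in
  \<open>Z\<close>, and irreducibility of \<open>Z\<close> says precisely that this intersection is
  prime.\<close>

lemma sober_stone_space: "sober_space (stone_space L)"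
  unfolding sober_space_def
proof (intro allI impI)
  fix Z assume Z: "irreducible_closedin (stone_space L) Z"
  let ?T = "stone_space L"
  have Zc: "closedin ?T Z" "Z \<noteq> {}" and irr: "\<And>A B. closedin ?T A \<Longrightarrow> closedin ?T B \<Longrightarrow> Z = A \<union> B \<Longrightarrow> Z = A \<or> Z = B"
    using Z unfolding irreducible_closedin_def by blast+
  have Zsub: "Z \<subseteq> {p. prime_filter L p}" using closedin_subset[OF Zc(1)] unfolding topspace_stone_space .
  define V where "V C = topspace ?T - basic_open L C" for C
  have V: "closedin ?T (V C)" "V C = {p. prime_filter L p \<and> C \<in> p}" if "C \<in> L" for C
  proof -
    show "closedin ?T (V C)" unfolding V_def using openin_basic_open[OF that] by blast
    show "V C = {p. prime_filter L p \<and> C \<in> p}"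
      unfolding V_def topspace_stone_space basic_open_def by blast
  qed
  define p where "p = {C \<in> L. Z \<subseteq> V C}"
  have zp: "prime_filter L q" if "q \<in> Z" for q using that Zsub by blast
  have pm: "C \<in> p \<longleftrightarrow> C \<in> L \<and> (\<forall>q\<in>Z. C \<in> q)" for C
  proof (cases "C \<in> L")
    case True
    have "Z \<subseteq> V C \<longleftrightarrow> (\<forall>q\<in>Z. C \<in> q)" unfolding V(2)[OF True] using zp by blast
    then show ?thesis unfolding p_def using True by simp
  qed (simp add: p_def)
  have p: "prime_filter L p" unfolding prime_filter_def
  proof (intro conjI ballI impI)
    show "p \<subseteq> L" unfolding p_def by blast
    have "X \<in> p" using pm top_in prime_filterD(3)[OF zp] by simp
    then show "p \<noteq> {}" by blast
    show "{} \<notin> p" using pm prime_filterD(2)[OF zp] Zc(2) by blast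
    show "D \<in> p" if "C \<in> p" "D \<in> L" "C \<subseteq> D" for C D
      unfolding pm using that(1)[unfolded pm] that(2,3) prime_filterD(4)[OF zp] by blast
    show "C \<inter> D \<in> p" if "C \<in> p" "D \<in> p" for C D
      unfolding pm using that[unfolded pm] by (auto intro!: Int_in prime_filterD(5)[OF zp])
    fix C D assume CD: "C \<in> L" "D \<in> L" "C \<union> D \<in> p"
    have "q \<in> V C \<union> V D" if "q \<in> Z" for q
      unfolding V(2)[OF CD(1)] V(2)[OF CD(2)]
      using prime_filterD(6)[OF zp[OF that] CD(1,2)] CD(3) pm zp that by simp
    then have "Z = (Z \<inter> V C) \<union> (Z \<inter> V D)" by blast
    then have "Z = Z \<inter> V C \<or> Z = Z \<inter> V D"
      using irr[of "Z \<inter> V C" "Z \<inter> V D"] V(1) CD Zc(1) by (simp add: closedin_Int)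
    then show "C \<in> p \<or> D \<in> p" unfolding p_def using CD by blast
  qed
  \<comment> \<open>Specialisation is inclusion of filters, so the closed points are the maximal
    prime filters.\<close>
  have cl: "?T closure_of {q} = {r. prime_filter L r \<and> q \<subseteq> r}" if q: "prime_filter L q" for q
  proof (intro equalityI subsetI)
    fix r assume r: "r \<in> ?T closure_of {q}"
    then have rp: "prime_filter L r" using closure_of_subset_topspace[of ?T] topspace_stone_space by blast
    moreover have "C \<in> r" if "C \<in> q" for C
    proof (rule ccontr)
      assume "C \<notin> r"
      have "C \<in> L" using that prime_filterD(1)[OF q] by blast
      have "r \<in> basic_open L C" using \<open>C \<notin> r\<close> rp unfolding basic_open_def by simp
      then have "q \<in> basic_open L C"
        using r[unfolded in_closure_of] openin_basic_open[OF \<open>C \<in> L\<close>] by auto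
      then show False using that unfolding basic_open_def by blast
    qed
    ultimately show "r \<in> {r. prime_filter L r \<and> q \<subseteq> r}" by blast
  next
    fix r assume r: "r \<in> {r. prime_filter L r \<and> q \<subseteq> r}"
    have "q \<in> S" if S: "openin ?T S" "r \<in> S" for S
    proof -
      obtain \<C> where "\<C> \<subseteq> L" "S = (\<Union>C\<in>\<C>. basic_open L C)" using S(1) openin_stone_space by metis
      then obtain C where "C \<in> \<C>" "r \<in> basic_open L C" using S(2) by blast
      then have "q \<in> basic_open L C" using r q unfolding basic_open_def by auto
      then show ?thesis using \<open>S = _\<close> \<open>C \<in> \<C>\<close> by blast
    qed
    then show "r \<in> ?T closure_of {q}" using r unfolding in_closure_of topspace_stone_space by blast
  qed
  have Zp: "Z = {r. prime_filter L r \<and> p \<subseteq> r}"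
  proof (intro equalityI subsetI)
    fix r assume "r \<in> Z"
    then show "r \<in> {r. prime_filter L r \<and> p \<subseteq> r}" using zp pm by blast
  next
    fix r assume r: "r \<in> {r. prime_filter L r \<and> p \<subseteq> r}"
    show "r \<in> Z"
    proof (rule ccontr)
      assume "r \<notin> Z"
      obtain \<C> where C: "\<C> \<subseteq> L" "topspace ?T - Z = (\<Union>C\<in>\<C>. basic_open L C)"
        using Zc(1) openin_stone_space unfolding closedin_def by metis
      have "r \<in> topspace ?T - Z" using r \<open>r \<notin> Z\<close> topspace_stone_space by blast
      then obtain D where D: "D \<in> \<C>" "r \<in> basic_open L D" using C(2) by blast
      have "basic_open L D \<inter> Z = {}" using C(2) D(1) by blast
      then have "Z \<subseteq> V D" unfolding V_def using closedin_subset[OF Zc(1)] by blast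
      then have "D \<in> p" unfolding p_def using D C by blast
      then show False using r D(2) unfolding basic_open_def by auto
    qed
  qed
  show "\<exists>!x. x \<in> topspace ?T \<and> Z = ?T closure_of {x}"
  proof (rule ex1I[of _ p])
    show "p \<in> topspace ?T \<and> Z = ?T closure_of {p}" using p cl[OF p] Zp topspace_stone_space by simp
    fix q assume "q \<in> topspace ?T \<and> Z = ?T closure_of {q}"
    then have q: "prime_filter L q" "Z = {r. prime_filter L r \<and> q \<subseteq> r}" using cl topspace_stone_space by auto
    then show "q = p" using p Zp by blast
  qed
qed

lemma spectral_stone_space: "spectral_space (stone_space L)"
  unfolding spectral_space_def
proof (intro conjI ballI)
  show "sober_space (stone_space L)" by (rule sober_stone_space)
  show "compact_space (stone_space L)"
    unfolding compact_space_def using compactin_basic_open[OF empty_in] by (simp add: basic_open_empty topspace_stone_space)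
  show "openin (stone_space L) = arbitrary union_of (\<lambda>U. U \<in> compact_opens (stone_space L))"
  proof
    fix S
    show "openin (stone_space L) S = (arbitrary union_of (\<lambda>U. U \<in> compact_opens (stone_space L))) S"
      unfolding openin_stone_space compact_opens_stone_space union_of_def
      by (auto simp: arbitrary_def subset_image_iff)
  qed
  fix U V assume "U \<in> compact_opens (stone_space L)" "V \<in> compact_opens (stone_space L)"
  then show "U \<inter> V \<in> compact_opens (stone_space L)"
    unfolding compact_opens_stone_space using basic_open_Un Un_in by (auto simp: image_iff) metis
qed

lemma stone_space_dual:
  "\<exists>h. bij_betw h (compact_opens (stone_space L)) L \<and>
    (\<forall>U\<in>compact_opens (stone_space L). \<forall>V\<in>compact_opens (stone_space L). U \<subseteq> V \<longleftrightarrow> h V \<subseteq> h U)"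
proof -
  have inj: "inj_on (basic_open L) L"
    using basic_open_subset_iff by (intro inj_onI) (metis order_antisym order_refl)
  define h where "h = the_inv_into L (basic_open L)"
  have "h (basic_open L C) = C" if "C \<in> L" for C unfolding h_def using the_inv_into_f_f[OF inj that] .
  moreover have "bij_betw h (compact_opens (stone_space L)) L"
    unfolding h_def compact_opens_stone_space by (rule bij_betw_the_inv_into) (simp add: bij_betw_def inj)
  ultimately show ?thesis
    unfolding compact_opens_stone_space using basic_open_subset_iff by (intro exI[of _ h]) auto
qed

end

text \<open>The closed sets \<open>W C\<close> are the complements of the compact open sets.\<close>

locale dual_space = set_lattice L X for L :: "'a set set" and X +
  fixes T :: "'t topology" and W :: "'a set \<Rightarrow> 't set"
  assumes closedin_W: "C \<in> L \<Longrightarrow> closedin T (W C)"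
    and separate: "closedin T A \<Longrightarrow> x \<in> topspace T \<Longrightarrow> x \<notin> A \<Longrightarrow> \<exists>C\<in>L. A \<subseteq> W C \<and> x \<notin> W C"
    and W_Un: "C \<in> L \<Longrightarrow> D \<in> L \<Longrightarrow> W (C \<union> D) = W C \<union> W D"
    and W_Int: "C \<in> L \<Longrightarrow> D \<in> L \<Longrightarrow> W (C \<inter> D) = W C \<inter> W D"
    and W_empty: "W {} = {}" and W_top: "W X = topspace T"
    and realize: "prime_filter L p \<Longrightarrow> \<exists>x\<in>topspace T. \<forall>C\<in>L. x \<in> W C \<longleftrightarrow> C \<in> p"
    and T0: "x \<in> topspace T \<Longrightarrow> y \<in> topspace T \<Longrightarrow> (\<And>C. C \<in> L \<Longrightarrow> x \<in> W C \<longleftrightarrow> y \<in> W C) \<Longrightarrow> x = y"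
begin

lemma W_mono: "C \<in> L \<Longrightarrow> D \<in> L \<Longrightarrow> C \<subseteq> D \<Longrightarrow> W C \<subseteq> W D"
  using W_Int by (metis Int_absorb2 inf_le2)

end

section \<open>Points of a spectral space as prime filters of compact open sets\<close>

lemma spectral_space_points:
  assumes T: "spectral_space T" and x: "x \<in> topspace T" and y: "y \<in> topspace T"
    and xy: "\<And>U. U \<in> compact_opens T \<Longrightarrow> x \<in> U \<longleftrightarrow> y \<in> U"
  shows "x = y"
proof -
  have base: "openin T = arbitrary union_of (\<lambda>U. U \<in> compact_opens T)" and sober: "sober_space T"
    using T unfolding spectral_space_def by auto
  have "x \<in> S \<longleftrightarrow> y \<in> S" if S: "openin T S" for S
  proof -
    have "\<forall>z\<in>S. \<exists>U. U \<in> compact_opens T \<and> z \<in> U \<and> U \<subseteq> S"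
      using S unfolding base arbitrary_union_of_alt .
    then show ?thesis using xy by blast
  qed
  \<comment> \<open>Equal neighbourhoods give equal closures, and sobriety allows an irreducible
    closed set only one generic point.\<close>
  then have cl: "T closure_of {x} = T closure_of {y}" unfolding closure_of_def using x y by auto
  have irr: "irreducible_closedin T (T closure_of {x})"
    unfolding irreducible_closedin_def
  proof (intro conjI allI impI)
    show "T closure_of {x} \<noteq> {}" using x by (simp add: closure_of_eq_empty)
    fix A B assume AB: "closedin T A \<and> closedin T B \<and> T closure_of {x} = A \<union> B"
    have "x \<in> T closure_of {x}" using x by (simp add: in_closure_of)
    then have "x \<in> A \<or> x \<in> B" using AB by blast
    then have "T closure_of {x} \<subseteq> A \<or> T closure_of {x} \<subseteq> B"
      using AB closure_of_minimal[of "{x}" A T] closure_of_minimal[of "{x}" B T] by auto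
    then show "T closure_of {x} = A \<or> T closure_of {x} = B" using AB by auto
  qed simp
  show ?thesis using sober[unfolded sober_space_def, rule_format, OF irr] x y cl by auto
qed

text \<open>The point is generic in the complement \<open>Z\<close> of all compact open sets outside
  \<open>\<F>\<close>. These are closed under finite unions by primeness, so by compactness their
  union contains no member of \<open>\<F>\<close>: a compact open set meets \<open>Z\<close> exactly
  if it is in \<open>\<F>\<close>.\<close>

lemma spectral_space_realize:
  assumes T: "spectral_space T" and F: "\<F> \<subseteq> compact_opens T" "topspace T \<in> \<F>" "{} \<notin> \<F>"
    and Int: "\<And>U V. U \<in> \<F> \<Longrightarrow> V \<in> \<F> \<Longrightarrow> U \<inter> V \<in> \<F>"
    and up: "\<And>U V. U \<in> \<F> \<Longrightarrow> V \<in> compact_opens T \<Longrightarrow> U \<subseteq> V \<Longrightarrow> V \<in> \<F>"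
    and prime: "\<And>U V. U \<in> compact_opens T \<Longrightarrow> V \<in> compact_opens T \<Longrightarrow> U \<union> V \<in> \<F> \<Longrightarrow> U \<in> \<F> \<or> V \<in> \<F>"
  shows "\<exists>x\<in>topspace T. \<forall>U\<in>compact_opens T. x \<in> U \<longleftrightarrow> U \<in> \<F>"
proof -
  have base: "openin T = arbitrary union_of (\<lambda>U. U \<in> compact_opens T)" and sober: "sober_space T"
    using T unfolding spectral_space_def by auto
  have bs: "\<exists>U. U \<in> compact_opens T \<and> z \<in> U \<and> U \<subseteq> S" if "openin T S" "z \<in> S" for S z
    using that unfolding base arbitrary_union_of_alt by blast
  define I where "I = compact_opens T - \<F>"
  define Z where "Z = topspace T - \<Union>I"
  have Io: "openin T U" if "U \<in> I" for U using that unfolding I_def compact_opens_def by auto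
  have Zc: "closedin T Z" unfolding Z_def using Io by blast
  have finI: "\<Union>\<G> \<in> I" if "finite \<G>" "\<G> \<subseteq> I" for \<G>
    using that
  proof (induction \<G> rule: finite_induct)
    case empty then show ?case using F(3) unfolding I_def compact_opens_def by simp
  next
    case (insert U \<G>)
    then have "U \<in> I" "\<Union>\<G> \<in> I" by auto
    then have "U \<union> \<Union>\<G> \<in> compact_opens T" "U \<union> \<Union>\<G> \<notin> \<F>"
      using prime unfolding I_def compact_opens_def by (auto intro: compactin_Un)
    then show ?case unfolding I_def by simp
  qed
  have meets: "U \<inter> Z \<noteq> {} \<longleftrightarrow> U \<in> \<F>" if U: "U \<in> compact_opens T" for U
  proof
    assume "U \<in> \<F>"
    show "U \<inter> Z \<noteq> {}"
    proof
      assume "U \<inter> Z = {}"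
      moreover have "U \<subseteq> topspace T" using U openin_subset unfolding compact_opens_def by blast
      ultimately have "U \<subseteq> \<Union>I" unfolding Z_def by blast
      then obtain \<G> where "finite \<G>" "\<G> \<subseteq> I" "U \<subseteq> \<Union>\<G>"
        using compactinD[of T U I] U Io unfolding compact_opens_def by blast
      then have "\<Union>\<G> \<in> I" "U \<subseteq> \<Union>\<G>" using finI by auto
      then show False using up[OF \<open>U \<in> \<F>\<close>] unfolding I_def by blast
    qed
  next
    assume "U \<inter> Z \<noteq> {}"
    then show "U \<in> \<F>" using U unfolding Z_def I_def by blast
  qed
  have "irreducible_closedin T Z" unfolding irreducible_closedin_def
  proof (intro conjI allI impI)
    show "closedin T Z" by (rule Zc)
    show "Z \<noteq> {}" using meets[of "topspace T"] F by blast
    fix A B assume AB: "closedin T A \<and> closedin T B \<and> Z = A \<union> B"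
    show "Z = A \<or> Z = B"
    proof (rule ccontr)
      assume "\<not> (Z = A \<or> Z = B)"
      then obtain a b where ab: "a \<in> Z" "a \<notin> A" "b \<in> Z" "b \<notin> B" using AB by blast
      have "a \<in> topspace T - A" "b \<in> topspace T - B" using ab unfolding Z_def by auto
      then obtain U V where U: "U \<in> compact_opens T" "a \<in> U" "U \<subseteq> topspace T - A"
        and V: "V \<in> compact_opens T" "b \<in> V" "V \<subseteq> topspace T - B"
        using bs[of "topspace T - A" a] bs[of "topspace T - B" b] AB unfolding closedin_def by blast
      have "U \<in> \<F>" "V \<in> \<F>" using meets U V ab by blast+
      then have "U \<inter> V \<in> \<F>" by (rule Int)
      moreover have "U \<inter> V \<in> compact_opens T" using \<open>U \<inter> V \<in> \<F>\<close> F by blast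
      ultimately have "U \<inter> V \<inter> Z \<noteq> {}" using meets by blast
      then show False using U V AB by blast
    qed
  qed
  then obtain x where x: "x \<in> topspace T" "Z = T closure_of {x}"
    using sober unfolding sober_space_def by blast
  have "x \<in> U \<longleftrightarrow> U \<in> \<F>" if U: "U \<in> compact_opens T" for U
  proof -
    have "openin T U" using U unfolding compact_opens_def by simp
    then have "U \<inter> Z \<noteq> {} \<longleftrightarrow> x \<in> U"
      unfolding x(2) using openin_Int_closure_of_eq_empty[of T U "{x}"] by auto
    then show ?thesis using meets[OF U] by blast
  qed
  then show ?thesis using x(1) by blast
qed

text \<open>Only an order relation is known about \<open>h\<close>, so unions and intersections are
  first recovered as least and greatest bounds.\<close>

lemma (in set_lattice) spectral_imp_dual_space:
  assumes T: "spectral_space T" and h: "bij_betw h (compact_opens T) L"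
    and anti: "\<forall>U\<in>compact_opens T. \<forall>V\<in>compact_opens T. U \<subseteq> V \<longleftrightarrow> h V \<subseteq> h U"
  shows "\<exists>W. dual_space L X T W"
proof -
  let ?K = "compact_opens T"
  define g where "g = inv_into ?K h"
  have hL: "h U \<in> L" if "U \<in> ?K" for U using h that by (meson bij_betwE)
  have gK: "g C \<in> ?K" and hg: "h (g C) = C" if "C \<in> L" for C
    using h that unfolding g_def by (auto simp: bij_betw_inv_into_right bij_betw_def inv_into_into)
  have gh: "g (h U) = U" if "U \<in> ?K" for U using h that unfolding g_def by (simp add: bij_betw_inv_into_left)
  have ga: "g C \<subseteq> g D \<longleftrightarrow> D \<subseteq> C" if "C \<in> L" "D \<in> L" for C D using anti gK hg that by auto
  have KT: "openin T U" "U \<subseteq> topspace T" if "U \<in> ?K" for U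
    using that openin_subset unfolding compact_opens_def by auto
  have KInt: "U \<inter> V \<in> ?K" if "U \<in> ?K" "V \<in> ?K" for U V using T that unfolding spectral_space_def by blast
  have KUn: "U \<union> V \<in> ?K" if "U \<in> ?K" "V \<in> ?K" for U V
    using that unfolding compact_opens_def by (auto intro: compactin_Un)
  have K0: "{} \<in> ?K" unfolding compact_opens_def by simp
  have K1: "topspace T \<in> ?K" using T unfolding spectral_space_def compact_space_def compact_opens_def by auto
  have gUn: "g (C \<union> D) = g C \<inter> g D" if "C \<in> L" "D \<in> L" for C D
  proof
    have CD: "C \<union> D \<in> L" using Un_in that by blast
    show "g (C \<union> D) \<subseteq> g C \<inter> g D" using ga[OF CD that(1)] ga[OF CD that(2)] by blast
    let ?E = "g C \<inter> g D"
    have E: "?E \<in> ?K" using KInt gK that by blast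
    have "C \<subseteq> h ?E" "D \<subseteq> h ?E"
      using ga[OF hL[OF E] that(1)] ga[OF hL[OF E] that(2)] unfolding gh[OF E] by auto
    then have "g (h ?E) \<subseteq> g (C \<union> D)" using ga[OF hL[OF E] CD] by simp
    then show "?E \<subseteq> g (C \<union> D)" unfolding gh[OF E] .
  qed
  have gInt: "g (C \<inter> D) = g C \<union> g D" if "C \<in> L" "D \<in> L" for C D
  proof
    have CD: "C \<inter> D \<in> L" using Int_in that by blast
    show "g C \<union> g D \<subseteq> g (C \<inter> D)" using ga[OF that(1) CD] ga[OF that(2) CD] by simp
    let ?E = "g C \<union> g D"
    have E: "?E \<in> ?K" using KUn gK that by blast
    have "h ?E \<subseteq> C" "h ?E \<subseteq> D"
      using ga[OF that(1) hL[OF E]] ga[OF that(2) hL[OF E]] unfolding gh[OF E] by auto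
    then have "g (C \<inter> D) \<subseteq> g (h ?E)" using ga[OF CD hL[OF E]] by simp
    then show "g (C \<inter> D) \<subseteq> ?E" unfolding gh[OF E] .
  qed
  have g0: "g {} = topspace T"
  proof
    show "g {} \<subseteq> topspace T" using KT gK empty_in by blast
    have "g (h (topspace T)) \<subseteq> g {}" using ga[OF hL[OF K1] empty_in] by simp
    then show "topspace T \<subseteq> g {}" unfolding gh[OF K1] .
  qed
  have g1: "g X = {}"
  proof -
    have "g X \<subseteq> g (h {})" using ga[OF top_in hL[OF K0]] le_top[OF hL[OF K0]] by simp
    then show ?thesis unfolding gh[OF K0] by simp
  qed
  have "dual_space L X T (\<lambda>C. topspace T - g C)"
  proof
    show "closedin T (topspace T - g C)" if "C \<in> L" for C using KT(1)[OF gK[OF that]] by blast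
    show "topspace T - g (C \<union> D) = (topspace T - g C) \<union> (topspace T - g D)" if "C \<in> L" "D \<in> L" for C D
      using gUn[OF that] by blast
    show "topspace T - g (C \<inter> D) = (topspace T - g C) \<inter> (topspace T - g D)" if "C \<in> L" "D \<in> L" for C D
      using gInt[OF that] by blast
    show "topspace T - g {} = {}" "topspace T - g X = topspace T" using g0 g1 by auto
    show "\<exists>C\<in>L. A \<subseteq> topspace T - g C \<and> x \<notin> topspace T - g C"
      if A: "closedin T A" "x \<in> topspace T" "x \<notin> A" for A x
    proof -
      have "openin T (topspace T - A)" "x \<in> topspace T - A" using A by auto
      moreover have "openin T = arbitrary union_of (\<lambda>U. U \<in> ?K)" using T unfolding spectral_space_def by auto
      ultimately obtain U where "U \<in> ?K" "x \<in> U" "U \<subseteq> topspace T - A"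
        unfolding arbitrary_union_of_alt by metis
      then show ?thesis using A hL gh closedin_subset[OF A(1)] by (intro bexI[of _ "h U"]) auto
    qed
    show "x = y" if "x \<in> topspace T" "y \<in> topspace T"
      "\<And>C. C \<in> L \<Longrightarrow> x \<in> topspace T - g C \<longleftrightarrow> y \<in> topspace T - g C" for x y
    proof (rule spectral_space_points[OF T that(1,2)])
      fix U assume U: "U \<in> ?K"
      show "x \<in> U \<longleftrightarrow> y \<in> U" using that(3)[OF hL[OF U]] that(1,2) unfolding gh[OF U] by blast
    qed
    fix p assume p: "prime_filter L p"
    \<comment> \<open>Since \<open>h\<close> reverses inclusions, the compact open sets with
      \<open>h U\<close> outside the prime filter \<open>p\<close> form a prime filter
      themselves.\<close>
    have "\<exists>x\<in>topspace T. \<forall>U\<in>?K. x \<in> U \<longleftrightarrow> U \<in> {U \<in> ?K. h U \<notin> p}"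
    proof (rule spectral_space_realize[OF T])
      have h1: "h (topspace T) = {}" using hg[OF empty_in] g0 by simp
      have h0: "h {} = X" using hg[OF top_in] g1 by simp
      show "topspace T \<in> {U \<in> ?K. h U \<notin> p}" using K1 h1 prime_filterD(2)[OF p] by simp
      show "{} \<notin> {U \<in> ?K. h U \<notin> p}" using h0 prime_filterD(3)[OF p] by simp
      have hInt: "h (U \<inter> V) = h U \<union> h V" if "U \<in> ?K" "V \<in> ?K" for U V
        using gUn[OF hL hL, OF that] hg[OF Un_in[OF hL hL, OF that]] gh that by metis
      have hUn: "h (U \<union> V) = h U \<inter> h V" if "U \<in> ?K" "V \<in> ?K" for U V
        using gInt[OF hL hL, OF that] hg[OF Int_in[OF hL hL, OF that]] gh that by metis
      fix U V
      show "U \<inter> V \<in> {U \<in> ?K. h U \<notin> p}" if "U \<in> {U \<in> ?K. h U \<notin> p}" "V \<in> {U \<in> ?K. h U \<notin> p}"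
        using that KInt hInt prime_filterD(6)[OF p hL[of U] hL[of V]] by auto
      show "V \<in> {U \<in> ?K. h U \<notin> p}" if "U \<in> {U \<in> ?K. h U \<notin> p}" "V \<in> ?K" "U \<subseteq> V"
        using that anti prime_filterD(4)[OF p, of "h V" "h U"] hL[of U] by auto
      show "U \<in> {U \<in> ?K. h U \<notin> p} \<or> V \<in> {U \<in> ?K. h U \<notin> p}" if "U \<in> ?K" "V \<in> ?K" "U \<union> V \<in> {U \<in> ?K. h U \<notin> p}"
        using that hUn prime_filterD(5)[OF p, of "h U" "h V"] by auto
    qed auto
    then obtain x where x: "x \<in> topspace T" "\<And>U. U \<in> ?K \<Longrightarrow> x \<in> U \<longleftrightarrow> h U \<notin> p" by auto
    have "x \<in> topspace T - g C \<longleftrightarrow> C \<in> p" if "C \<in> L" for C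
      using x(2)[OF gK[OF that]] x(1) hg[OF that] by simp
    then show "\<exists>x\<in>topspace T. \<forall>C\<in>L. x \<in> topspace T - g C \<longleftrightarrow> C \<in> p" using x(1) by blast
  qed
  then show ?thesis by blast
qed

section \<open>Points of a cylinder fan based space\<close>

text \<open>The zero set of \<open>t\<close> within the class of \<open>v\<close>, as far as the
  coordinates in \<open>F\<close> can tell. Fixing only finitely many coordinates makes it a
  cylinder fan even if \<open>K\<close> is infinite.\<close>

definition germ :: "'k set \<Rightarrow> ('k \<Rightarrow> int) \<Rightarrow> 'k set \<Rightarrow> 'k lterm \<Rightarrow> ('k \<Rightarrow> int \<times> real) set" where
  "germ K v F t = {f \<in> Delta_power K. (\<forall>i\<in>F. fst (f i) = v i) \<and> leval t (\<lambda>i. snd (f i)) = 0}"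

text \<open>The terms whose zero sets belong to a given prime filter; the improper filter is admitted.\<close>

definition prime_family :: "'k set \<Rightarrow> 'k lterm set \<Rightarrow> bool" where
  "prime_family K Q \<longleftrightarrow> (\<forall>t\<in>Q. lvars t \<subseteq> K) \<and> LZero \<in> Q \<and>
     (\<forall>s\<in>Q. \<forall>t\<in>Q. \<forall>u. lvars u \<subseteq> K \<longrightarrow> zero_set s \<inter> zero_set t \<subseteq> zero_set u \<longrightarrow> u \<in> Q) \<and>
     (\<forall>u\<in>Q. \<forall>s t. lvars s \<subseteq> K \<longrightarrow> lvars t \<subseteq> K \<longrightarrow> zero_set u \<subseteq> zero_set s \<union> zero_set t \<longrightarrow> s \<in> Q \<or> t \<in> Q)"

lemma germ_eq_cylinder:
  assumes "F \<subseteq> K"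
  shows "germ K v F t = cylinder K F (\<lambda>w. if \<forall>i\<in>F. w i = v i then Some t else None)"
  unfolding germ_def cylinder_def by auto

lemma germ_in_cylinder_fans:
  assumes "finite F" "F \<subseteq> K" "lvars t \<subseteq> F" shows "germ K v F t \<in> cylinder_fans K"
  unfolding cylinder_fans_iff germ_eq_cylinder[OF assms(2)]
  using assms by (intro exI conjI) (auto simp: lterm_family_def split: if_splits)

lemma germ_Int_LZero: "lvars t \<subseteq> F \<Longrightarrow> germ K v F t = germ K v (lvars t) t \<inter> germ K v F LZero"
  unfolding germ_def by auto

lemma cylinder_Int_germ:
  "cylinder K F \<tau> \<inter> germ K v F LZero = (case \<tau> (restrict v F) of None \<Rightarrow> {} | Some t \<Rightarrow> germ K v F t)"
proof -
  have "(\<lambda>i\<in>F. fst (f i)) = restrict v F" if "\<forall>i\<in>F. fst (f i) = v i" for f :: "'a \<Rightarrow> int \<times> real"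
    using that by (auto simp: restrict_def)
  then show ?thesis unfolding cylinder_def germ_def by (cases "\<tau> (restrict v F)") auto
qed

text \<open>Places real coordinates into a given radical class; with it, inclusions between germs
  are read back as inclusions between zero sets.\<close>

definition class_point :: "'k set \<Rightarrow> ('k \<Rightarrow> int) \<Rightarrow> ('k \<Rightarrow> real) \<Rightarrow> 'k \<Rightarrow> int \<times> real" where
  "class_point K v y = (\<lambda>i\<in>K. (v i, real_of_int (quad_sign v i) * \<bar>y i\<bar>))"

lemma class_point_Delta:
  assumes "v \<in> K \<rightarrow> {0, 1}"
  shows "class_point K v y \<in> Delta_power K"
proof -
  have "(v i, real_of_int (quad_sign v i) * \<bar>y i\<bar>) \<in> Delta" if "i \<in> K" for i
    using assms that unfolding Delta_def lex_le_def quad_sign_def by auto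
  then show ?thesis unfolding class_point_def by auto
qed

lemma leval_class_point:
  assumes "lvars t \<subseteq> K" shows "leval t (\<lambda>i. snd (class_point K v y i)) = leval t y"
  using assms by (intro leval_cong) (auto simp: class_point_def abs_mult subset_iff)

lemma class_point_in_germ:
  assumes "v \<in> K \<rightarrow> {0, 1}" "F \<subseteq> K" "lvars t \<subseteq> K"
  shows "class_point K v y \<in> germ K v F t \<longleftrightarrow> y \<in> zero_set t"
proof -
  have "\<forall>i\<in>F. fst (class_point K v y i) = v i" using assms(2) by (auto simp: class_point_def)
  then show ?thesis using class_point_Delta[OF assms(1), of y] leval_class_point[OF assms(3), of v y]
    unfolding germ_def zero_set_def by simp
qed

lemma class_point_in_cylinder:
  assumes "v \<in> K \<rightarrow> {0, 1}" "F \<subseteq> K" "lterm_family F \<tau>"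
  shows "class_point K v y \<in> cylinder K F \<tau> \<longleftrightarrow> (\<exists>t. \<tau> (restrict v F) = Some t \<and> y \<in> zero_set t)"
proof -
  have "(\<lambda>i\<in>F. fst (class_point K v y i)) = restrict v F"
    using assms(2) by (auto simp: class_point_def restrict_def intro!: ext)
  moreover have "leval t (\<lambda>i. snd (class_point K v y i)) = leval t y" if "\<tau> (restrict v F) = Some t" for t
    using assms(2,3) that unfolding lterm_family_def by (intro leval_class_point) blast
  ultimately show ?thesis using class_point_Delta[OF assms(1), of y]
    unfolding cylinder_def zero_set_def by auto
qed

lemma zero_in_zero_set: "(\<lambda>i. 0) \<in> zero_set t"
  unfolding zero_set_def by simp

locale fan_space = dual_space "cylinder_fans K" "Delta_power K" T W
  for K :: "'k set" and T :: "'t topology" and W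
begin

text \<open>For infinite \<open>K\<close> the class of a full vector \<open>v\<close> is only an
  intersection of cylinder fans, so it enters through its constraints on single coordinates.\<close>

definition fibre :: "('k \<Rightarrow> int) \<Rightarrow> 't set" where
  "fibre v = {x \<in> topspace T. \<forall>i\<in>K. x \<in> W (germ K v {i} LZero)}"

definition family :: "('k \<Rightarrow> int) \<Rightarrow> 't \<Rightarrow> 'k lterm set" where
  "family v x = {t. lvars t \<subseteq> K \<and> x \<in> W (germ K v (lvars t) t)}"

lemma fibre_germ_LZero:
  assumes x: "x \<in> fibre v" and F: "finite F" "F \<subseteq> K"
  shows "x \<in> W (germ K v F LZero)"
  using F
proof (induction F rule: finite_induct)
  case empty
  have "germ K v {} LZero = Delta_power K" unfolding germ_def by auto
  then show ?case using W_top x unfolding fibre_def by simp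
next
  case (insert i F)
  have "germ K v (insert i F) LZero = germ K v {i} LZero \<inter> germ K v F LZero"
    unfolding germ_def by auto
  moreover have "x \<in> W (germ K v {i} LZero)" using x insert unfolding fibre_def by simp
  ultimately show ?case
    using insert W_Int[OF germ_in_cylinder_fans germ_in_cylinder_fans, of "{i}" LZero F LZero v v] by simp
qed

text \<open>The filter of a point of the fibre contains the constraints on all coordinates, so it
  does not matter which of them a germ fixes, as long as the variables are covered.\<close>

lemma in_family_iff:
  assumes x: "x \<in> fibre v" and F: "finite F" "F \<subseteq> K" and t: "lvars t \<subseteq> F"
  shows "t \<in> family v x \<longleftrightarrow> x \<in> W (germ K v F t)"
proof -
  have tK: "lvars t \<subseteq> K" using t F by blast
  have "W (germ K v F t) = W (germ K v (lvars t) t) \<inter> W (germ K v F LZero)"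
    unfolding germ_Int_LZero[OF t, of K v]
    by (rule W_Int) (use F tK in \<open>auto intro!: germ_in_cylinder_fans finite_lvars\<close>)
  then show ?thesis using fibre_germ_LZero[OF x F] tK unfolding family_def by auto
qed

text \<open>Intersecting a cylinder fan with the constraints of the fibre leaves only its term in
  the class of \<open>v\<close>. Closed sets within a fibre are thus described by terms.\<close>

lemma in_W_iff:
  assumes x: "x \<in> fibre v" and F: "finite F" "F \<subseteq> K" and \<tau>: "lterm_family F \<tau>"
  shows "x \<in> W (cylinder K F \<tau>) \<longleftrightarrow> (\<exists>t. \<tau> (restrict v F) = Some t \<and> t \<in> family v x)"
proof -
  have C: "cylinder K F \<tau> \<in> cylinder_fans K" unfolding cylinder_fans_iff using F \<tau> by blast
  have "x \<in> W (cylinder K F \<tau>) \<longleftrightarrow> x \<in> W (cylinder K F \<tau> \<inter> germ K v F LZero)"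
    using fibre_germ_LZero[OF x F] W_Int[OF C germ_in_cylinder_fans] F by simp
  also have "\<dots> \<longleftrightarrow> (\<exists>t. \<tau> (restrict v F) = Some t \<and> t \<in> family v x)"
  proof (cases "\<tau> (restrict v F)")
    case None then show ?thesis unfolding cylinder_Int_germ by (simp add: W_empty)
  next
    case (Some t)
    then have "lvars t \<subseteq> F" using \<tau> unfolding lterm_family_def by blast
    then show ?thesis unfolding cylinder_Int_germ using Some in_family_iff[OF x F] by simp
  qed
  finally show ?thesis .
qed

lemma fibre_eqI:
  assumes "x \<in> fibre v" "y \<in> fibre v" "family v x = family v y" shows "x = y"
proof (rule T0)
  show "x \<in> topspace T" "y \<in> topspace T" using assms unfolding fibre_def by auto
  fix C assume "C \<in> cylinder_fans K"
  then obtain F \<tau> where "finite F" "F \<subseteq> K" "lterm_family F \<tau>" "C = cylinder K F \<tau>"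
    unfolding cylinder_fans_iff by (elim exE conjE)
  then show "x \<in> W C \<longleftrightarrow> y \<in> W C" using in_W_iff assms by simp
qed

lemma germ_mono:
  "zero_set s \<inter> zero_set t \<subseteq> zero_set u \<Longrightarrow> germ K v F s \<inter> germ K v F t \<subseteq> germ K v F u"
  unfolding germ_def zero_set_def by auto

lemma germ_Un:
  "zero_set u \<subseteq> zero_set s \<union> zero_set t \<Longrightarrow> germ K v F u \<subseteq> germ K v F s \<union> germ K v F t"
  unfolding germ_def zero_set_def by auto

lemma prime_family_family:
  assumes x: "x \<in> fibre v" shows "prime_family K (family v x)"
  unfolding prime_family_def
proof (intro conjI ballI allI impI)
  show "lvars t \<subseteq> K" if "t \<in> family v x" for t using that unfolding family_def by simp
  show "LZero \<in> family v x" using fibre_germ_LZero[OF x, of "{}"] unfolding family_def by simp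
  fix s t u :: "'k lterm"
  let ?F = "lvars s \<union> lvars t \<union> lvars u"
  have fin: "finite ?F" by (simp add: finite_lvars)
  show "u \<in> family v x" if st: "s \<in> family v x" "t \<in> family v x" and u: "lvars u \<subseteq> K"
    "zero_set s \<inter> zero_set t \<subseteq> zero_set u"
  proof -
    have FK: "?F \<subseteq> K" using st u unfolding family_def by auto
    note in_fam = in_family_iff[OF x fin FK]
    have g: "germ K v ?F s \<in> cylinder_fans K" "germ K v ?F t \<in> cylinder_fans K" "germ K v ?F u \<in> cylinder_fans K"
      using germ_in_cylinder_fans[OF fin FK] by auto
    have "x \<in> W (germ K v ?F s)" "x \<in> W (germ K v ?F t)"
      using in_fam[of s] in_fam[of t] st by auto
    then have "x \<in> W (germ K v ?F s \<inter> germ K v ?F t)" unfolding W_Int[OF g(1,2)] by simp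
    then have "x \<in> W (germ K v ?F u)" using W_mono[OF Int_in[OF g(1,2)] g(3) germ_mono[OF u(2)]] by blast
    then show ?thesis using in_fam by auto
  qed
  show "s \<in> family v x \<or> t \<in> family v x" if u: "u \<in> family v x" and st: "lvars s \<subseteq> K" "lvars t \<subseteq> K"
    "zero_set u \<subseteq> zero_set s \<union> zero_set t"
  proof -
    have FK: "?F \<subseteq> K" using st u unfolding family_def by auto
    note in_fam = in_family_iff[OF x fin FK]
    have g: "germ K v ?F s \<in> cylinder_fans K" "germ K v ?F t \<in> cylinder_fans K" "germ K v ?F u \<in> cylinder_fans K"
      using germ_in_cylinder_fans[OF fin FK] by auto
    have "x \<in> W (germ K v ?F u)" using in_fam u by auto
    then have "x \<in> W (germ K v ?F s \<union> germ K v ?F t)"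
      using W_mono[OF g(3) Un_in[OF g(1,2)] germ_Un[OF st(3)]] by blast
    then have "x \<in> W (germ K v ?F s) \<or> x \<in> W (germ K v ?F t)" using W_Un[OF g(1,2)] by blast
    then show ?thesis using in_fam by auto
  qed
qed

text \<open>The required prime filter consists of the cylinder fans above some germ of a term in
  \<open>Q\<close>; its point exists by duality.\<close>

lemma realize_family:
  assumes v: "v \<in> K \<rightarrow> {0, 1}" and Q: "prime_family K Q"
  shows "\<exists>x\<in>fibre v. family v x = Q"
proof -
  have QK: "\<And>t. t \<in> Q \<Longrightarrow> lvars t \<subseteq> K" and Q0: "LZero \<in> Q"
    and Q1: "\<And>s t u. s \<in> Q \<Longrightarrow> t \<in> Q \<Longrightarrow> lvars u \<subseteq> K \<Longrightarrow> zero_set s \<inter> zero_set t \<subseteq> zero_set u \<Longrightarrow> u \<in> Q"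
    and Q2: "\<And>s t u. u \<in> Q \<Longrightarrow> lvars s \<subseteq> K \<Longrightarrow> lvars t \<subseteq> K \<Longrightarrow> zero_set u \<subseteq> zero_set s \<union> zero_set t \<Longrightarrow> s \<in> Q \<or> t \<in> Q"
    using Q unfolding prime_family_def by blast+
  define p where "p = {C \<in> cylinder_fans K. \<exists>F t. finite F \<and> F \<subseteq> K \<and> t \<in> Q \<and> lvars t \<subseteq> F \<and> germ K v F t \<subseteq> C}"
  have pI: "C \<in> p" if "C \<in> cylinder_fans K" "finite F" "F \<subseteq> K" "t \<in> Q" "lvars t \<subseteq> F" "germ K v F t \<subseteq> C" for C F t
    using that unfolding p_def by blast
  have pE: "\<exists>F t. C \<in> cylinder_fans K \<and> finite F \<and> F \<subseteq> K \<and> t \<in> Q \<and> lvars t \<subseteq> F \<and> germ K v F t \<subseteq> C" if "C \<in> p" for C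
    using that unfolding p_def by blast
  have pp: "prime_filter (cylinder_fans K) p" unfolding prime_filter_def
  proof (intro conjI ballI impI)
    show "p \<subseteq> cylinder_fans K" unfolding p_def by blast
    have "Delta_power K \<in> p" using pI[OF top_in, of "{}" LZero] Q0 le_top germ_in_cylinder_fans[of "{}" K LZero v] by simp
    then show "p \<noteq> {}" by blast
    \<comment> \<open>The origin of the class lies in every germ with term in \<open>Q\<close>, even
      if \<open>Q\<close> consists of all terms.\<close>
    show "{} \<notin> p"
    proof
      assume "{} \<in> p"
      from pE[OF this] obtain F t where "F \<subseteq> K" "t \<in> Q" "germ K v F t \<subseteq> {}" by blast
      then show False using class_point_in_germ[OF v, of F t "\<lambda>_. 0"] QK zero_in_zero_set by blast
    qed
    show "D \<in> p" if "C \<in> p" "D \<in> cylinder_fans K" "C \<subseteq> D" for C D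
    proof -
      obtain F t where "finite F" "F \<subseteq> K" "t \<in> Q" "lvars t \<subseteq> F" "germ K v F t \<subseteq> C" using pE[OF \<open>C \<in> p\<close>] by auto
      then show ?thesis using pI[OF \<open>D \<in> _\<close>, of F t] \<open>C \<subseteq> D\<close> by auto
    qed
    show "C \<inter> D \<in> p" if CD: "C \<in> p" "D \<in> p" for C D
    proof -
      obtain F s where s: "C \<in> cylinder_fans K" "finite F" "F \<subseteq> K" "s \<in> Q" "lvars s \<subseteq> F" "germ K v F s \<subseteq> C" using pE[OF CD(1)] by auto
      obtain F' t where t: "D \<in> cylinder_fans K" "finite F'" "F' \<subseteq> K" "t \<in> Q" "lvars t \<subseteq> F'" "germ K v F' t \<subseteq> D" using pE[OF CD(2)] by auto
      have "lconj s t \<in> Q" by (rule Q1[OF s(4) t(4)]) (use QK s t in \<open>auto simp: zero_set_def\<close>)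
      moreover have "germ K v (F \<union> F') (lconj s t) \<subseteq> germ K v F s \<inter> germ K v F' t" unfolding germ_def by auto
      ultimately show ?thesis
        by (intro pI[OF Int_in[OF s(1) t(1)], of "F \<union> F'" "lconj s t"]) (use s t in auto)
    qed
    fix C D assume CD: "C \<in> cylinder_fans K" "D \<in> cylinder_fans K" "C \<union> D \<in> p"
    obtain F t where t: "finite F" "F \<subseteq> K" "t \<in> Q" "lvars t \<subseteq> F" "germ K v F t \<subseteq> C \<union> D" using pE[OF CD(3)] by auto
    obtain F' \<tau> \<sigma> where F': "finite F'" "F \<subseteq> F'" "F' \<subseteq> K" "lterm_family F' \<tau>" "lterm_family F' \<sigma>"
      and C: "C = cylinder K F' \<tau>" and D: "D = cylinder K F' \<sigma>"
      using cylinder_fans_common_support[OF CD(1,2) t(1,2)] by (elim exE conjE)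
    have cover: "(\<exists>s. \<tau> (restrict v F') = Some s \<and> y \<in> zero_set s) \<or> (\<exists>s. \<sigma> (restrict v F') = Some s \<and> y \<in> zero_set s)"
      if y: "y \<in> zero_set t" for y
    proof -
      have "class_point K v y \<in> germ K v F t" using class_point_in_germ[OF v t(2) QK[OF t(3)]] y by simp
      then have "class_point K v y \<in> C \<or> class_point K v y \<in> D" using t(5) by blast
      then show ?thesis unfolding C D using class_point_in_cylinder[OF v F'(3)] F'(4,5) by simp
    qed
    have fam: "lvars s \<subseteq> F'" if "\<tau> w = Some s \<or> \<sigma> w = Some s" for s w
      using that F'(4,5) unfolding lterm_family_def by blast
    have inC: "C \<in> p" if "\<tau> (restrict v F') = Some s" "s \<in> Q" for s
    proof (rule pI[OF CD(1) F'(1,3) that(2)])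
      show "lvars s \<subseteq> F'" using fam that by blast
      show "germ K v F' s \<subseteq> C" using cylinder_Int_germ[of K F' \<tau> v] that unfolding C by auto
    qed
    have inD: "D \<in> p" if "\<sigma> (restrict v F') = Some s" "s \<in> Q" for s
    proof (rule pI[OF CD(2) F'(1,3) that(2)])
      show "lvars s \<subseteq> F'" using fam that by blast
      show "germ K v F' s \<subseteq> D" using cylinder_Int_germ[of K F' \<sigma> v] that unfolding D by auto
    qed
    \<comment> \<open>The origin lies in every zero set, so the two cylinders cannot both be empty
      in the class of \<open>v\<close>. If one of them is, the term of the other covers alone and
      primeness is applied with that term twice.\<close>
    show "C \<in> p \<or> D \<in> p"
    proof (cases "\<tau> (restrict v F')")
      case None
      then obtain s where s: "\<sigma> (restrict v F') = Some s" using cover[OF zero_in_zero_set] by auto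
      then have "s \<in> Q" using Q2[OF t(3), of s s] cover None fam[of "restrict v F'" s] F'(3) by auto
      then show ?thesis using inD s by blast
    next
      case (Some r)
      show ?thesis
      proof (cases "\<sigma> (restrict v F')")
        case None
        then have "r \<in> Q" using Q2[OF t(3), of r r] cover Some fam[of "restrict v F'" r] F'(3) by auto
        then show ?thesis using inC Some by blast
      next
        case s: (Some s)
        have "r \<in> Q \<or> s \<in> Q"
          using Q2[OF t(3), of r s] cover Some s fam[of "restrict v F'" r] fam[of "restrict v F'" s] F'(3) by auto
        then show ?thesis using inC inD Some s by blast
      qed
    qed
  qed
  obtain x where x: "x \<in> topspace T" "\<And>C. C \<in> cylinder_fans K \<Longrightarrow> x \<in> W C \<longleftrightarrow> C \<in> p"
    using realize[OF pp] by blast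
  have "x \<in> fibre v" unfolding fibre_def
  proof (intro CollectI conjI ballI)
    fix i assume "i \<in> K"
    then have g: "germ K v {i} LZero \<in> cylinder_fans K" by (intro germ_in_cylinder_fans) auto
    then have "germ K v {i} LZero \<in> p" using pI[OF g, of "{i}" LZero] \<open>i \<in> K\<close> Q0 by simp
    then show "x \<in> W (germ K v {i} LZero)" using x(2)[OF g] by simp
  qed (rule x(1))
  moreover have "t \<in> family v x \<longleftrightarrow> t \<in> Q" for t
  proof (cases "lvars t \<subseteq> K")
    case True
    have g: "germ K v (lvars t) t \<in> cylinder_fans K" using True by (intro germ_in_cylinder_fans) (auto simp: finite_lvars)
    have "germ K v (lvars t) t \<in> p \<longleftrightarrow> t \<in> Q"
    proof
      assume "germ K v (lvars t) t \<in> p"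
      from pE[OF this] obtain F s where s: "F \<subseteq> K" "s \<in> Q" "germ K v F s \<subseteq> germ K v (lvars t) t" by auto
      have "zero_set s \<subseteq> zero_set t"
        using class_point_in_germ[OF v s(1) QK[OF s(2)]] class_point_in_germ[OF v True True] s(3) by blast
      then show "t \<in> Q" using Q1[OF s(2) s(2) True] by simp
    next
      assume "t \<in> Q"
      then show "germ K v (lvars t) t \<in> p" using pI[OF g finite_lvars True _ order_refl order_refl] by simp
    qed
    then show ?thesis unfolding family_def using True x(2)[OF g] by simp
  next
    case False then show ?thesis using QK unfolding family_def by auto
  qed
  ultimately show ?thesis by blast
qed

text \<open>For each coordinate the two possible constraints cover the whole power, so every point
  satisfies one of them.\<close>

lemma exists_fibre:
  assumes "x \<in> topspace T"
  shows "\<exists>v. v \<in> K \<rightarrow> {0, 1} \<and> x \<in> fibre v"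
proof -
  define v :: "'k \<Rightarrow> int" where "v i = (if x \<in> W (germ K (\<lambda>_. 0) {i} LZero) then 0 else 1)" for i
  have "x \<in> W (germ K v {i} LZero)" if i: "i \<in> K" for i
  proof -
    have g: "germ K w {i} LZero \<in> cylinder_fans K" for w using i by (intro germ_in_cylinder_fans) auto
    have gw: "germ K v {i} LZero = germ K (\<lambda>_. v i) {i} LZero" unfolding germ_def by simp
    have "Delta_power K = germ K (\<lambda>_. 0) {i} LZero \<union> germ K (\<lambda>_. 1) {i} LZero"
    proof -
      have "fst (f i) = 0 \<or> fst (f i) = 1" if "f \<in> Delta_power K" for f
        using that i by (intro fst_Delta) auto
      then show ?thesis unfolding germ_def by auto
    qed
    then have "x \<in> W (germ K (\<lambda>_. 0) {i} LZero) \<or> x \<in> W (germ K (\<lambda>_. 1) {i} LZero)"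
      using W_Un[OF g[of "\<lambda>_. 0"] g[of "\<lambda>_. 1"]] W_top assms by (metis UnE)
    then show ?thesis unfolding gw v_def by auto
  qed
  then show ?thesis using assms unfolding fibre_def by (intro exI[of _ v]) (auto simp: v_def)
qed

lemma closedin_fibre: "closedin T (fibre v)"
proof -
  have "fibre v = \<Inter>(insert (topspace T) ((\<lambda>i. W (germ K v {i} LZero)) ` K))" unfolding fibre_def by auto
  moreover have "closedin T \<dots>"
    by (intro closedin_Inter) (auto intro!: closedin_W germ_in_cylinder_fans)
  ultimately show ?thesis by simp
qed

text \<open>Within a fibre, a larger family means a specialisation. The point with the largest
  family lies in every closed set that meets the fibre, and it is the only point there with this
  family.\<close>

lemma exists_closed_point:
  assumes v: "v \<in> K \<rightarrow> {0, 1}"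
  shows "\<exists>N\<in>fibre v. family v N = {t. lvars t \<subseteq> K} \<and> closedin T {N} \<and>
    (\<forall>A. closedin T A \<and> A \<inter> fibre v \<noteq> {} \<longrightarrow> N \<in> A)"
proof -
  let ?A = "{t :: 'k lterm. lvars t \<subseteq> K}"
  have "prime_family K ?A" unfolding prime_family_def by simp
  then obtain N where N: "N \<in> fibre v" "family v N = ?A" using realize_family[OF v] by blast
  let ?I = "\<Inter>((\<lambda>t. W (germ K v (lvars t) t)) ` ?A)"
  have clI: "closedin T ?I"
    by (intro closedin_Inter) (auto intro!: closedin_W germ_in_cylinder_fans exI[of _ LZero] simp: finite_lvars)
  have NI: "{N} = ?I \<inter> fibre v"
  proof (intro equalityI subsetI)
    fix x assume "x \<in> {N}" then show "x \<in> ?I \<inter> fibre v" using N unfolding family_def by auto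
  next
    fix x assume x: "x \<in> ?I \<inter> fibre v"
    then have "family v x = ?A" unfolding family_def by auto
    then show "x \<in> {N}" using fibre_eqI[of x v N] N x by simp
  qed
  have "closedin T {N}" unfolding NI by (rule closedin_Int[OF clI closedin_fibre])
  moreover have "N \<in> A" if A: "closedin T A" "x \<in> A" "x \<in> fibre v" for A x
  proof (rule ccontr)
    assume "N \<notin> A"
    moreover have "N \<in> topspace T" using N(1) unfolding fibre_def by simp
    ultimately obtain C where C: "C \<in> cylinder_fans K" "A \<subseteq> W C" "N \<notin> W C" using separate[OF A(1)] by blast
    obtain F \<tau> where F: "finite F" "F \<subseteq> K" "lterm_family F \<tau>" and C': "C = cylinder K F \<tau>"
      using C(1) unfolding cylinder_fans_iff by (elim exE conjE)
    have "x \<in> W C" using A C(2) by blast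
    then have "N \<in> W C"
      unfolding C' in_W_iff[OF A(3) F] in_W_iff[OF N(1) F] N(2) by (auto simp: family_def)
    then show False using C(3) by blast
  qed
  ultimately show ?thesis using N by blast
qed

end

section \<open>Prime ideals of abelian \<open>\<ell>\<close>-groups\<close>

locale l_group =
  fixes G :: "'a lgroup" (structure)
  assumes abelian_lgroup: "abelian_lgroup G"
begin

sublocale comm_group G using abelian_lgroup unfolding abelian_lgroup_def by blast

sublocale order: Lattice.lattice "lgroup_order G" using abelian_lgroup unfolding abelian_lgroup_def by blast

section \<open>Order and lattice arithmetic\<close>

abbreviation lle (infix "\<preceq>" 50) where "x \<preceq> y \<equiv> lgroup_le G x y"
abbreviation ljoin (infixl "\<curlyvee>" 65) where "x \<curlyvee> y \<equiv> lgroup_join G x y"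
abbreviation lmeet (infixl "\<curlywedge>" 65) where "x \<curlywedge> y \<equiv> lgroup_meet G x y"

lemma order_simps: "carrier (lgroup_order G) = carrier G" "le (lgroup_order G) = lgroup_le G"
  by (simp_all add: lgroup_order_def)

lemma lle_refl: "x \<in> carrier G \<Longrightarrow> x \<preceq> x"
  and lle_trans: "x \<preceq> y \<Longrightarrow> y \<preceq> z \<Longrightarrow> x \<in> carrier G \<Longrightarrow> y \<in> carrier G \<Longrightarrow> z \<in> carrier G \<Longrightarrow> x \<preceq> z"
  and lle_antisym: "x \<preceq> y \<Longrightarrow> y \<preceq> x \<Longrightarrow> x \<in> carrier G \<Longrightarrow> y \<in> carrier G \<Longrightarrow> x = y"
  using order.le_refl order.le_trans order.le_antisym unfolding order_simps by blast+

lemmas join_carrier = order.join_closed[unfolded order_simps]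
  and meet_carrier = order.meet_closed[unfolded order_simps]
  and join_upper1 = order.join_left[unfolded order_simps]
  and join_upper2 = order.join_right[unfolded order_simps]
  and meet_lower1 = order.meet_left[unfolded order_simps]
  and meet_lower2 = order.meet_right[unfolded order_simps]
  and join_least = order.join_le[unfolded order_simps]
  and meet_greatest = order.meet_le[unfolded order_simps]

lemma mult_right_mono: "x \<preceq> y \<Longrightarrow> x \<in> carrier G \<Longrightarrow> y \<in> carrier G \<Longrightarrow> z \<in> carrier G \<Longrightarrow> x \<otimes> z \<preceq> y \<otimes> z"
  using abelian_lgroup unfolding abelian_lgroup_def by blast

lemma mult_le_mono:
  assumes "x \<preceq> y" "u \<preceq> v" "x \<in> carrier G" "y \<in> carrier G" "u \<in> carrier G" "v \<in> carrier G"
  shows "x \<otimes> u \<preceq> y \<otimes> v"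
proof -
  have "x \<otimes> u \<preceq> y \<otimes> u" using mult_right_mono assms by blast
  moreover have "u \<otimes> y \<preceq> v \<otimes> y" using mult_right_mono assms by blast
  ultimately show ?thesis using lle_trans[of "x \<otimes> u" "y \<otimes> u" "y \<otimes> v"] assms by (simp add: m_comm)
qed

lemma inv_le_inv:
  assumes "x \<preceq> y" "x \<in> carrier G" "y \<in> carrier G" shows "inv y \<preceq> inv x"
proof -
  have "x \<otimes> (inv x \<otimes> inv y) \<preceq> y \<otimes> (inv x \<otimes> inv y)" using mult_right_mono assms by simp
  moreover have "x \<otimes> (inv x \<otimes> inv y) = inv y" using assms by (simp add: m_assoc[symmetric])
  moreover have "y \<otimes> (inv x \<otimes> inv y) = inv x"
    using assms by (subst m_comm[of "inv x"]) (simp_all add: m_assoc[symmetric])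
  ultimately show ?thesis by simp
qed

lemma join_mult:
  assumes "x \<in> carrier G" "y \<in> carrier G" "z \<in> carrier G"
  shows "(x \<curlyvee> y) \<otimes> z = (x \<otimes> z) \<curlyvee> (y \<otimes> z)"
proof (rule lle_antisym)
  note c = join_carrier[OF assms(1,2)]
  show "(x \<otimes> z) \<curlyvee> (y \<otimes> z) \<preceq> (x \<curlyvee> y) \<otimes> z"
    using assms c by (intro join_least mult_right_mono join_upper1 join_upper2) auto
  let ?w = "(x \<otimes> z) \<curlyvee> (y \<otimes> z)"
  have w: "?w \<in> carrier G" using assms join_carrier by simp
  have "(x \<otimes> z) \<otimes> inv z \<preceq> ?w \<otimes> inv z" "(y \<otimes> z) \<otimes> inv z \<preceq> ?w \<otimes> inv z"
    using assms w by (intro mult_right_mono join_upper1 join_upper2; simp)+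
  then have "x \<curlyvee> y \<preceq> ?w \<otimes> inv z" using assms w by (intro join_least) (simp_all add: m_assoc)
  then have "(x \<curlyvee> y) \<otimes> z \<preceq> (?w \<otimes> inv z) \<otimes> z" using assms w c by (intro mult_right_mono) auto
  then show "(x \<curlyvee> y) \<otimes> z \<preceq> ?w" using assms w by (simp add: m_assoc)
qed (use assms join_carrier in auto)

lemma inv_meet:
  assumes "x \<in> carrier G" "y \<in> carrier G"
  shows "inv (x \<curlywedge> y) = inv x \<curlyvee> inv y"
proof (rule lle_antisym)
  let ?j = "inv x \<curlyvee> inv y"
  have j: "?j \<in> carrier G" and m: "x \<curlywedge> y \<in> carrier G" using assms join_carrier meet_carrier by auto
  show "?j \<preceq> inv (x \<curlywedge> y)"
    using assms m by (intro join_least inv_le_inv meet_lower1 meet_lower2) auto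
  have "inv ?j \<preceq> inv (inv x)" "inv ?j \<preceq> inv (inv y)"
    using assms j by (intro inv_le_inv join_upper1 join_upper2; simp)+
  then have "inv ?j \<preceq> x \<curlywedge> y" using assms j by (intro meet_greatest) auto
  then have "inv (x \<curlywedge> y) \<preceq> inv (inv ?j)" using j m by (intro inv_le_inv) auto
  then show "inv (x \<curlywedge> y) \<preceq> ?j" using j by simp
qed (use assms join_carrier meet_carrier in auto)

lemma meet_eq: "x \<in> carrier G \<Longrightarrow> y \<in> carrier G \<Longrightarrow> x \<curlywedge> y = inv (inv x \<curlyvee> inv y)"
  using inv_meet[of x y] meet_carrier[of x y] by (metis inv_inv)

lemma meet_mult:
  assumes "x \<in> carrier G" "y \<in> carrier G" "z \<in> carrier G"
  shows "(x \<curlywedge> y) \<otimes> z = (x \<otimes> z) \<curlywedge> (y \<otimes> z)"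
proof -
  have "(x \<otimes> z) \<curlywedge> (y \<otimes> z) = inv ((inv x \<otimes> inv z) \<curlyvee> (inv y \<otimes> inv z))"
    using assms by (simp add: meet_eq inv_mult)
  also have "\<dots> = inv ((inv x \<curlyvee> inv y) \<otimes> inv z)" using assms by (simp add: join_mult)
  also have "\<dots> = (x \<curlywedge> y) \<otimes> z" using assms join_carrier by (simp add: meet_eq inv_mult)
  finally show ?thesis by simp
qed

text \<open>With \<open>?n\<close> the meet of \<open>x\<close> and the unit, the positive part of
  \<open>x\<close> is \<open>x\<close> divided by \<open>?n\<close> and that of its inverse is the
  unit divided by \<open>?n\<close>; their meet is \<open>?n\<close> divided by itself.\<close>

lemma pos_neg_disjoint:
  assumes x: "x \<in> carrier G" shows "(x \<curlyvee> \<one>) \<curlywedge> (inv x \<curlyvee> \<one>) = \<one>"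
proof -
  let ?n = "x \<curlywedge> \<one>"
  have n: "?n \<in> carrier G" using x meet_carrier by simp
  have y: "inv x \<curlyvee> \<one> = inv ?n" using inv_meet[OF x one_closed] by simp
  have "(inv x \<curlyvee> \<one>) \<otimes> x = \<one> \<curlyvee> x" using join_mult[of "inv x" \<one> x] x by simp
  also have "\<dots> = x \<curlyvee> \<one>" unfolding join_def by (simp add: insert_commute)
  finally have "x \<curlyvee> \<one> = x \<otimes> inv ?n" using y n x by (simp add: m_comm)
  then have "(x \<curlyvee> \<one>) \<curlywedge> (inv x \<curlyvee> \<one>) = (x \<curlywedge> \<one>) \<otimes> inv ?n"
    using y n x meet_mult[of x \<one> "inv ?n"] by simp
  then show ?thesis using n by simp
qed

text \<open>No absolute values are taken here, unlike in \<open>leval\<close>. The two evaluations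
  are compared only when all values of variables are at or above the unit.\<close>

primrec lgeval :: "('k \<Rightarrow> 'a) \<Rightarrow> 'k lterm \<Rightarrow> 'a" where
  "lgeval a (LVar i) = a i"
| "lgeval a LZero = \<one>"
| "lgeval a (LAdd s t) = lgeval a s \<otimes> lgeval a t"
| "lgeval a (LNeg t) = inv (lgeval a t)"
| "lgeval a (LSup s t) = lgeval a s \<curlyvee> lgeval a t"

lemma lgeval_carrier: "(\<And>i. i \<in> lvars t \<Longrightarrow> a i \<in> carrier G) \<Longrightarrow> lgeval a t \<in> carrier G"
  by (induction t) (auto simp: join_carrier)

end

section \<open>The totally ordered quotient by a prime ideal\<close>

locale l_group_prime = l_group +
  fixes P assumes prime: "prime_lideal G P"
begin

lemma subgroup_P: "subgroup P G" and P_carrier: "x \<in> P \<Longrightarrow> x \<in> carrier G"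
  and P_join: "x \<in> P \<Longrightarrow> y \<in> P \<Longrightarrow> x \<curlyvee> y \<in> P"
  and P_convex: "x \<in> P \<Longrightarrow> y \<in> P \<Longrightarrow> z \<in> carrier G \<Longrightarrow> x \<preceq> z \<Longrightarrow> z \<preceq> y \<Longrightarrow> z \<in> P"
  and P_prime: "x \<in> carrier G \<Longrightarrow> y \<in> carrier G \<Longrightarrow> x \<curlywedge> y \<in> P \<Longrightarrow> x \<in> P \<or> y \<in> P"
proof -
  note l = prime[unfolded prime_lideal_def, THEN conjunct1, unfolded lideal_def]
  note j = l[THEN conjunct2, THEN conjunct1] and c = l[THEN conjunct2, THEN conjunct2]
    and p = prime[unfolded prime_lideal_def, THEN conjunct2, THEN conjunct2]
  show *: "subgroup P G" by (rule l[THEN conjunct1])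
  show "x \<in> P \<Longrightarrow> x \<in> carrier G" using subgroup.mem_carrier[OF *] .
  show "x \<in> P \<Longrightarrow> y \<in> P \<Longrightarrow> x \<curlyvee> y \<in> P" using j by simp
  show "x \<in> P \<Longrightarrow> y \<in> P \<Longrightarrow> z \<in> carrier G \<Longrightarrow> x \<preceq> z \<Longrightarrow> z \<preceq> y \<Longrightarrow> z \<in> P"
    by (rule c[rule_format]) (assumption | rule conjI)+
  show "x \<in> carrier G \<Longrightarrow> y \<in> carrier G \<Longrightarrow> x \<curlywedge> y \<in> P \<Longrightarrow> x \<in> P \<or> y \<in> P"
    by (rule p[rule_format])
qed

lemmas P_one = subgroup.one_closed[OF subgroup_P]
  and P_mult = subgroup.m_closed[OF subgroup_P]
  and P_inv = subgroup.m_inv_closed[OF subgroup_P]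

text \<open>Nonnegativity in the totally ordered quotient modulo \<open>P\<close>.\<close>

definition ge_one :: "'a \<Rightarrow> bool" where "ge_one g \<longleftrightarrow> (\<exists>p\<in>P. p \<preceq> g)"

lemma ge_one_mult:
  assumes "ge_one g" "ge_one h" "g \<in> carrier G" "h \<in> carrier G" shows "ge_one (g \<otimes> h)"
proof -
  obtain p q where "p \<in> P" "q \<in> P" "p \<preceq> g" "q \<preceq> h" using assms unfolding ge_one_def by blast
  then have "p \<otimes> q \<in> P" "p \<otimes> q \<preceq> g \<otimes> h" using P_mult mult_le_mono P_carrier assms by auto
  then show ?thesis unfolding ge_one_def by blast
qed

text \<open>The positive parts of \<open>x\<close> and of its inverse are disjoint, so primeness
  puts one of them into \<open>P\<close>, and the opposite element is then nonnegative modulo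
  \<open>P\<close>.\<close>

lemma ge_one_total:
  assumes x: "x \<in> carrier G" shows "ge_one x \<or> ge_one (inv x)"
proof -
  have c: "x \<curlyvee> \<one> \<in> carrier G" "inv x \<curlyvee> \<one> \<in> carrier G" using x join_carrier by auto
  have "x \<curlyvee> \<one> \<in> P \<or> inv x \<curlyvee> \<one> \<in> P"
    using P_prime[OF c] pos_neg_disjoint[OF x] P_one by simp
  then show ?thesis
  proof
    assume "x \<curlyvee> \<one> \<in> P"
    then have "inv (x \<curlyvee> \<one>) \<in> P" by (rule P_inv)
    moreover have "inv (x \<curlyvee> \<one>) \<preceq> inv x" using x c by (intro inv_le_inv join_upper1) auto
    ultimately show ?thesis unfolding ge_one_def by blast
  next
    assume "inv x \<curlyvee> \<one> \<in> P"
    then have "inv (inv x \<curlyvee> \<one>) \<in> P" by (rule P_inv)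
    moreover have "inv (inv x \<curlyvee> \<one>) \<preceq> inv (inv x)" using x c by (intro inv_le_inv join_upper1) auto
    ultimately show ?thesis using x unfolding ge_one_def by auto
  qed
qed

text \<open>Antisymmetry of the order modulo \<open>P\<close>, from convexity.\<close>

lemma in_P_iff:
  assumes x: "x \<in> carrier G" shows "x \<in> P \<longleftrightarrow> ge_one x \<and> ge_one (inv x)"
proof
  assume "x \<in> P"
  then show "ge_one x \<and> ge_one (inv x)" using P_inv lle_refl P_carrier unfolding ge_one_def by blast
next
  assume "ge_one x \<and> ge_one (inv x)"
  then obtain p q where pq: "p \<in> P" "q \<in> P" "p \<preceq> x" "q \<preceq> inv x" unfolding ge_one_def by blast
  have "inv (inv x) \<preceq> inv q" using pq x P_carrier by (intro inv_le_inv) auto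
  then show "x \<in> P" using P_convex[OF pq(1) P_inv[OF pq(2)] x pq(3)] x by simp
qed

lemma P_cancel:
  assumes "x \<in> carrier G" "y \<in> carrier G" "x \<otimes> inv y \<in> P" shows "x \<in> P \<longleftrightarrow> y \<in> P"
proof
  assume "y \<in> P"
  then have "(x \<otimes> inv y) \<otimes> y \<in> P" using assms P_mult by blast
  then show "x \<in> P" using assms by (simp add: m_assoc)
next
  assume "x \<in> P"
  then have "inv (x \<otimes> inv y) \<otimes> x \<in> P" using assms P_mult P_inv by blast
  moreover have "inv (x \<otimes> inv y) \<otimes> x = y" using assms by (simp add: inv_mult m_comm[of "inv x"] m_assoc)
  ultimately show "y \<in> P" by simp
qed

text \<open>Modulo \<open>P\<close> this is the join of \<open>m\<close> and a smaller
  \<open>n\<close>. The element is squeezed between \<open>s\<close> divided by \<open>m\<close> and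
  the join of that with \<open>?q\<close>, both members of \<open>P\<close>.\<close>

lemma join_quotient_in_P:
  assumes c: "s \<in> carrier G" "t \<in> carrier G" "m \<in> carrier G" "n \<in> carrier G"
    and P: "s \<otimes> inv m \<in> P" "t \<otimes> inv n \<in> P" and ge: "ge_one (m \<otimes> inv n)"
  shows "(s \<curlyvee> t) \<otimes> inv m \<in> P"
proof -
  obtain p where p: "p \<in> P" "p \<preceq> m \<otimes> inv n" using ge unfolding ge_one_def by blast
  have pc: "p \<in> carrier G" using p P_carrier by blast
  have e: "(s \<curlyvee> t) \<otimes> inv m = (s \<otimes> inv m) \<curlyvee> (t \<otimes> inv m)" using c by (intro join_mult) auto
  let ?q = "(t \<otimes> inv n) \<otimes> inv p"
  have qP: "?q \<in> P" using P_mult[OF P(2) P_inv[OF p(1)]] .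
  have "inv (m \<otimes> inv n) \<preceq> inv p" using p pc c by (intro inv_le_inv) auto
  then have "inv (m \<otimes> inv n) \<otimes> (t \<otimes> inv n) \<preceq> inv p \<otimes> (t \<otimes> inv n)" using pc c by (intro mult_right_mono) auto
  moreover have "inv (m \<otimes> inv n) \<otimes> (t \<otimes> inv n) = t \<otimes> inv m"
  proof -
    have "inv (m \<otimes> inv n) \<otimes> (t \<otimes> inv n) = (inv m \<otimes> n) \<otimes> (inv n \<otimes> t)"
      using c by (simp add: inv_mult m_comm)
    also have "\<dots> = inv m \<otimes> (n \<otimes> (inv n \<otimes> t))" using c by (intro m_assoc) auto
    also have "n \<otimes> (inv n \<otimes> t) = t" using c by (simp add: m_assoc[symmetric])
    also have "inv m \<otimes> t = t \<otimes> inv m" using c by (simp add: m_comm)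
    finally show ?thesis .
  qed
  ultimately have le: "t \<otimes> inv m \<preceq> ?q" using c pc by (simp add: m_comm)
  have jP: "(s \<otimes> inv m) \<curlyvee> ?q \<in> P" using P_join[OF P(1) qP] .
  have cc: "s \<otimes> inv m \<in> carrier G" "t \<otimes> inv m \<in> carrier G" "?q \<in> carrier G" using c pc by auto
  have "(s \<otimes> inv m) \<curlyvee> (t \<otimes> inv m) \<preceq> (s \<otimes> inv m) \<curlyvee> ?q"
    using cc le join_carrier lle_trans[OF le join_upper2[OF cc(1,3)]]
    by (intro join_least join_upper1) auto
  then show ?thesis unfolding e using P_convex[OF P(1) jP join_carrier[OF cc(1,2)] join_upper1[OF cc(1,2)]] by simp
qed

text \<open>The multiplicative form of \<open>pair\<close>: the functional \<open>l\<close> at the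
  point of \<open>G\<close> with coordinates \<open>a\<close>.\<close>

definition lval :: "'k set \<Rightarrow> ('k \<Rightarrow> 'a) \<Rightarrow> ('k \<Rightarrow> int) \<Rightarrow> 'a" where
  "lval F a l = (\<Otimes>i\<in>F. a i [^] l i)"

context
  fixes F :: "'k set" and a :: "'k \<Rightarrow> 'a"
  assumes F: "finite F" and a: "\<And>i. i \<in> F \<Longrightarrow> a i \<in> carrier G"
begin

lemma lval_carrier: "lval F a l \<in> carrier G"
  unfolding lval_def using a by (intro finprod_closed) auto

lemma lval_add: "lval F a (\<lambda>i. l i + m i) = lval F a l \<otimes> lval F a m"
proof -
  have "lval F a (\<lambda>i. l i + m i) = (\<Otimes>i\<in>F. a i [^] l i \<otimes> a i [^] m i)"
    unfolding lval_def using a by (intro finprod_cong') (auto simp: int_pow_mult)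
  then show ?thesis unfolding lval_def using a by (subst finprod_multf[symmetric]) auto
qed

lemma lval_zero: "lval F a (\<lambda>i. 0) = \<one>"
  unfolding lval_def by (intro finprod_one_eqI) simp

lemma lval_minus: "lval F a (\<lambda>i. - l i) = inv (lval F a l)"
proof -
  have "lval F a (\<lambda>i. - l i) \<otimes> lval F a l = \<one>" using lval_add[of "\<lambda>i. - l i" l] lval_zero by simp
  then show ?thesis using lval_carrier inv_equality by metis
qed

lemma lval_unit_vec: assumes "i \<in> F" shows "lval F a (unit_vec i) = a i"
proof -
  have "lval F a (unit_vec i) = (\<Otimes>j\<in>F. if i = j then a j else \<one>)"
    unfolding lval_def unit_vec_def using a by (intro finprod_cong') (auto simp: int_pow_1)
  then show ?thesis using finprod_singleton[OF assms F, of a] a by auto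
qed

text \<open>Totality comes from primeness of \<open>P\<close>, the clause on unit vectors from
  positivity of the generators.\<close>

lemma pos_cone_lval:
  assumes "\<And>i. i \<in> F \<Longrightarrow> \<one> \<preceq> a i"
  shows "pos_cone F {l. ge_one (lval F a l)}"
  unfolding pos_cone_def
proof (intro conjI ballI allI)
  show "(\<lambda>i. l i + m i) \<in> {l. ge_one (lval F a l)}" if "l \<in> {l. ge_one (lval F a l)}" "m \<in> {l. ge_one (lval F a l)}" for l m
    using that ge_one_mult lval_carrier by (simp add: lval_add)
  show "l \<in> {l. ge_one (lval F a l)} \<or> (\<lambda>i. - l i) \<in> {l. ge_one (lval F a l)}" for l
    using ge_one_total[OF lval_carrier] by (simp add: lval_minus)
  show "unit_vec i \<in> {l. ge_one (lval F a l)}" if "i \<in> F" for i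
    using assms[OF that] P_one by (auto simp: lval_unit_vec[OF that] ge_one_def)
qed

text \<open>The group counterpart of \<open>leval_eq_pair_lin\<close>: modulo \<open>P\<close> each
  join is decided by the sign of the difference in the totally ordered quotient, and
  \<open>lin\<close> makes the same decision.\<close>

lemma lgeval_lin:
  assumes "lvars t \<subseteq> F"
  shows "lgeval a t \<otimes> inv (lval F a (lin {l. ge_one (lval F a l)} t)) \<in> P"
  using assms
proof (induction t)
  case (LVar i)
  then show ?case using a P_one by (simp add: lval_unit_vec)
next
  case LZero
  then show ?case using P_one by (simp add: lval_zero)
next
  case (LAdd s t)
  let ?v = "\<lambda>t. lval F a (lin {l. ge_one (lval F a l)} t)"
  have c: "lgeval a s \<in> carrier G" "lgeval a t \<in> carrier G" using a LAdd.prems by (auto intro!: lgeval_carrier)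
  have "lgeval a (LAdd s t) \<otimes> inv (?v (LAdd s t)) = (lgeval a s \<otimes> inv (?v s)) \<otimes> (lgeval a t \<otimes> inv (?v t))"
    using c lval_carrier by (simp add: lval_add inv_mult m_ac)
  then show ?case using LAdd P_mult by simp
next
  case (LNeg t)
  let ?v = "\<lambda>t. lval F a (lin {l. ge_one (lval F a l)} t)"
  have c: "lgeval a t \<in> carrier G" using a LNeg.prems by (auto intro!: lgeval_carrier)
  have "lgeval a (LNeg t) \<otimes> inv (?v (LNeg t)) = inv (lgeval a t \<otimes> inv (?v t))"
    using c lval_carrier by (simp add: lval_minus inv_mult)
  then show ?case using LNeg P_inv by simp
next
  case (LSup s t)
  let ?Q = "{l. ge_one (lval F a l)}"
  let ?v = "\<lambda>t. lval F a (lin ?Q t)"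
  have c: "lgeval a s \<in> carrier G" "lgeval a t \<in> carrier G" using a LSup.prems by (auto intro!: lgeval_carrier)
  have IH: "lgeval a s \<otimes> inv (?v s) \<in> P" "lgeval a t \<otimes> inv (?v t) \<in> P" using LSup by auto
  have diff: "lval F a (\<lambda>j. l j - m j) = lval F a l \<otimes> inv (lval F a m)" for l m
    using lval_add[of l "\<lambda>j. - m j"] lval_minus[of m] by simp
  show ?case
  proof (cases "(\<lambda>j. lin ?Q s j - lin ?Q t j) \<in> ?Q")
    case True
    then have "ge_one (?v s \<otimes> inv (?v t))" by (simp add: diff)
    then show ?thesis using join_quotient_in_P[OF c lval_carrier lval_carrier IH] True by simp
  next
    case False
    then have "ge_one (inv (?v s \<otimes> inv (?v t)))"
      using ge_one_total[of "?v s \<otimes> inv (?v t)"] lval_carrier by (simp add: diff)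
    then have "ge_one (?v t \<otimes> inv (?v s))" using lval_carrier by (simp add: inv_mult m_comm)
    then have "(lgeval a t \<curlyvee> lgeval a s) \<otimes> inv (?v t) \<in> P"
      using join_quotient_in_P[OF c(2,1) lval_carrier lval_carrier IH(2,1)] by simp
    moreover have "lgeval a t \<curlyvee> lgeval a s = lgeval a s \<curlyvee> lgeval a t"
      unfolding join_def by (simp add: insert_commute)
    ultimately show ?thesis using False by simp
  qed
qed

text \<open>Modulo \<open>P\<close> a term has the value of its functional, so it lies in
  \<open>P\<close> exactly if this functional and its negative are both in the point cone;
  \<open>zero_set_transfer\<close> then applies.\<close>

lemma lgeval_transfer:
  assumes pos: "\<And>i. i \<in> F \<Longrightarrow> \<one> \<preceq> a i" and st: "lvars s \<subseteq> F" "lvars t \<subseteq> F" "zero_set s \<subseteq> zero_set t"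
    and s: "lgeval a s \<in> P"
  shows "lgeval a t \<in> P"
proof -
  let ?Q = "{l. ge_one (lval F a l)}"
  have iff: "lgeval a u \<in> P \<longleftrightarrow> lin ?Q u \<in> ?Q \<and> (\<lambda>j. - lin ?Q u j) \<in> ?Q" if u: "lvars u \<subseteq> F" for u
  proof -
    have "lgeval a u \<in> carrier G" using a u by (auto intro!: lgeval_carrier)
    then have "lgeval a u \<in> P \<longleftrightarrow> lval F a (lin ?Q u) \<in> P"
      using P_cancel[OF _ lval_carrier lgeval_lin[OF u]] by blast
    then show ?thesis using in_P_iff[OF lval_carrier] by (simp add: lval_minus)
  qed
  have Q: "pos_cone F ?Q" using pos_cone_lval pos by blast
  show ?thesis
    using zero_set_transfer[OF F st(1,2) Q st(3)] iff[OF st(1)] iff[OF st(2)] s by blast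
qed

end

end

section \<open>The spectrum of an \<open>\<ell>\<close>-group with positive generators\<close>

text \<open>The common setting of both implications: \<open>G\<close> is a given group generated by
  positive parts in one, a quotient of term functions in the other.\<close>

locale lgroup_rep = fan_space K T W + l_group G
  for K :: "'k set" and T :: "'t topology" and W and G :: "'a lgroup" (structure) +
  fixes a :: "'k \<Rightarrow> 'a" and v :: "'k \<Rightarrow> int"
  assumes a_carrier: "i \<in> K \<Longrightarrow> a i \<in> carrier G" and a_pos: "i \<in> K \<Longrightarrow> \<one> \<preceq> a i"
    and generated: "g \<in> carrier G \<Longrightarrow> \<exists>t. lvars t \<subseteq> K \<and> lgeval a t = g"
    and v: "v \<in> K \<rightarrow> {0, 1}"
begin

text \<open>The family has to contain the kernel of the evaluation in \<open>G\<close>; otherwise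
  membership of a term would not be determined by its value.\<close>

definition rep_points :: "'t set" where
  "rep_points = {x \<in> fibre v. \<forall>t. lvars t \<subseteq> K \<and> lgeval a t = \<one> \<longrightarrow> t \<in> family v x}"

definition to_ideal :: "'t \<Rightarrow> 'a set" where
  "to_ideal x = lgeval a ` family v x"

lemma eval_carrier: "lvars t \<subseteq> K \<Longrightarrow> lgeval a t \<in> carrier G"
  using a_carrier by (intro lgeval_carrier) auto

lemma family_lvars: "t \<in> family v x \<Longrightarrow> lvars t \<subseteq> K"
  unfolding family_def by simp

lemma family_LZero:
  assumes "x \<in> fibre v" shows "LZero \<in> family v x"
  using prime_family_family[OF assms] unfolding prime_family_def by (elim conjE)

lemma family_Int:
  assumes "x \<in> fibre v" "s \<in> family v x" "t \<in> family v x" "lvars u \<subseteq> K" "zero_set s \<inter> zero_set t \<subseteq> zero_set u"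
  shows "u \<in> family v x"
  by (rule prime_family_family[OF assms(1), unfolded prime_family_def, THEN conjunct2, THEN conjunct2,
      THEN conjunct1, rule_format, OF assms(2-5)])

lemma family_Un:
  assumes "x \<in> fibre v" "u \<in> family v x" "lvars s \<subseteq> K" "lvars t \<subseteq> K" "zero_set u \<subseteq> zero_set s \<union> zero_set t"
  shows "s \<in> family v x \<or> t \<in> family v x"
  by (rule prime_family_family[OF assms(1), unfolded prime_family_def, THEN conjunct2, THEN conjunct2,
      THEN conjunct2, rule_format, OF assms(2-5)])

lemma rep_points_fibre: "x \<in> rep_points \<Longrightarrow> x \<in> fibre v"
  unfolding rep_points_def by simp

text \<open>Terms of equal value differ by a term of trivial value, which belongs to the family.
  Where this difference and one of the terms vanish, so does the other.\<close>

lemma in_to_ideal_iff: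
  assumes x: "x \<in> rep_points" and t: "lvars t \<subseteq> K"
  shows "lgeval a t \<in> to_ideal x \<longleftrightarrow> t \<in> family v x"
proof
  assume "lgeval a t \<in> to_ideal x"
  then obtain s where s: "s \<in> family v x" "lgeval a t = lgeval a s" unfolding to_ideal_def by auto
  have sK: "lvars s \<subseteq> K" using family_lvars[OF s(1)] .
  let ?d = "LAdd t (LNeg s)"
  have "lgeval a ?d = \<one>" using s(2) eval_carrier[OF sK] by simp
  then have d: "?d \<in> family v x" using x t sK unfolding rep_points_def by simp
  show "t \<in> family v x"
    by (rule family_Int[OF rep_points_fibre[OF x] s(1) d t]) (auto simp: zero_set_def)
qed (simp add: to_ideal_def)

lemma eval_linf: "lvars s \<subseteq> K \<Longrightarrow> lvars t \<subseteq> K \<Longrightarrow> lgeval a (linf s t) = lgeval a s \<curlywedge> lgeval a t"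
  unfolding linf_def using eval_carrier by (simp add: meet_eq)

lemma to_ideal_prime:
  assumes x: "x \<in> rep_points" and ne: "family v x \<noteq> {t. lvars t \<subseteq> K}"
  shows "prime_lideal G (to_ideal x)"
proof -
  note xf = rep_points_fibre[OF x]
  have elim: "\<exists>t. t \<in> family v x \<and> lvars t \<subseteq> K \<and> g = lgeval a t" if "g \<in> to_ideal x" for g
    using that family_lvars unfolding to_ideal_def by auto
  have intro: "lgeval a t \<in> to_ideal x" if "t \<in> family v x" for t
    using that unfolding to_ideal_def by auto
  have two: "lgeval a u \<in> to_ideal x" if "s \<in> family v x" "t \<in> family v x" "lvars u \<subseteq> lvars s \<union> lvars t"
    "zero_set s \<inter> zero_set t \<subseteq> zero_set u" for s t u
    using family_Int[OF xf that(1,2) _ that(4)] that(3) family_lvars[OF that(1)] family_lvars[OF that(2)]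
    by (intro intro) auto
  have sub: "subgroup (to_ideal x) G"
  proof
    show "to_ideal x \<subseteq> carrier G" using elim eval_carrier by blast
    have "lgeval a LZero \<in> to_ideal x" using family_LZero[OF xf] by (rule intro)
    then show "\<one> \<in> to_ideal x" by simp
    show "g \<otimes> h \<in> to_ideal x" if gh: "g \<in> to_ideal x" "h \<in> to_ideal x" for g h
    proof -
      obtain s t where st: "s \<in> family v x" "g = lgeval a s" "t \<in> family v x" "h = lgeval a t"
        using elim[OF gh(1)] elim[OF gh(2)] by auto
      then have "lgeval a (LAdd s t) \<in> to_ideal x" by (intro two[of s t]) (auto simp: zero_set_def)
      then show ?thesis using st by simp
    qed
    show "inv g \<in> to_ideal x" if gh: "g \<in> to_ideal x" for g
    proof -
      obtain s where st: "s \<in> family v x" "g = lgeval a s" using elim[OF gh(1)] by auto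
      then have "lgeval a (LNeg s) \<in> to_ideal x" by (intro two[of s s]) (auto simp: zero_set_def)
      then show ?thesis using st by simp
    qed
  qed
  have lat: "g \<curlywedge> h \<in> to_ideal x \<and> g \<curlyvee> h \<in> to_ideal x" if gh: "g \<in> to_ideal x" "h \<in> to_ideal x" for g h
  proof -
    obtain s t where st: "s \<in> family v x" "lvars s \<subseteq> K" "g = lgeval a s" "t \<in> family v x" "lvars t \<subseteq> K" "h = lgeval a t"
      using elim[OF gh(1)] elim[OF gh(2)] by auto
    then have "lgeval a (LSup s t) \<in> to_ideal x" by (intro two[of s t]) (auto simp: zero_set_def)
    moreover have "lgeval a (linf s t) \<in> to_ideal x" using st by (intro two[of s t]) (auto simp: zero_set_def)
    ultimately show ?thesis using st eval_linf by simp
  qed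
  have conv: "z \<in> to_ideal x" if gh: "g \<in> to_ideal x" "h \<in> to_ideal x" "z \<in> carrier G" "g \<preceq> z" "z \<preceq> h" for g h z
  proof -
    obtain s t where st: "s \<in> family v x" "lvars s \<subseteq> K" "g = lgeval a s" "t \<in> family v x" "lvars t \<subseteq> K" "h = lgeval a t"
      using elim[OF gh(1)] elim[OF gh(2)] by auto
    obtain u where u: "lvars u \<subseteq> K" "lgeval a u = z" using generated[OF gh(3)] by blast
    have c: "g \<in> carrier G" "h \<in> carrier G" using st eval_carrier by auto
    \<comment> \<open>Writing \<open>z\<close> as the meet of \<open>g \<curlyvee> z\<close> and
      \<open>h\<close> gives a term of value \<open>z\<close> that is squeezed to zero wherever
      \<open>s\<close> and \<open>t\<close> vanish.\<close>
    have "g \<curlyvee> z = z"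
      using c gh by (intro lle_antisym join_least join_upper2 lle_refl join_carrier) auto
    moreover have "z \<curlywedge> h = z"
      using c gh by (intro lle_antisym meet_greatest meet_lower1 lle_refl meet_carrier) auto
    ultimately have ev: "lgeval a (linf (LSup s u) t) = z"
      using st u by (subst eval_linf) auto
    have "linf (LSup s u) t \<in> family v x"
      using st u by (intro family_Int[OF xf st(1,4)]) (auto simp: zero_set_def)
    then show ?thesis using intro ev by metis
  qed
  have prime: "g \<in> to_ideal x \<or> h \<in> to_ideal x" if gh: "g \<in> carrier G" "h \<in> carrier G" "g \<curlywedge> h \<in> to_ideal x" for g h
  proof -
    obtain s where s: "lvars s \<subseteq> K" "lgeval a s = g" using generated[OF gh(1)] by blast
    obtain t where t: "lvars t \<subseteq> K" "lgeval a t = h" using generated[OF gh(2)] by blast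
    have "lgeval a (linf s t) \<in> to_ideal x" using gh(3) s t eval_linf by simp
    then have "linf s t \<in> family v x" using in_to_ideal_iff[OF x, of "linf s t"] s t by simp
    then have "s \<in> family v x \<or> t \<in> family v x"
      using s t by (intro family_Un[OF xf]) (auto simp: zero_set_def min_def split: if_splits)
    then show ?thesis using intro s t by auto
  qed
  obtain t where "lvars t \<subseteq> K" "t \<notin> family v x" using ne family_lvars by blast
  then have "lgeval a t \<in> carrier G - to_ideal x" using in_to_ideal_iff[OF x] eval_carrier by simp
  then have ne': "to_ideal x \<noteq> carrier G" by blast
  show ?thesis unfolding prime_lideal_def lideal_def
  proof (intro conjI ballI impI)
    show "subgroup (to_ideal x) G" by (rule sub)
    show "to_ideal x \<noteq> carrier G" by (rule ne')
    show "g \<curlywedge> h \<in> to_ideal x" "g \<curlyvee> h \<in> to_ideal x" if "g \<in> to_ideal x" "h \<in> to_ideal x" for g h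
      using lat[OF that] by auto
    show "z \<in> to_ideal x" if "g \<in> to_ideal x" "h \<in> to_ideal x" "z \<in> carrier G" "g \<preceq> z \<and> z \<preceq> h" for g h z
      using conv[OF that(1-3)] that(4) by simp
    show "g \<in> to_ideal x \<or> h \<in> to_ideal x" if "g \<in> carrier G" "h \<in> carrier G" "g \<curlywedge> h \<in> to_ideal x" for g h
      using prime[OF that] .
  qed
qed

text \<open>Closure under inclusion of zero sets is \<open>lgeval_transfer\<close>. Intersections
  are handled by the sum of absolute values, unions by their meet, to which primeness of
  \<open>P\<close> applies.\<close>

lemma ideal_family:
  assumes P: "prime_lideal G P"
  shows "prime_family K {t. lvars t \<subseteq> K \<and> lgeval a t \<in> P}" (is "prime_family K ?Q")
proof -
  interpret P: l_group_prime G P by unfold_locales (rule P)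
  have transfer: "lgeval a t \<in> P" if "lgeval a s \<in> P" "lvars s \<subseteq> K" "lvars t \<subseteq> K" "zero_set s \<subseteq> zero_set t" for s t
    using that a_carrier a_pos
    by (intro P.lgeval_transfer[of "lvars s \<union> lvars t" a s t]) (auto simp: finite_lvars)
  have abs: "lgeval a (labs t) \<in> P" if "lgeval a t \<in> P" for t
    using that P.P_join P.P_inv unfolding labs_def by simp
  show ?thesis unfolding prime_family_def
  proof (intro conjI ballI allI impI)
    show "LZero \<in> ?Q" using P.P_one by simp
    fix s t u :: "'k lterm"
    show "u \<in> ?Q" if "s \<in> ?Q" "t \<in> ?Q" "lvars u \<subseteq> K" "zero_set s \<inter> zero_set t \<subseteq> zero_set u"
    proof -
      have "lgeval a (lconj s t) \<in> P" using that abs P.P_mult unfolding lconj_def by simp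
      then show ?thesis using transfer[of "lconj s t" u] that by (auto simp: zero_set_def)
    qed
    show "s \<in> ?Q \<or> t \<in> ?Q" if u: "u \<in> ?Q" "lvars s \<subseteq> K" "lvars t \<subseteq> K" "zero_set u \<subseteq> zero_set s \<union> zero_set t"
    proof -
      have "lgeval a (ldisj s t) \<in> P" using transfer[of u "ldisj s t"] u by (auto simp: zero_set_def)
      then have "lgeval a (labs s) \<curlywedge> lgeval a (labs t) \<in> P" using eval_linf[of "labs s" "labs t"] u unfolding ldisj_def by simp
      then have "lgeval a (labs s) \<in> P \<or> lgeval a (labs t) \<in> P" using P.P_prime eval_carrier u by simp
      then show ?thesis using transfer[of "labs s" s] transfer[of "labs t" t] u by (auto simp: zero_set_def)
    qed
  qed simp
qed

lemma to_ideal_surj: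
  assumes P: "prime_lideal G P"
  shows "\<exists>x\<in>rep_points. family v x \<noteq> {t. lvars t \<subseteq> K} \<and> to_ideal x = P"
proof -
  interpret P: l_group_prime G P by unfold_locales (rule P)
  obtain x where x: "x \<in> fibre v" "family v x = {t. lvars t \<subseteq> K \<and> lgeval a t \<in> P}"
    using realize_family[OF v ideal_family[OF P]] by blast
  have xr: "x \<in> rep_points" unfolding rep_points_def using x P.P_one by simp
  have eq: "to_ideal x = P"
  proof (intro equalityI subsetI)
    fix g assume "g \<in> to_ideal x" then show "g \<in> P" unfolding to_ideal_def x(2) by auto
  next
    fix g assume g: "g \<in> P"
    then obtain t where "lvars t \<subseteq> K" "lgeval a t = g" using generated P.P_carrier by blast
    then show "g \<in> to_ideal x" unfolding to_ideal_def x(2) using g by auto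
  qed
  have "P \<noteq> carrier G" using P unfolding prime_lideal_def by simp
  then obtain g where "g \<in> carrier G" "g \<notin> P" using P.P_carrier by blast
  then obtain t where "lvars t \<subseteq> K" "lgeval a t \<notin> P" using generated by blast
  then have "family v x \<noteq> {t. lvars t \<subseteq> K}" unfolding x(2) by auto
  then show ?thesis using xr eq by blast
qed

lemma closedin_rep_points: "closedin T rep_points"
proof -
  define \<W> where "\<W> = insert (fibre v) ((\<lambda>t. W (germ K v (lvars t) t)) ` {t. lvars t \<subseteq> K \<and> lgeval a t = \<one>})"
  have "rep_points = \<Inter>\<W>"
    unfolding rep_points_def family_def \<W>_def by auto
  moreover have "closedin T (\<Inter>\<W>)"
  proof (rule closedin_Inter)
    show "\<W> \<noteq> {}" unfolding \<W>_def by simp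
    fix S assume "S \<in> \<W>"
    then show "closedin T S" unfolding \<W>_def
      by (auto intro!: closedin_fibre closedin_W germ_in_cylinder_fans simp: finite_lvars)
  qed
  ultimately show ?thesis by simp
qed

lemma topspace_lgroup_spectrum: "topspace (lgroup_spectrum G) = {P. prime_lideal G P}"
proof -
  have "\<exists>g\<in>carrier G. g \<notin> P" if "prime_lideal G P" for P
  proof -
    interpret P: l_group_prime G P by unfold_locales (rule that)
    have "P \<noteq> carrier G" using that unfolding prime_lideal_def by simp
    then show ?thesis using P.P_carrier by blast
  qed
  then show ?thesis unfolding lgroup_spectrum_def topology_generated_by_topspace by auto
qed

lemma openin_lgroup_spectrum: "g \<in> carrier G \<Longrightarrow> openin (lgroup_spectrum G) {P. prime_lideal G P \<and> g \<notin> P}"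
  unfolding lgroup_spectrum_def by (intro topology_generated_by_Basis) blast

text \<open>The homeomorphism is \<open>to_ideal\<close>. It would send \<open>M\<close>, whose
  family contains all terms, to the whole carrier, which is not a proper ideal; and \<open>M\<close>
  lies in every closed set meeting the fibre, so no other point is closed.\<close>

theorem rep_points_spectrum:
  "\<exists>M. M \<in> rep_points \<and> {x \<in> rep_points. closedin (subtopology T rep_points) {x}} = {M} \<and>
    subtopology T (rep_points - {M}) homeomorphic_space lgroup_spectrum G"
proof -
  let ?A = "{t :: 'k lterm. lvars t \<subseteq> K}"
  obtain M where M: "M \<in> fibre v" "family v M = ?A" "closedin T {M}"
    "\<forall>A. closedin T A \<and> A \<inter> fibre v \<noteq> {} \<longrightarrow> M \<in> A"
    using exists_closed_point[OF v] by (elim bexE conjE)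
  have MY: "M \<in> rep_points" unfolding rep_points_def using M by simp
  have uniq: "x = M" if "x \<in> rep_points" "family v x = ?A" for x
    using fibre_eqI[OF rep_points_fibre[OF that(1)] M(1)] that(2) M(2) by simp
  have nonM: "family v x \<noteq> ?A" if "x \<in> rep_points - {M}" for x using uniq that by blast
  have only: "x = M" if x: "x \<in> rep_points" "closedin (subtopology T rep_points) {x}" for x
  proof -
    obtain A where A: "closedin T A" "{x} = A \<inter> rep_points" using x(2) unfolding closedin_subtopology by auto
    have "M \<in> A" using M(4) A rep_points_fibre[OF x(1)] by blast
    then have "M \<in> {x}" unfolding A(2) using MY by blast
    then show ?thesis by simp
  qed
  have Mclosed: "closedin (subtopology T rep_points) {M}"
    unfolding closedin_subtopology using M(3) MY by (intro exI[of _ "{M}"]) auto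
  have closed_pts: "{x \<in> rep_points. closedin (subtopology T rep_points) {x}} = {M}"
    using only Mclosed MY by blast
  let ?X = "subtopology T (rep_points - {M})"
  have "rep_points \<subseteq> topspace T" using closedin_subset[OF closedin_rep_points] .
  then have tX: "topspace ?X = rep_points - {M}" by auto
  have im: "to_ideal ` (rep_points - {M}) = {P. prime_lideal G P}"
  proof (intro equalityI subsetI)
    fix P assume "P \<in> to_ideal ` (rep_points - {M})"
    then obtain x where x: "x \<in> rep_points - {M}" "P = to_ideal x" by blast
    then have "prime_lideal G P" using to_ideal_prime[of x] nonM[OF x(1)] by simp
    then show "P \<in> {P. prime_lideal G P}" by simp
  next
    fix P assume "P \<in> {P. prime_lideal G P}"
    then obtain x where "x \<in> rep_points" "family v x \<noteq> ?A" "to_ideal x = P" using to_ideal_surj by blast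
    then show "P \<in> to_ideal ` (rep_points - {M})" using M(2) by blast
  qed
  have inj: "inj_on to_ideal (rep_points - {M})"
  proof (rule inj_onI)
    fix x y assume xy: "x \<in> rep_points - {M}" "y \<in> rep_points - {M}" "to_ideal x = to_ideal y"
    have "t \<in> family v x \<longleftrightarrow> t \<in> family v y" for t
      using in_to_ideal_iff[of x t] in_to_ideal_iff[of y t] xy family_lvars[of t] by auto
    then show "x = y" using fibre_eqI[of x v y] xy rep_points_fibre by blast
  qed
  have cont: "continuous_map ?X (lgroup_spectrum G) to_ideal"
    unfolding lgroup_spectrum_def
  proof (rule continuous_on_generated_topo)
    fix U assume "U \<in> {{P. prime_lideal G P \<and> g \<notin> P} | g. g \<in> carrier G}"
    then obtain g where g: "g \<in> carrier G" "U = {P. prime_lideal G P \<and> g \<notin> P}" by blast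
    obtain t where t: "lvars t \<subseteq> K" "lgeval a t = g" using generated[OF g(1)] by blast
    have "to_ideal -` U \<inter> topspace ?X = (topspace T - W (germ K v (lvars t) t)) \<inter> (rep_points - {M})"
    proof (intro equalityI subsetI)
      fix x assume "x \<in> to_ideal -` U \<inter> topspace ?X"
      then have x: "x \<in> rep_points - {M}" "g \<notin> to_ideal x" unfolding tX g(2) by auto
      then have "t \<notin> family v x" using in_to_ideal_iff[of x t] t by simp
      then show "x \<in> (topspace T - W (germ K v (lvars t) t)) \<inter> (rep_points - {M})"
        using x t \<open>rep_points \<subseteq> topspace T\<close> unfolding family_def by auto
    next
      fix x assume x: "x \<in> (topspace T - W (germ K v (lvars t) t)) \<inter> (rep_points - {M})"
      then have "t \<notin> family v x" unfolding family_def by simp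
      then have "g \<notin> to_ideal x" using in_to_ideal_iff[of x t] t x by simp
      then show "x \<in> to_ideal -` U \<inter> topspace ?X" unfolding tX g(2) using x im by blast
    qed
    moreover have "openin T (topspace T - W (germ K v (lvars t) t))"
      using closedin_W[OF germ_in_cylinder_fans[OF finite_lvars t(1) order_refl]] unfolding closedin_def by blast
    ultimately show "openin ?X (to_ideal -` U \<inter> topspace ?X)" unfolding openin_subtopology by blast
  next
    show "to_ideal ` topspace ?X \<subseteq> \<Union>{{P. prime_lideal G P \<and> g \<notin> P} | g. g \<in> carrier G}"
      using topspace_lgroup_spectrum[unfolded lgroup_spectrum_def topology_generated_by_topspace] im tX by simp
  qed
  have "open_map ?X (lgroup_spectrum G) to_ideal"
    unfolding open_map_def
  proof (intro allI impI)
    fix U assume "openin ?X U"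
    then obtain S where S: "openin T S" "U = S \<inter> (rep_points - {M})" unfolding openin_subtopology by blast
    show "openin (lgroup_spectrum G) (to_ideal ` U)"
      unfolding openin_subopen[of _ "to_ideal ` U"]
    proof
      fix P assume "P \<in> to_ideal ` U"
      then obtain x where x: "x \<in> S" "x \<in> rep_points - {M}" "P = to_ideal x" using S(2) by blast
      have xT: "x \<in> topspace T" using x(1) openin_subset[OF S(1)] by blast
      have cl: "closedin T (topspace T - S)" using S(1) by blast
      have "x \<notin> topspace T - S" using x(1) by blast
      then obtain C where C: "C \<in> cylinder_fans K" "topspace T - S \<subseteq> W C" "x \<notin> W C"
        using separate[OF cl xT] by blast
      obtain F \<tau> where F: "finite F" "F \<subseteq> K" "lterm_family F \<tau>" and C': "C = cylinder K F \<tau>"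
        using C(1) unfolding cylinder_fans_iff by (elim exE conjE)
      have inU: "y \<in> U" if "y \<in> rep_points - {M}" "y \<notin> W C" for y
        using that C(2) \<open>rep_points \<subseteq> topspace T\<close> S(2) by blast
      \<comment> \<open>Within the fibre \<open>W C\<close> is governed by the term of
        \<open>C\<close> in the class of \<open>v\<close>. If there is none, \<open>U\<close> is
        everything; otherwise the prime ideals omitting the value of this term form the
        neighbourhood.\<close>
      show "\<exists>V. openin (lgroup_spectrum G) V \<and> P \<in> V \<and> V \<subseteq> to_ideal ` U"
      proof (cases "\<tau> (restrict v F)")
        case None
        have "rep_points - {M} \<subseteq> U"
        proof
          fix y assume y: "y \<in> rep_points - {M}"
          then have "y \<notin> W C" using None unfolding C' in_W_iff[OF rep_points_fibre F, of y] by (simp add: in_W_iff[OF rep_points_fibre F])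
          then show "y \<in> U" using inU y by blast
        qed
        then have "to_ideal ` U = topspace (lgroup_spectrum G)"
          using im topspace_lgroup_spectrum S(2) by blast
        then show ?thesis using \<open>P \<in> to_ideal ` U\<close> by (intro exI[of _ "to_ideal ` U"]) auto
      next
        case (Some t)
        then have tK: "lvars t \<subseteq> K" using F(2,3) unfolding lterm_family_def by blast
        have iff: "y \<in> W C \<longleftrightarrow> lgeval a t \<in> to_ideal y" if "y \<in> rep_points" for y
          unfolding C' in_W_iff[OF rep_points_fibre[OF that] F] in_to_ideal_iff[OF that tK] using Some by simp
        let ?V = "{P. prime_lideal G P \<and> lgeval a t \<notin> P}"
        have "openin (lgroup_spectrum G) ?V" using openin_lgroup_spectrum eval_carrier[OF tK] by simp
        moreover have "P \<in> ?V" using x im C(3) iff[of x] by blast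
        moreover have "?V \<subseteq> to_ideal ` U"
        proof
          fix Q assume Q: "Q \<in> ?V"
          then obtain y where y: "y \<in> rep_points - {M}" "Q = to_ideal y" using im by blast
          then have "y \<notin> W C" using iff[of y] Q by simp
          then show "Q \<in> to_ideal ` U" using inU y by blast
        qed
        ultimately show ?thesis by blast
      qed
    qed
  qed
  then have "homeomorphic_map ?X (lgroup_spectrum G) to_ideal"
    using cont im inj tX topspace_lgroup_spectrum by (intro bijective_open_imp_homeomorphic_map) auto
  then show ?thesis using MY closed_pts homeomorphic_map_imp_homeomorphic_space by blast
qed

end

section \<open>From \<open>\<ell>\<close>-groups to cylinder fan based spaces and back\<close>

text \<open>Shows that positive parts generate the group, so they can serve as values of the
  variables.\<close>

lemma (in l_group) pos_neg_generate:
  assumes g: "g \<in> carrier G" shows "(g \<curlyvee> \<one>) \<otimes> inv (inv g \<curlyvee> \<one>) = g"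
proof -
  let ?n = "inv g \<curlyvee> \<one>"
  have n: "?n \<in> carrier G" using g join_carrier by simp
  have "?n \<otimes> g = \<one> \<curlyvee> g" using join_mult[of "inv g" \<one> g] g by simp
  then have "g \<curlyvee> \<one> = g \<otimes> ?n" using g n unfolding join_def by (simp add: insert_commute m_comm)
  then show ?thesis using g n by (simp add: m_assoc)
qed

lemma cylinder_fan_based_stone_space: "cylinder_fan_based K (stone_space (cylinder_fans K))"
  unfolding cylinder_fan_based_def
  using set_lattice.spectral_stone_space[OF set_lattice_cylinder_fans]
    set_lattice.stone_space_dual[OF set_lattice_cylinder_fans] by (intro conjI)

lemma cylinder_fan_based_fan_space:
  assumes "cylinder_fan_based K T" shows "\<exists>W. fan_space K T W"
proof -
  obtain h where "spectral_space T" "bij_betw h (compact_opens T) (cylinder_fans K)"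
    "\<forall>U\<in>compact_opens T. \<forall>V\<in>compact_opens T. U \<subseteq> V \<longleftrightarrow> h V \<subseteq> h U"
    using assms unfolding cylinder_fan_based_def by (elim exE conjE)
  then show ?thesis
    using set_lattice.spectral_imp_dual_space[OF set_lattice_cylinder_fans] unfolding fan_space_def by blast
qed

proposition spectrum_closed_subset_of_fan_space:
  fixes G :: "'g lgroup"
  assumes G: "abelian_lgroup G"
  shows "\<exists>Y M. closedin (stone_space (cylinder_fans (carrier G))) Y \<and>
    {x \<in> Y. closedin (subtopology (stone_space (cylinder_fans (carrier G))) Y) {x}} = {M} \<and>
    lgroup_spectrum G homeomorphic_space subtopology (stone_space (cylinder_fans (carrier G))) (Y - {M})"
proof -
  let ?K = "carrier G" let ?T = "stone_space (cylinder_fans ?K)"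
  interpret l_group G by unfold_locales (rule G)
  obtain W where "fan_space ?K ?T W" using cylinder_fan_based_fan_space[OF cylinder_fan_based_stone_space] by blast
  then interpret fan_space ?K ?T W .
  \<comment> \<open>The variable \<open>g\<close> takes the positive part of \<open>g\<close> as its
    value, and the fibre is that over the zero vector.\<close>
  interpret lgroup_rep ?K ?T W G "\<lambda>g. lgroup_join G g \<one>\<^bsub>G\<^esub>" "\<lambda>_. 0"
  proof unfold_locales
    show "g \<curlyvee> \<one>\<^bsub>G\<^esub> \<in> carrier G" "\<one>\<^bsub>G\<^esub> \<preceq> g \<curlyvee> \<one>\<^bsub>G\<^esub>" if "g \<in> carrier G" for g
      using that join_carrier join_upper2 by auto
    show "\<exists>t. lvars t \<subseteq> carrier G \<and> lgeval (\<lambda>g. g \<curlyvee> \<one>\<^bsub>G\<^esub>) t = g" if "g \<in> carrier G" for g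
      using pos_neg_generate[OF that] that by (intro exI[of _ "LAdd (LVar g) (LNeg (LVar (inv\<^bsub>G\<^esub> g)))"]) auto
  qed auto
  show ?thesis using closedin_rep_points rep_points_spectrum homeomorphic_space_sym by blast
qed

section \<open>Closed sets with a single closed point\<close>

context fan_space
begin

text \<open>Every fibre met by \<open>Y\<close> contributes its own closed point to
  \<open>Y\<close>. All these equal \<open>M\<close>, and fibres of vectors that differ on
  \<open>K\<close> are disjoint.\<close>

lemma closed_subset_in_fibre:
  assumes Y: "closedin T Y" and M: "{x \<in> Y. closedin (subtopology T Y) {x}} = {M}"
  shows "\<exists>v. v \<in> K \<rightarrow> {0, 1} \<and> Y \<subseteq> fibre v"
proof -
  have YT: "Y \<subseteq> topspace T" using closedin_subset[OF Y] .
  have *: "M \<in> fibre w" if y: "y \<in> Y" "y \<in> fibre w" "w \<in> K \<rightarrow> {0, 1}" for y w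
  proof -
    obtain N where N: "N \<in> fibre w" "closedin T {N}" "\<forall>A. closedin T A \<and> A \<inter> fibre w \<noteq> {} \<longrightarrow> N \<in> A"
      using exists_closed_point[OF y(3)] by (elim bexE conjE)
    have NY: "N \<in> Y" using N(3) Y y by blast
    then have "closedin (subtopology T Y) {N}" using N(2) unfolding closedin_subtopology by blast
    then have "N \<in> {M}" using NY M by blast
    then show ?thesis using N(1) by simp
  qed
  have "M \<in> Y" using M by blast
  then obtain v where v: "v \<in> K \<rightarrow> {0, 1}" "M \<in> fibre v" using exists_fibre YT by blast
  have "y \<in> fibre v" if y: "y \<in> Y" for y
  proof -
    obtain w where w: "w \<in> K \<rightarrow> {0, 1}" "y \<in> fibre w" using exists_fibre YT y by blast
    have Mw: "M \<in> fibre w" using *[OF y w(2,1)] .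
    have "v i = w i" if i: "i \<in> K" for i
    proof (rule ccontr)
      assume "v i \<noteq> w i"
      then have "germ K v {i} LZero \<inter> germ K w {i} LZero = {}" unfolding germ_def by auto
      moreover have "M \<in> W (germ K v {i} LZero) \<inter> W (germ K w {i} LZero)"
        using v(2) Mw i unfolding fibre_def by simp
      moreover have "germ K v {i} LZero \<in> cylinder_fans K" "germ K w {i} LZero \<in> cylinder_fans K"
        using i by (auto intro!: germ_in_cylinder_fans)
      ultimately show False using W_Int W_empty by (metis empty_iff)
    qed
    then have "germ K v {i} LZero = germ K w {i} LZero" if "i \<in> K" for i
      using that unfolding germ_def by simp
    then show ?thesis using w(2) unfolding fibre_def by simp
  qed
  then show ?thesis using v(1) by blast
qed

text \<open>A cylinder fan whose closed set contains \<open>Y\<close> has one term in the class of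
  \<open>v\<close>, the same for all points of \<open>Y\<close>; the term exists because
  \<open>Y\<close> is nonempty. Being common to all families, it belongs to that of
  \<open>x\<close>.\<close>

lemma closed_subset_families:
  assumes Y: "closedin T Y" and Yv: "Y \<subseteq> fibre v"
    and x: "x \<in> fibre v" and sub: "(\<Inter>y\<in>Y. family v y) \<subseteq> family v x" and ne: "Y \<noteq> {}"
  shows "x \<in> Y"
proof (rule ccontr)
  assume "x \<notin> Y"
  moreover have "x \<in> topspace T" using x unfolding fibre_def by simp
  ultimately obtain C where C: "C \<in> cylinder_fans K" "Y \<subseteq> W C" "x \<notin> W C" using separate[OF Y] by blast
  obtain F \<tau> where F: "finite F" "F \<subseteq> K" "lterm_family F \<tau>" and C': "C = cylinder K F \<tau>"
    using C(1) unfolding cylinder_fans_iff by (elim exE conjE)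
  have *: "\<exists>t. \<tau> (restrict v F) = Some t \<and> t \<in> family v y" if "y \<in> Y" for y
    using C(2) that in_W_iff[OF subsetD[OF Yv that] F] unfolding C' by blast
  obtain y where "y \<in> Y" using ne by blast
  then obtain t where t: "\<tau> (restrict v F) = Some t" using * by blast
  have "t \<in> family v y" if "y \<in> Y" for y using *[OF that] t by simp
  then have "t \<in> family v x" using sub by blast
  then have "x \<in> W C" unfolding C' in_W_iff[OF x F] using t by blast
  then show False using C(3) by blast
qed

end

section \<open>Quotients of the group of term functions\<close>

lemma lgroup_order_latticeI:
  fixes G :: "'a lgroup"
  assumes refl: "\<And>x. x \<in> carrier G \<Longrightarrow> lgroup_le G x x"
    and antisym: "\<And>x y. x \<in> carrier G \<Longrightarrow> y \<in> carrier G \<Longrightarrow> lgroup_le G x y \<Longrightarrow> lgroup_le G y x \<Longrightarrow> x = y"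
    and trans: "\<And>x y z. x \<in> carrier G \<Longrightarrow> y \<in> carrier G \<Longrightarrow> z \<in> carrier G \<Longrightarrow>
      lgroup_le G x y \<Longrightarrow> lgroup_le G y z \<Longrightarrow> lgroup_le G x z"
    and join: "\<And>x y. x \<in> carrier G \<Longrightarrow> y \<in> carrier G \<Longrightarrow> \<exists>j\<in>carrier G. lgroup_le G x j \<and> lgroup_le G y j \<and>
      (\<forall>z\<in>carrier G. lgroup_le G x z \<and> lgroup_le G y z \<longrightarrow> lgroup_le G j z)"
    and meet: "\<And>x y. x \<in> carrier G \<Longrightarrow> y \<in> carrier G \<Longrightarrow> \<exists>j\<in>carrier G. lgroup_le G j x \<and> lgroup_le G j y \<and>
      (\<forall>z\<in>carrier G. lgroup_le G z x \<and> lgroup_le G z y \<longrightarrow> lgroup_le G z j)"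
  shows "Lattice.lattice (lgroup_order G)"
proof -
  interpret partial_order "lgroup_order G"
    by unfold_locales (auto simp: lgroup_order_def intro: refl antisym trans)
  show ?thesis
  proof unfold_locales
    fix x y assume xy: "x \<in> carrier (lgroup_order G)" "y \<in> carrier (lgroup_order G)"
    then have xy': "x \<in> carrier G" "y \<in> carrier G" by (auto simp: lgroup_order_def)
    show "\<exists>s. least (lgroup_order G) s (Upper (lgroup_order G) {x, y})"
      using join[OF xy'] xy' by (auto simp: least_def Upper_def lgroup_order_def)
    show "\<exists>s. greatest (lgroup_order G) s (Lower (lgroup_order G) {x, y})"
      using meet[OF xy'] xy' by (auto simp: greatest_def Lower_def lgroup_order_def)
  qed
qed

text \<open>An \<open>\<ell>\<close>-ideal of \<open>G\<^sub>K\<close>, given as a set of terms.\<close>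

locale term_ideal =
  fixes K :: "'k set" and J :: "'k lterm set"
  assumes J_lvars: "t \<in> J \<Longrightarrow> lvars t \<subseteq> K" and J_zero: "LZero \<in> J"
    and J_Int: "s \<in> J \<Longrightarrow> t \<in> J \<Longrightarrow> lvars u \<subseteq> K \<Longrightarrow> zero_set s \<inter> zero_set t \<subseteq> zero_set u \<Longrightarrow> u \<in> J"
begin

abbreviation KT :: "'k lterm set" where "KT \<equiv> {t. lvars t \<subseteq> K}"

text \<open>Made of functions rather than terms, so terms with equal values are identified and the
  elements of the quotient are genuine cosets.\<close>

definition coset :: "'k lterm \<Rightarrow> (('k \<Rightarrow> real) \<Rightarrow> real) set" where
  "coset t = {leval s | s. s \<in> KT \<and> LAdd s (LNeg t) \<in> J}"

text \<open>Cosets are multiplied elementwise. The order is that of a quotient by an ideal: the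
  positive part of the difference of representatives lies in \<open>J\<close>.\<close>

definition quot :: "(('k \<Rightarrow> real) \<Rightarrow> real) set lgroup" where
  "quot = \<lparr>carrier = coset ` KT, mult = (\<lambda>X Y. {\<lambda>x. f x + g x | f g. f \<in> X \<and> g \<in> Y}), one = coset LZero,
     lgroup_le = (\<lambda>X Y. \<exists>s t. s \<in> KT \<and> t \<in> KT \<and> X = coset s \<and> Y = coset t \<and>
       LSup (LAdd s (LNeg t)) LZero \<in> J)\<rparr>"

text \<open>Membership in \<open>J\<close> depends only on zero sets, so each law of the quotient
  reduces to an implication between real values at a point, left to arithmetic.\<close>

lemma J_intro:
  assumes "r \<in> J" "s \<in> J" "t \<in> J" "u \<in> KT"
    and "\<And>x. leval r x = 0 \<Longrightarrow> leval s x = 0 \<Longrightarrow> leval t x = 0 \<Longrightarrow> leval u x = 0"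
  shows "u \<in> J"
proof -
  have "lconj r s \<in> J" using J_Int[OF assms(1,2), of "lconj r s"] J_lvars assms(1,2) by (auto simp: zero_set_def)
  then show ?thesis using J_Int[OF _ assms(3), of "lconj r s" u] assms(4,5) by (auto simp: zero_set_def)
qed

lemma J_intro1:
  assumes "r \<in> J" "u \<in> KT" "\<And>x. leval r x = 0 \<Longrightarrow> leval u x = 0" shows "u \<in> J"
  by (rule J_intro[OF assms(1) J_zero J_zero assms(2)]) (rule assms(3))

lemma J_intro2:
  assumes "r \<in> J" "s \<in> J" "u \<in> KT" "\<And>x. leval r x = 0 \<Longrightarrow> leval s x = 0 \<Longrightarrow> leval u x = 0" shows "u \<in> J"
  by (rule J_intro[OF assms(1,2) J_zero assms(3)]) (rule assms(4))

lemma J_trivial: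
  assumes "u \<in> KT" "\<And>x. leval u x = 0" shows "u \<in> J"
  by (rule J_intro[OF J_zero J_zero J_zero assms(1)]) (rule assms(2))

lemma leval_in_coset: "t \<in> KT \<Longrightarrow> leval t \<in> coset t"
  unfolding coset_def by (auto intro!: exI[of _ t] J_trivial)

lemma coset_eq_iff:
  assumes "s \<in> KT" "t \<in> KT" shows "coset s = coset t \<longleftrightarrow> LAdd s (LNeg t) \<in> J"
proof
  assume "coset s = coset t"
  then have "leval s \<in> coset t" using leval_in_coset[OF assms(1)] by simp
  then obtain u where u: "leval s = leval u" "LAdd u (LNeg t) \<in> J" unfolding coset_def by auto
  show "LAdd s (LNeg t) \<in> J" by (rule J_intro1[OF u(2)]) (use assms u(1) in auto)
next
  assume st: "LAdd s (LNeg t) \<in> J"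
  have "LAdd u (LNeg s) \<in> J \<longleftrightarrow> LAdd u (LNeg t) \<in> J" if "u \<in> KT" for u
  proof
    assume "LAdd u (LNeg s) \<in> J"
    then show "LAdd u (LNeg t) \<in> J" by (rule J_intro2[OF st]) (use that assms in auto)
  next
    assume "LAdd u (LNeg t) \<in> J"
    then show "LAdd u (LNeg s) \<in> J" by (rule J_intro2[OF st]) (use that assms in auto)
  qed
  then show "coset s = coset t" unfolding coset_def by blast
qed

lemma coset_eqI:
  assumes "s \<in> KT" "t \<in> KT" "\<And>x. leval s x = leval t x" shows "coset s = coset t"
  unfolding coset_eq_iff[OF assms(1,2)] by (rule J_trivial) (use assms in auto)

lemma quot_carrier: "carrier quot = coset ` KT"
  and quot_one: "\<one>\<^bsub>quot\<^esub> = coset LZero"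
  by (simp_all add: quot_def)

lemma quot_mult:
  assumes "s \<in> KT" "t \<in> KT" shows "coset s \<otimes>\<^bsub>quot\<^esub> coset t = coset (LAdd s t)"
proof -
  have "coset s \<otimes>\<^bsub>quot\<^esub> coset t = {\<lambda>x. f x + g x | f g. f \<in> coset s \<and> g \<in> coset t}" by (simp add: quot_def)
  also have "\<dots> = coset (LAdd s t)"
  proof (intro equalityI subsetI)
    fix h assume "h \<in> {\<lambda>x. f x + g x | f g. f \<in> coset s \<and> g \<in> coset t}"
    then obtain p q where pq: "p \<in> KT" "q \<in> KT" "LAdd p (LNeg s) \<in> J" "LAdd q (LNeg t) \<in> J"
      "h = (\<lambda>x. leval p x + leval q x)"
      unfolding coset_def by auto
    have "LAdd (LAdd p q) (LNeg (LAdd s t)) \<in> J"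
      by (rule J_intro2[OF pq(3,4)]) (use pq assms in auto)
    moreover have "h = leval (LAdd p q)" using pq(5) by auto
    ultimately show "h \<in> coset (LAdd s t)" unfolding coset_def using pq by (intro CollectI exI[of _ "LAdd p q"]) auto
  next
    fix h assume "h \<in> coset (LAdd s t)"
    then obtain u where u: "u \<in> KT" "LAdd u (LNeg (LAdd s t)) \<in> J" "h = leval u" unfolding coset_def by auto
    let ?d = "LAdd u (LNeg s)"
    have "LAdd ?d (LNeg t) \<in> J" by (rule J_intro1[OF u(2)]) (use u assms in auto)
    then have "leval ?d \<in> coset t" unfolding coset_def using u assms by (intro CollectI exI[of _ ?d]) auto
    moreover have "h = (\<lambda>x. leval s x + leval ?d x)" using u(3) by auto
    ultimately show "h \<in> {\<lambda>x. f x + g x | f g. f \<in> coset s \<and> g \<in> coset t}"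
      using leval_in_coset[OF assms(1)] by blast
  qed
  finally show ?thesis .
qed

lemma quot_le:
  assumes "s \<in> KT" "t \<in> KT"
  shows "lgroup_le quot (coset s) (coset t) \<longleftrightarrow> LSup (LAdd s (LNeg t)) LZero \<in> J"
proof
  assume "lgroup_le quot (coset s) (coset t)"
  then obtain p q where pq: "p \<in> KT" "q \<in> KT" "coset s = coset p" "coset t = coset q" "LSup (LAdd p (LNeg q)) LZero \<in> J"
    by (auto simp: quot_def)
  have "LAdd s (LNeg p) \<in> J" "LAdd t (LNeg q) \<in> J"
    using pq coset_eq_iff[OF assms(1) pq(1)] coset_eq_iff[OF assms(2) pq(2)] by auto
  from this pq(5) show "LSup (LAdd s (LNeg t)) LZero \<in> J" by (rule J_intro) (use pq assms in auto)
next
  assume "LSup (LAdd s (LNeg t)) LZero \<in> J"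
  then show "lgroup_le quot (coset s) (coset t)" using assms by (auto simp: quot_def)
qed

lemma quot_comm_group: "comm_group quot"
proof (rule comm_groupI)
  show "x \<otimes>\<^bsub>quot\<^esub> y \<in> carrier quot" if "x \<in> carrier quot" "y \<in> carrier quot" for x y
    using that unfolding quot_carrier by (auto simp: quot_mult)
  show "\<one>\<^bsub>quot\<^esub> \<in> carrier quot" unfolding quot_carrier quot_one by auto
  show "x \<otimes>\<^bsub>quot\<^esub> y \<otimes>\<^bsub>quot\<^esub> z = x \<otimes>\<^bsub>quot\<^esub> (y \<otimes>\<^bsub>quot\<^esub> z)" if "x \<in> carrier quot" "y \<in> carrier quot" "z \<in> carrier quot" for x y z
    using that unfolding quot_carrier
    by (clarsimp simp: quot_mult) (rule coset_eqI; simp)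
  show "x \<otimes>\<^bsub>quot\<^esub> y = y \<otimes>\<^bsub>quot\<^esub> x" if "x \<in> carrier quot" "y \<in> carrier quot" for x y
    using that unfolding quot_carrier
    by (clarsimp simp: quot_mult) (rule coset_eqI; simp)
  show "\<one>\<^bsub>quot\<^esub> \<otimes>\<^bsub>quot\<^esub> x = x" if "x \<in> carrier quot" for x
    using that unfolding quot_carrier quot_one
    by (clarsimp simp: quot_mult) (rule coset_eqI; simp)
  show "\<exists>y\<in>carrier quot. y \<otimes>\<^bsub>quot\<^esub> x = \<one>\<^bsub>quot\<^esub>" if "x \<in> carrier quot" for x
  proof -
    obtain t where t: "t \<in> KT" "x = coset t" using \<open>x \<in> carrier quot\<close> unfolding quot_carrier by blast
    have "coset (LNeg t) \<otimes>\<^bsub>quot\<^esub> x = \<one>\<^bsub>quot\<^esub>"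
      unfolding t(2) quot_one using t(1)
      by (clarsimp simp: quot_mult) (rule coset_eqI; simp)
    then show ?thesis using t(1) unfolding quot_carrier by (intro bexI[of _ "coset (LNeg t)"]) auto
  qed
qed

lemma quot_abelian_lgroup: "abelian_lgroup quot"
  unfolding abelian_lgroup_def
proof (intro conjI ballI impI)
  show "comm_group quot" by (rule quot_comm_group)
  have rep: "\<exists>t\<in>KT. x = coset t" if "x \<in> carrier quot" for x using that unfolding quot_carrier by blast
  show "Lattice.lattice (lgroup_order quot)"
  proof (rule lgroup_order_latticeI)
    fix x y assume "x \<in> carrier quot" "y \<in> carrier quot"
    then obtain s t where st: "s \<in> KT" "x = coset s" "t \<in> KT" "y = coset t" using rep by blast
    show "lgroup_le quot x x"
      unfolding st(2,4) quot_le[OF st(1) st(1)] by (rule J_trivial) (use st in auto)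
    show "x = y" if "lgroup_le quot x y" "lgroup_le quot y x"
      using that unfolding st(2,4) quot_le[OF st(1) st(3)] quot_le[OF st(3) st(1)] coset_eq_iff[OF st(1) st(3)]
      by (rule J_intro2) (use st in auto)
    show "lgroup_le quot x z" if z: "z \<in> carrier quot" "lgroup_le quot x y" "lgroup_le quot y z" for z
    proof -
      obtain u where u: "u \<in> KT" "z = coset u" using rep[OF z(1)] by blast
      show ?thesis using z(2,3) unfolding st(2,4) u(2) quot_le[OF st(1) st(3)] quot_le[OF st(3) u(1)] quot_le[OF st(1) u(1)]
        by (rule J_intro2) (use st u in auto)
    qed
    show "\<exists>j\<in>carrier quot. lgroup_le quot x j \<and> lgroup_le quot y j \<and>
      (\<forall>z\<in>carrier quot. lgroup_le quot x z \<and> lgroup_le quot y z \<longrightarrow> lgroup_le quot j z)"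
    proof (intro bexI[of _ "coset (LSup s t)"] conjI ballI impI)
      have c: "LSup s t \<in> KT" using st by simp
      show "coset (LSup s t) \<in> carrier quot" using c unfolding quot_carrier by blast
      show "lgroup_le quot x (coset (LSup s t))" "lgroup_le quot y (coset (LSup s t))"
        unfolding st(2,4) quot_le[OF st(1) c] quot_le[OF st(3) c] using st by (auto intro!: J_trivial)
      fix z assume "z \<in> carrier quot" and z: "lgroup_le quot x z \<and> lgroup_le quot y z"
      then obtain u where u: "u \<in> KT" "z = coset u" using rep by blast
      show "lgroup_le quot (coset (LSup s t)) z"
        using z[THEN conjunct1] z[THEN conjunct2]
        unfolding st(2,4) u(2) quot_le[OF st(1) u(1)] quot_le[OF st(3) u(1)] quot_le[OF c u(1)]
        by (rule J_intro2) (use st u in auto)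
    qed
    show "\<exists>j\<in>carrier quot. lgroup_le quot j x \<and> lgroup_le quot j y \<and>
      (\<forall>z\<in>carrier quot. lgroup_le quot z x \<and> lgroup_le quot z y \<longrightarrow> lgroup_le quot z j)"
    proof (intro bexI[of _ "coset (linf s t)"] conjI ballI impI)
      have c: "linf s t \<in> KT" using st by simp
      show "coset (linf s t) \<in> carrier quot" using c unfolding quot_carrier by blast
      show "lgroup_le quot (coset (linf s t)) x" "lgroup_le quot (coset (linf s t)) y"
        unfolding st(2,4) quot_le[OF c st(1)] quot_le[OF c st(3)] using st by (auto intro!: J_trivial)
      fix z assume "z \<in> carrier quot" and z: "lgroup_le quot z x \<and> lgroup_le quot z y"
      then obtain u where u: "u \<in> KT" "z = coset u" using rep by blast
      show "lgroup_le quot z (coset (linf s t))"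
        using z[THEN conjunct1] z[THEN conjunct2]
        unfolding st(2,4) u(2) quot_le[OF u(1) st(1)] quot_le[OF u(1) st(3)] quot_le[OF u(1) c]
        by (rule J_intro2) (use st u in auto)
    qed
  qed
  fix x y z assume "x \<in> carrier quot" "y \<in> carrier quot" "z \<in> carrier quot" and le: "lgroup_le quot x y"
  then obtain s t u where st: "s \<in> KT" "x = coset s" "t \<in> KT" "y = coset t" "u \<in> KT" "z = coset u" using rep by meson
  have c: "LAdd s u \<in> KT" "LAdd t u \<in> KT" using st by auto
  show "lgroup_le quot (x \<otimes>\<^bsub>quot\<^esub> z) (y \<otimes>\<^bsub>quot\<^esub> z)"
    using le unfolding st(2,4,6) quot_mult[OF st(1,5)] quot_mult[OF st(3,5)] quot_le[OF c] quot_le[OF st(1,3)]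
    by (rule J_intro1) (use st in auto)
qed

sublocale quot: l_group quot by unfold_locales (rule quot_abelian_lgroup)

lemma quot_inv: "t \<in> KT \<Longrightarrow> inv\<^bsub>quot\<^esub> coset t = coset (LNeg t)"
proof (rule quot.inv_equality)
  assume t: "t \<in> KT"
  show "coset (LNeg t) \<otimes>\<^bsub>quot\<^esub> coset t = \<one>\<^bsub>quot\<^esub>"
    unfolding quot_one using t by (clarsimp simp: quot_mult) (rule coset_eqI; simp)
qed (auto simp: quot_carrier)

lemma quot_join:
  assumes "s \<in> KT" "t \<in> KT" shows "lgroup_join quot (coset s) (coset t) = coset (LSup s t)"
proof (rule quot.lle_antisym)
  have c: "LSup s t \<in> KT" using assms by simp
  have st: "coset s \<in> carrier quot" "coset t \<in> carrier quot" "coset (LSup s t) \<in> carrier quot"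
    using assms c unfolding quot_carrier by blast+
  show j: "lgroup_join quot (coset s) (coset t) \<in> carrier quot" using st quot.join_carrier by simp
  show "coset (LSup s t) \<in> carrier quot" by (rule st(3))
  have "lgroup_le quot (coset s) (coset (LSup s t))" "lgroup_le quot (coset t) (coset (LSup s t))"
    unfolding quot_le[OF assms(1) c] quot_le[OF assms(2) c] using assms by (auto intro!: J_trivial)
  then show "lgroup_le quot (lgroup_join quot (coset s) (coset t)) (coset (LSup s t))"
    using st by (intro quot.join_least) auto
  obtain u where u: "u \<in> KT" "lgroup_join quot (coset s) (coset t) = coset u" using j unfolding quot_carrier by blast
  have "lgroup_le quot (coset s) (coset u)" "lgroup_le quot (coset t) (coset u)"
    using quot.join_upper1[OF st(1,2)] quot.join_upper2[OF st(1,2)] unfolding u(2) by auto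
  then show "lgroup_le quot (coset (LSup s t)) (lgroup_join quot (coset s) (coset t))"
    unfolding u(2) quot_le[OF assms(1) u(1)] quot_le[OF assms(2) u(1)] quot_le[OF c u(1)]
    by (rule J_intro2) (use assms u in auto)
qed

lemma quot_lgeval: "t \<in> KT \<Longrightarrow> quot.lgeval (\<lambda>i. coset (LVar i)) t = coset t"
  by (induction t) (auto simp: quot_one quot_mult quot_inv quot_join)

end

proposition closed_subset_of_fan_space_spectrum:
  fixes K :: "'k set"
  assumes T: "cylinder_fan_based K T" and Y: "closedin T Y"
    and M: "{x \<in> Y. closedin (subtopology T Y) {x}} = {M}"
  shows "\<exists>G :: (('k \<Rightarrow> real) \<Rightarrow> real) set lgroup.
    abelian_lgroup G \<and> subtopology T (Y - {M}) homeomorphic_space lgroup_spectrum G"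
proof -
  obtain W where "fan_space K T W" using cylinder_fan_based_fan_space[OF T] by blast
  then interpret fan_space K T W .
  obtain v where vY: "v \<in> K \<rightarrow> {0, 1}" "Y \<subseteq> fibre v" using closed_subset_in_fibre[OF Y M] by blast
  have MY: "M \<in> Y" using M by blast
  \<comment> \<open>An intersection of prime families need not be prime, but it is an ideal, and the
    quotient by it is the required group.\<close>
  define J where "J = (\<Inter>y\<in>Y. family v y)"
  have pf: "prime_family K (family v y)" if "y \<in> Y" for y using prime_family_family vY(2) that by blast
  interpret term_ideal K J
  proof
    show "lvars t \<subseteq> K" if "t \<in> J" for t using that MY unfolding J_def family_def by blast
    show "LZero \<in> J" unfolding J_def using pf unfolding prime_family_def by simp
    show "u \<in> J" if st: "s \<in> J" "t \<in> J" "lvars u \<subseteq> K" "zero_set s \<inter> zero_set t \<subseteq> zero_set u" for s t u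
      unfolding J_def
    proof
      fix y assume y: "y \<in> Y"
      then have "s \<in> family v y" "t \<in> family v y" using st unfolding J_def by auto
      then show "u \<in> family v y"
        using pf[OF y, unfolded prime_family_def, THEN conjunct2, THEN conjunct2, THEN conjunct1, rule_format, OF _ _ st(3,4)]
        by blast
    qed
  qed
  interpret lgroup_rep K T W quot "\<lambda>i. coset (LVar i)" v
  proof unfold_locales
    show "coset (LVar i) \<in> carrier quot" if "i \<in> K" for i using that unfolding quot_carrier by auto
    show "lgroup_le quot \<one>\<^bsub>quot\<^esub> (coset (LVar i))" if "i \<in> K" for i
      unfolding quot_one using that by (subst quot_le) (auto intro!: J_trivial)
    show "\<exists>t. lvars t \<subseteq> K \<and> quot.lgeval (\<lambda>i. coset (LVar i)) t = g" if "g \<in> carrier quot" for g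
      using that quot_lgeval unfolding quot_carrier by blast
  qed (rule vY(1))
  have one: "quot.lgeval (\<lambda>i. coset (LVar i)) t = \<one>\<^bsub>quot\<^esub> \<longleftrightarrow> t \<in> J" if t: "lvars t \<subseteq> K" for t
  proof -
    have "coset t = coset LZero \<longleftrightarrow> LAdd t (LNeg LZero) \<in> J" using t by (intro coset_eq_iff) auto
    also have "\<dots> \<longleftrightarrow> t \<in> J"
      using t J_intro1[of t "LAdd t (LNeg LZero)"] J_intro1[of "LAdd t (LNeg LZero)" t] by auto
    finally show ?thesis unfolding quot_one using quot_lgeval t by simp
  qed
  \<comment> \<open>By \<open>one\<close> the kernel of the evaluation is \<open>J\<close>, so
    \<open>rep_points\<close> consists of the points of the fibre whose family contains
    \<open>J\<close>; a nonempty closed set is recovered from its common terms.\<close>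
  have "rep_points = Y"
  proof (intro equalityI subsetI)
    fix x assume "x \<in> rep_points"
    then have "x \<in> fibre v" "J \<subseteq> family v x" using one J_lvars unfolding rep_points_def by auto
    then show "x \<in> Y" using closed_subset_families[OF Y vY(2), of x] MY unfolding J_def by blast
  next
    fix x assume "x \<in> Y"
    moreover have "t \<in> family v x" if "t \<in> J" for t using that \<open>x \<in> Y\<close> unfolding J_def by blast
    ultimately show "x \<in> rep_points" using vY(2) one unfolding rep_points_def by auto
  qed
  then obtain M' where "{x \<in> Y. closedin (subtopology T Y) {x}} = {M'}"
    "subtopology T (Y - {M'}) homeomorphic_space lgroup_spectrum quot" using rep_points_spectrum by auto
  moreover from this have "M' = M" using M by simp
  ultimately show ?thesis using quot_abelian_lgroup by blast
qed

text \<open>Each implication has its own type variables, since types cannot be quantified: the space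
  is built over the type of \<open>G\<close>, and the group over the type of the index set.\<close>

theorem theorem1p1:
  fixes X :: "'a topology"
  shows
    "(\<forall>G :: 'g lgroup.
        abelian_lgroup G \<and> X homeomorphic_space lgroup_spectrum G \<longrightarrow>
        (\<exists>(K :: 'g set) (T :: ('g \<Rightarrow> int \<times> real) set set topology) Y M.
           cylinder_fan_based K T \<and> closedin T Y \<and>
           {x \<in> Y. closedin (subtopology T Y) {x}} = {M} \<and>
           X homeomorphic_space subtopology T (Y - {M})))
     \<and>
     (\<forall>(K :: 'k set) (T :: 't topology) Y M.
        cylinder_fan_based K T \<and> closedin T Y \<and>
        {x \<in> Y. closedin (subtopology T Y) {x}} = {M} \<and>
        X homeomorphic_space subtopology T (Y - {M}) \<longrightarrow>
        (\<exists>G :: (('k \<Rightarrow> real) \<Rightarrow> real) set lgroup.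
           abelian_lgroup G \<and> X homeomorphic_space lgroup_spectrum G))"
proof (intro conjI allI impI; elim conjE)
  fix G :: "'g lgroup"
  assume G: "abelian_lgroup G" and X: "X homeomorphic_space lgroup_spectrum G"
  let ?T = "stone_space (cylinder_fans (carrier G))"
  obtain Y M where YM: "closedin ?T Y" "{x \<in> Y. closedin (subtopology ?T Y) {x}} = {M}"
    "lgroup_spectrum G homeomorphic_space subtopology ?T (Y - {M})"
    using spectrum_closed_subset_of_fan_space[OF G] by (elim exE conjE)
  have "X homeomorphic_space subtopology ?T (Y - {M})" using X YM(3) by (rule homeomorphic_space_trans)
  then show "\<exists>(K :: 'g set) (T :: ('g \<Rightarrow> int \<times> real) set set topology) Y M.
      cylinder_fan_based K T \<and> closedin T Y \<and> {x \<in> Y. closedin (subtopology T Y) {x}} = {M} \<and>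
      X homeomorphic_space subtopology T (Y - {M})"
    using cylinder_fan_based_stone_space YM(1,2) by (intro exI conjI)
next
  fix K :: "'k set" and T :: "'t topology" and Y M
  assume K: "cylinder_fan_based K T" "closedin T Y" "{x \<in> Y. closedin (subtopology T Y) {x}} = {M}"
    and X: "X homeomorphic_space subtopology T (Y - {M})"
  obtain G :: "(('k \<Rightarrow> real) \<Rightarrow> real) set lgroup" where G: "abelian_lgroup G"
    "subtopology T (Y - {M}) homeomorphic_space lgroup_spectrum G"
    using closed_subset_of_fan_space_spectrum[OF K] by (elim exE conjE)
  have "X homeomorphic_space lgroup_spectrum G" using X G(2) by (rule homeomorphic_space_trans)
  then show "\<exists>G :: (('k \<Rightarrow> real) \<Rightarrow> real) set lgroup. abelian_lgroup G \<and> X homeomorphic_space lgroup_spectrum G"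
    using G(1) by blast
qed

end
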